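(* As $n\to\infty$, \[ r_{2,1}(n)\sim \frac{3^{1/4}\phi^{1/2}}{5\pi} n^{-1/4}e^{2\pi\sqrt{n/15}} \qquad\text{and}\qquad r_{2,2}(n)\sim\frac{3^{5/4}\phi^{1/2}}{10\pi} n^{-1/4}e^{2\pi\sqrt{n/15}}, \] where $\phi=\frac{1+\sqrt5}{2}$ is the golden ratio.
   Context: A partition $\lambda=(\lambda_1\ge \lambda_2\ge\cdots\ge\lambda_k)$ of $n$ is a weakly decreasing sequence of positive integers summing to $n$; its conjugate is $\lambda'$ with $\lambda'_j=\#\{i:\lambda_i\ge j\}$. For the cell in row $i$ and column $j$ of the Young diagram of $\lambda$, its hook length is $h(i,j)=\lambda_i+\lambda'_j-i-j+1$. A $t$-hook is a cell with hook length $t$. For a positive integer $t$, $r_{2,t}(n)$ denotes the total number of $t$-hooks, summed over all partitions of $n$ all of whose parts are congruent to $1$ or $4$ modulo $5$. *)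

theory Defs
  imports Complex_Main "HOL-Library.Landau_Symbols"
begin

text \<open>Partitions are weakly decreasing lists of positive integers. As in the usual notation,
  rows and columns are numbered from 1.\<close>

definition is_partition :: "nat list \<Rightarrow> nat \<Rightarrow> bool" where
  "is_partition xs n \<longleftrightarrow> sorted_wrt (\<ge>) xs \<and> (\<forall>x \<in> set xs. x > 0) \<and> sum_list xs = n"

definition row_length :: "nat list \<Rightarrow> nat \<Rightarrow> nat" where
  "row_length xs i = xs ! (i - 1)"

definition conj_part :: "nat list \<Rightarrow> nat \<Rightarrow> nat" where
  "conj_part xs j = card {i \<in> {1..length xs}. row_length xs i \<ge> j}"

definition young_diagram :: "nat list \<Rightarrow> (nat \<times> nat) set" where
  "young_diagram xs = {(i, j). i \<in> {1..length xs} \<and> j \<in> {1..row_length xs i}}"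

text \<open>Computed in the integers, so that no subtraction is truncated.\<close>

definition hook_length :: "nat list \<Rightarrow> nat \<Rightarrow> nat \<Rightarrow> int" where
  "hook_length xs i j = int (row_length xs i) + int (conj_part xs j) - int i - int j + 1"

definition hooks :: "nat \<Rightarrow> nat list \<Rightarrow> (nat \<times> nat) set" where
  "hooks t xs = {(i, j) \<in> young_diagram xs. hook_length xs i j = int t}"

definition partitions_1_4_mod_5 :: "nat \<Rightarrow> nat list set" where
  "partitions_1_4_mod_5 n =
     {xs. is_partition xs n \<and> (\<forall>x \<in> set xs. x mod 5 = 1 \<or> x mod 5 = 4)}"

definition r2 :: "nat \<Rightarrow> nat \<Rightarrow> nat" where
  "r2 t n = (\<Sum>xs \<in> partitions_1_4_mod_5 n. card (hooks t xs))"

definition golden_ratio :: real where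
  "golden_ratio = (1 + sqrt 5) / 2"

text \<open>The sum and the cardinalities in the definition of \<^const>\<open>r2\<close> range over finite sets.\<close>

lemma finite_partitions_1_4_mod_5: "finite (partitions_1_4_mod_5 n)"
proof (rule finite_subset)
  have len: "length xs \<le> sum_list xs" if "\<forall>x \<in> set xs. x > 0" for xs :: "nat list"
    using that by (induction xs) auto
  show "partitions_1_4_mod_5 n \<subseteq> {xs. set xs \<subseteq> {..n} \<and> length xs \<le> n}"
    using len member_le_sum_list
    by (fastforce simp: partitions_1_4_mod_5_def is_partition_def)
  show "finite {xs. set xs \<subseteq> {..n} \<and> length xs \<le> n}"
    by (rule finite_lists_length_le) simp
qed

lemma finite_young_diagram: "finite (young_diagram xs)"
proof -
  have "young_diagram xs = (SIGMA i:{1..length xs}. {1..row_length xs i})"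
    by (auto simp: young_diagram_def)
  then show ?thesis
    by simp
qed

lemma finite_hooks: "finite (hooks t xs)"
  by (rule finite_subset[OF _ finite_young_diagram[of xs]]) (auto simp: hooks_def)

end

theory Submission
  imports Defs "HOL-Complex_Analysis.Complex_Analysis" "HOL-Probability.Probability"
    "HOL-Real_Asymp.Real_Asymp"
begin

text \<open>
  A \<open>1\<close>-hook is a distinct part size, and a \<open>2\<close>-hook is either a part size \<open>m \<ge> 2\<close> with
  \<open>m - 1\<close> not a part or a part size of multiplicity at least \<open>2\<close>; for parts congruent to
  \<open>1\<close> or \<open>4\<close> modulo \<open>5\<close> the condition on \<open>m - 1\<close> is void. With \<open>q = exp (- s)\<close>,
  \<open>F(s) = \<Sum> q^m\<close> over the admissible part sizes \<open>m\<close>, and \<open>P(s)\<close> the generating function of the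
  partitions, the two hook counts therefore have the generating functions \<open>F(s) P(s)\<close> and
  \<open>(F(s) - q + F(2s)) P(s)\<close>.

  In \<open>log P(s) = \<Sum>k. F(ks) / k\<close> the polar part \<open>2 / (5s)\<close> of \<open>F\<close> contributes \<open>\<pi>\<^sup>2 / (15 s)\<close>; the rest
  is a Riemann sum of step \<open>s\<close>, bounded in a sector and convergent as \<open>s \<rightarrow> 0\<close>. Its limit is found
  on the real axis by writing \<open>P\<^sup>2\<close> as the product over all parts prime to \<open>5\<close>, which is a
  quotient of two partition generating functions, times the product with the residue
  character modulo \<open>5\<close>, which tends to \<open>sin (2\<pi>/5) / sin (\<pi>/5) = \<phi>\<close>. Off the sector,
  \<open>\<bar>F(x + iy)\<bar> \<le> \<rho> F(x)\<close> with \<open>\<rho> < 1\<close> makes \<open>P\<close> exponentially smaller than at the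
  saddle point, and the coefficients follow from Cauchy's formula by dominated convergence.
\<close>

section \<open>Hooks and partitions\<close>

text \<open>The residues 1 and 4 are negatives of each other modulo 5, and so \<open>F14 s\<close>
  equals cosh (3s/2) / sinh (5s/2), an odd function. Removing its pole 2 / (5s) therefore leaves no
  constant term, the quotient by s stays bounded at the origin, and log P has no logarithmic term.
  The limit of the Riemann sum is an integral that is never evaluated directly. Twice the indicator
  of the residues 1 and 4 is the indicator of the residues prime to 5 plus the residue character.
  The first of these gives a difference of two copies of one sum, at the scales x and 5x; both
  copies tend to the same unknown integral, which cancels. What survives is half the logarithm of (1
  - exp (-x)) / (1 - exp (-5x)), which tends to - ln 5 / 2. The power of n is read off at the
  saddle. With N of order n^(1/2), the saddle point has abscissa of order 1/N and width of order
  N^(-3/2), and the pole of the hook factor contributes N; the product has order N^(-1/2), that is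
  n^(-1/4). The two hook counts differ only in the residue of that pole, 2/5 against 2/5 +
  1/5.\<close>

lemma conj_part_galois:
  assumes "sorted_wrt (\<ge>) xs" and i: "1 \<le> i" "i \<le> length xs"
  shows "j \<le> row_length xs i \<longleftrightarrow> i \<le> conj_part xs j"
proof -
  define I where "I = {i \<in> {1..length xs}. row_length xs i \<ge> j}"
  \<comment> \<open>The rows of length at least \<open>j\<close> form an initial segment, so their
    number is the index of the last of them.\<close>
  have down: "i' \<in> I" if "i \<in> I" "1 \<le> i'" "i' \<le> i" for i i'
  proof -
    have "xs ! (i - 1) \<le> xs ! (i' - 1)"
    proof (cases "i' = i")
      case False
      then show ?thesis
        using that sorted_wrt_nth_less[OF assms(1), of "i' - 1" "i - 1"]
        by (auto simp: I_def)
    qed simp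
    then show ?thesis
      using that by (auto simp: I_def row_length_def)
  qed
  have fin: "finite I" by (simp add: I_def)
  show ?thesis
  proof
    assume "j \<le> row_length xs i"
    then have "i \<in> I" using i by (auto simp: I_def)
    then have "{1..i} \<subseteq> I" using down by auto
    then show "i \<le> conj_part xs j"
      using card_mono[OF fin, of "{1..i}"] by (simp add: conj_part_def I_def)
  next
    assume le: "i \<le> conj_part xs j"
    have "i \<in> I"
    proof (rule ccontr)
      assume "i \<notin> I"
      then have "I \<subseteq> {1..<i}"
        using down[of _ i] i by (fastforce simp: not_less I_def)
      then have "card I \<le> i - 1"
        using card_mono[of "{1..<i}" I] by simp
      then show False using le i by (simp add: conj_part_def I_def)
    qed
    then show "j \<le> row_length xs i" by (simp add: I_def)
  qed
qed

lemma conj_part_le_length: "conj_part xs j \<le> length xs"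
proof -
  have "conj_part xs j \<le> card {1..length xs}"
    unfolding conj_part_def by (rule card_mono) auto
  then show ?thesis by simp
qed

lemma set_eq_rows: "set xs = row_length xs ` {1..length xs}"
proof -
  have "set xs = (\<lambda>i. xs ! i) ` {0..<length xs}"
    by (auto simp: in_set_conv_nth)
  also have "{0..<length xs} = (\<lambda>i. i - 1) ` {1..length xs}"
    using image_Suc_atLeastLessThan[of 0 "length xs"]
    by (metis (no_types, lifting) diff_Suc_1 image_cong image_ident image_image atLeastLessThanSuc_atLeastAtMost One_nat_def)
  finally show ?thesis
    by (simp add: image_image row_length_def)
qed

lemma count_mset_eq_card_rows:
  "count (mset xs) m = card {i \<in> {1..length xs}. row_length xs i = m}"
proof -
  have "count (mset xs) m = card {i. i < length xs \<and> xs ! i = m}"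
    by (simp add: count_mset count_list_eq_length_filter length_filter_conv_card eq_commute)
  also have "{i \<in> {1..length xs}. row_length xs i = m} = Suc ` {i. i < length xs \<and> xs ! i = m}"
  proof (intro equalityI subsetI)
    fix i assume "i \<in> {i \<in> {1..length xs}. row_length xs i = m}"
    then show "i \<in> Suc ` {i. i < length xs \<and> xs ! i = m}"
      by (cases i) (auto simp: row_length_def)
  qed (auto simp: row_length_def)
  then have "card {i. i < length xs \<and> xs ! i = m} = card {i \<in> {1..length xs}. row_length xs i = m}"
    by (simp add: card_image)
  finally show ?thesis .
qed

text \<open>For a cell of the diagram both \<open>j \<le> row_length xs i\<close> and
  \<open>i \<le> conj_part xs j\<close> hold, so hook length 1 forces equality twice: the cell is
  the corner that ends the block of rows of length \<open>j\<close>.\<close>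

lemma card_hooks_1:
  assumes sorted: "sorted_wrt (\<ge>) xs" and pos: "\<forall>x \<in> set xs. x > 0"
  shows "card (hooks 1 xs) = card (set xs)"
proof -
  let ?r = "row_length xs" and ?c = "conj_part xs" and ?l = "length xs"
  note gal = conj_part_galois[OF sorted]
  have "hooks 1 xs = (\<lambda>m. (?c m, m)) ` set xs"
  proof (intro equalityI subrelI)
    fix i j assume "(i, j) \<in> hooks 1 xs"
    then have i: "1 \<le> i" "i \<le> ?l" and j: "1 \<le> j" "j \<le> ?r i"
      and h: "int (?r i) + int (?c j) - int i - int j = 0"
      by (auto simp: hooks_def young_diagram_def hook_length_def)
    have "i \<le> ?c j" using gal i j by blast
    then have "?r i = j" "i = ?c j" using h j by linarith+
    moreover from this have "j \<in> set xs" using i by (force simp: set_eq_rows)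
    ultimately show "(i, j) \<in> (\<lambda>m. (?c m, m)) ` set xs"
      by blast
  next
    fix i j assume "(i, j) \<in> (\<lambda>m. (?c m, m)) ` set xs"
    then obtain i' where ij: "i = ?c j" "j = ?r i'" "1 \<le> i'" "i' \<le> ?l"
      by (auto simp: set_eq_rows)
    have j: "1 \<le> j" using pos ij by (force simp: set_eq_rows)
    have "i' \<le> i" using gal[of i' j] ij by simp
    then have i: "1 \<le> i" "i \<le> ?l" using ij conj_part_le_length by auto
    have "j \<le> ?r i" using gal[OF i, of j] ij by simp
    moreover have "?r i \<le> j"
    proof -
      have "i' \<le> ?c (?r i)" using gal[OF i, of "?r i"] \<open>i' \<le> i\<close> by simp
      then show ?thesis using gal[of i' "?r i"] ij by simp
    qed
    ultimately show "(i, j) \<in> hooks 1 xs"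
      using i j ij(1) by (auto simp: hooks_def young_diagram_def hook_length_def)
  qed
  moreover have "inj_on (\<lambda>m. (?c m, m)) (set xs)"
    by (auto simp: inj_on_def)
  ultimately show ?thesis by (simp add: card_image)
qed

text \<open>Arm and leg add up to 1. Arm 1 and leg 0 mean that the last row reaching column
  \<open>m - 1\<close> has length \<open>m\<close>, so that no row has length \<open>m - 1\<close>;
  arm 0 and leg 1 mean that the cell lies directly above a corner, so that the length of its row is
  repeated. The maps \<open>f\<close> and \<open>g\<close> send a part size to the cell in
  question.\<close>

lemma card_hooks_2:
  assumes sorted: "sorted_wrt (\<ge>) xs" and pos: "\<forall>x \<in> set xs. x > 0"
  shows "card (hooks 2 xs) =
           card {m \<in> set xs. 2 \<le> m \<and> m - 1 \<notin> set xs} + card {m \<in> set xs. 2 \<le> count (mset xs) m}"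
proof -
  let ?r = "row_length xs" and ?c = "conj_part xs" and ?l = "length xs"
  note gal = conj_part_galois[OF sorted]
  have mono: "?r i \<le> ?r i'" if "1 \<le> i'" "i' \<le> i" "i \<le> ?l" for i i'
    using gal[of i "?r i"] gal[of i' "?r i"] that by auto
  define A where "A = {m \<in> set xs. 2 \<le> m \<and> m - 1 \<notin> set xs}"
  define B where "B = {m \<in> set xs. 2 \<le> count (mset xs) m}"
  define f where "f = (\<lambda>m. (?c (m - 1), m - 1))"
  define g where "g = (\<lambda>m. (?c m - 1, m))"
  have "hooks 2 xs = f ` A \<union> g ` B"
  proof (intro equalityI subrelI)
    fix i j assume "(i, j) \<in> hooks 2 xs"
    then have i: "1 \<le> i" "i \<le> ?l" and j: "1 \<le> j" "j \<le> ?r i"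
      and h: "int (?r i) + int (?c j) - int i - int j = 1"
      by (auto simp: hooks_def young_diagram_def hook_length_def)
    have "i \<le> ?c j" using gal i j by blast
    then consider "?r i = j + 1" "i = ?c j" | "?r i = j" "?c j = i + 1"
      using h j by linarith
    then show "(i, j) \<in> f ` A \<union> g ` B"
    proof cases
      case 1
      have "j \<notin> set xs"
      proof
        assume "j \<in> set xs"
        then obtain i' where i': "1 \<le> i'" "i' \<le> ?l" "?r i' = j" by (auto simp: set_eq_rows)
        then have "i' \<le> i" using gal[of i' j] 1 by simp
        then show False using mono[of i' i] i i' 1 by simp
      qed
      moreover have "j + 1 \<in> set xs" using 1 i by (force simp: set_eq_rows)
      ultimately have "j + 1 \<in> A" using j by (simp add: A_def)
      then show ?thesis using 1 by (force simp: f_def)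
    next
      case 2
      have l: "i + 1 \<le> ?l" using conj_part_le_length[of xs j] 2 by simp
      have "?r (i + 1) = j"
        using gal[of "i + 1" j] l 2 mono[of i "i + 1"] i by force
      then have "{i, i + 1} \<subseteq> {i \<in> {1..?l}. ?r i = j}" using 2 i l by auto
      then have "2 \<le> count (mset xs) j"
        unfolding count_mset_eq_card_rows using card_mono[of "{i \<in> {1..?l}. ?r i = j}" "{i, i+1}"]
        by simp
      moreover have "j \<in> set xs" using 2 i by (force simp: set_eq_rows)
      ultimately have "j \<in> B" by (simp add: B_def)
      then show ?thesis using 2 by (force simp: g_def)
    qed
  next
    fix i j assume "(i, j) \<in> f ` A \<union> g ` B"
    then consider "(i, j) \<in> f ` A" | "(i, j) \<in> g ` B" by blast
    then show "(i, j) \<in> hooks 2 xs"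
    proof cases
      case 1
      then have ij: "i = ?c j" "j + 1 \<in> set xs" "1 \<le> j" "j \<notin> set xs"
        by (auto simp: f_def A_def)
      then obtain i' where i': "1 \<le> i'" "i' \<le> ?l" "?r i' = j + 1" by (auto simp: set_eq_rows)
      then have "i' \<le> i" using gal[of i' j] ij by simp
      then have i: "1 \<le> i" "i \<le> ?l" using i' ij conj_part_le_length by auto
      have "j \<le> ?r i" using gal[OF i, of j] ij by simp
      moreover have "?r i \<noteq> j" using ij i by (force simp: set_eq_rows)
      moreover have "?r i \<le> j + 1" using mono[of i' i] i' i \<open>i' \<le> i\<close> by simp
      ultimately have "?r i = j + 1" by simp
      then show ?thesis
        using i ij by (auto simp: hooks_def young_diagram_def hook_length_def)
    next
      case 2
      then have ij: "i = ?c j - 1" "j \<in> set xs" "2 \<le> count (mset xs) j"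
        by (auto simp: g_def B_def)
      have j: "1 \<le> j" using pos ij by force
      define I where "I = {i \<in> {1..?l}. ?r i = j}"
      have "2 \<le> card I" using ij by (simp add: I_def count_mset_eq_card_rows)
      then have "\<not> card I \<le> Suc 0" "finite I" by (simp_all add: I_def)
      then obtain a b where ab: "a \<in> I" "b \<in> I" "a < b"
        by (metis card_le_Suc0_iff_eq linorder_neqE_nat)
      then have "b \<le> ?c j" using gal[of b j] by (auto simp: I_def)
      then have i: "1 \<le> i" "i \<le> ?l" "a \<le> i" "?c j = i + 1"
        using ij ab conj_part_le_length[of xs j] by (auto simp: I_def)
      then have "j \<le> ?r i" using gal[of i j] by simp
      moreover have "?r i \<le> j" using mono[of a i] ab i by (auto simp: I_def)
      ultimately show ?thesis
        using i j by (auto simp: hooks_def young_diagram_def hook_length_def)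
    qed
  qed
  moreover have "inj_on f A" "inj_on g B"
    by (auto simp: inj_on_def f_def g_def A_def)
  \<comment> \<open>The cells of \<open>f\<close> lie in columns whose number is not a part size,
    those of \<open>g\<close> in columns whose number is one.\<close>
  moreover have "f ` A \<inter> g ` B = {}"
    by (auto simp: f_def g_def A_def B_def)
  moreover have "finite A" "finite B" by (auto simp: A_def B_def)
  ultimately show ?thesis
    by (simp add: card_Un_disjoint card_image del: One_nat_def flip: A_def B_def)
qed

section \<open>Partitions with parts in a given set, as multisets\<close>

definition parts_14 :: "nat set" where
  "parts_14 = {m. m mod 5 = 1 \<or> m mod 5 = 4}"

definition mpartitions :: "nat set \<Rightarrow> nat \<Rightarrow> nat multiset set" where
  "mpartitions S n = {M. set_mset M \<subseteq> S \<and> sum_mset M = n}"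

definition npartitions :: "nat set \<Rightarrow> nat \<Rightarrow> nat" where
  "npartitions S n = card (mpartitions S n)"

lemma count_le_sum_mset:
  fixes M :: "nat multiset"
  shows "count M m * m \<le> sum_mset M"
proof -
  have "replicate_mset (count M m) m \<subseteq># M" by (simp flip: count_le_replicate_mset_subset_eq)
  then obtain N where "M = replicate_mset (count M m) m + N" unfolding mset_subset_eq_exists_conv by blast
  then have "sum_mset M = sum_mset (replicate_mset (count M m) m + N)" by (rule arg_cong)
  then show ?thesis by simp
qed

lemma mult_le_sum_mset:
  fixes M :: "nat multiset"
  assumes "j \<le> count M m"
  shows "j * m \<le> sum_mset M"
  using mult_le_mono1[OF assms, of m] count_le_sum_mset[of M m] by linarith

lemma finite_mpartitions:
  assumes "0 \<notin> S"
  shows "finite (mpartitions S n)"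
proof (rule finite_subset)
  have "size M \<le> sum_mset M" if "0 \<notin># M" for M :: "nat multiset"
    using that by (induction M) (auto simp: Suc_le_eq)
  note size = this
  have le: "x \<le> sum_mset M" if "x \<in># M" for x and M :: "nat multiset"
    using that by (induction M) auto
  have "set xs \<subseteq> {..n} \<and> length xs \<le> n" if "mset xs \<in> mpartitions S n" for xs
    using assms that size[of "mset xs"] le[of _ "mset xs"] by (auto simp: mpartitions_def)
  then show "mpartitions S n \<subseteq> mset ` {xs. set xs \<subseteq> {..n} \<and> length xs \<le> n}"
    by (metis (no_types, lifting) ex_mset image_eqI mem_Collect_eq subsetI)
  show "finite (mset ` {xs::nat list. set xs \<subseteq> {..n} \<and> length xs \<le> n})"
    by (intro finite_imageI finite_lists_length_le) simp
qed

text \<open>Removing \<open>j\<close> copies of \<open>m\<close> is a bijection onto the partitions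
  of \<open>n - j * m\<close>; the case distinction guards the truncated subtraction.\<close>

lemma card_mpartitions_count_ge:
  assumes "m \<in> S"
  shows "card {M \<in> mpartitions S n. j \<le> count M m} = (if j * m \<le> n then npartitions S (n - j * m) else 0)"
proof (cases "j * m \<le> n")
  case True
  have "bij_betw (\<lambda>M. M + replicate_mset j m) (mpartitions S (n - j * m)) {M \<in> mpartitions S n. j \<le> count M m}"
  proof (rule bij_betwI[where g = "\<lambda>M. M - replicate_mset j m"])
    show "(\<lambda>M. M + replicate_mset j m) \<in> mpartitions S (n - j * m) \<rightarrow> {M \<in> mpartitions S n. j \<le> count M m}"
      using assms True by (auto simp: mpartitions_def split: if_splits)
    have "sum_mset (M - replicate_mset j m) = sum_mset M - j * m" if "j \<le> count M m" for M
    proof -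
      have "replicate_mset j m \<subseteq># M" using that by (simp flip: count_le_replicate_mset_subset_eq)
      then show ?thesis
        by (simp add: sum_mset_diff)
    qed
    then show "(\<lambda>M. M - replicate_mset j m) \<in> {M \<in> mpartitions S n. j \<le> count M m} \<rightarrow> mpartitions S (n - j * m)"
      by (auto simp: mpartitions_def dest: in_diffD)
  qed (auto simp flip: count_le_replicate_mset_subset_eq)
  then show ?thesis
    using True by (simp add: npartitions_def bij_betw_same_card)
next
  case False
  have "j * m \<le> n" if "M \<in> mpartitions S n" "j \<le> count M m" for M
    using mult_le_sum_mset[OF that(2)] that(1) by (simp add: mpartitions_def)
  then have "{M \<in> mpartitions S n. j \<le> count M m} = {}" using False by blast
  then show ?thesis using False by (simp only: if_False card.empty)
qed

text \<open>Pairs of a partition and a part size are counted the other way round, which reduces hook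
  totals to values of \<open>npartitions\<close>. The predicate \<open>P\<close> is there for the
  condition \<open>2 \<le> m\<close> of the 2-hooks, and \<open>j\<close> is the multiplicity asked
  for.\<close>

lemma sum_card_count_ge:
  assumes "0 \<notin> S" "j \<ge> 1"
  shows "(\<Sum>M\<in>mpartitions S n. card {m \<in> set_mset M. P m \<and> j \<le> count M m}) =
           (\<Sum>m\<in>{m\<in>S. P m \<and> j * m \<le> n}. npartitions S (n - j * m))"
proof -
  define T where "T = {m \<in> S. P m \<and> j * m \<le> n}"
  have "m \<le> n" if "m \<in> T" for m
    using that assms(2) le_trans[of m "j * m" n] by (simp add: T_def)
  then have "T \<subseteq> {..n}" by blast
  then have fin: "finite T" using finite_subset by blast
  have eq: "{m \<in> set_mset M. P m \<and> j \<le> count M m} = {m \<in> T. j \<le> count M m}" if "M \<in> mpartitions S n" for M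
  proof -
    have "j * m \<le> n" if "j \<le> count M m" for m
      using mult_le_sum_mset[OF that] \<open>M \<in> _\<close> by (simp add: mpartitions_def)
    moreover have "m \<in># M" if "j \<le> count M m" for m
      using that assms(2) by (simp flip: count_greater_zero_iff)
    ultimately show ?thesis using that by (auto simp: T_def mpartitions_def)
  qed
  have "(\<Sum>M\<in>mpartitions S n. card {m \<in> set_mset M. P m \<and> j \<le> count M m}) =
        (\<Sum>M\<in>mpartitions S n. \<Sum>m\<in>T. if j \<le> count M m then 1 else 0)"
    using fin by (intro sum.cong refl) (simp add: eq sum.If_cases Int_def)
  also have "\<dots> = (\<Sum>m\<in>T. card {M \<in> mpartitions S n. j \<le> count M m})"
    using finite_mpartitions[OF assms(1)] by (subst sum.swap) (simp add: sum.If_cases Int_def)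
  also have "\<dots> = (\<Sum>m\<in>T. npartitions S (n - j * m))"
    by (intro sum.cong refl) (simp add: T_def card_mpartitions_count_ge)
  finally show ?thesis by (simp add: T_def)
qed

text \<open>Euler's recurrence: the size of a partition is the sum of \<open>m\<close> over the
  pairs (m, j) such that \<open>m\<close> occurs at least \<open>j\<close> times, and a pair
  contributes to the term \<open>N = j * m\<close>. It is the logarithmic derivative of the Euler
  product in coefficients, and it spares the infinite product itself.\<close>

lemma npartitions_recurrence:
  assumes "0 \<notin> S"
  shows "n * npartitions S n = (\<Sum>N=1..n. (\<Sum>m\<in>{m\<in>S. m dvd N}. m) * npartitions S (n - N))"
proof -
  define T where "T = S \<inter> {..n}"
  have fin: "finite T" by (simp add: T_def)
  have "n * npartitions S n = (\<Sum>M\<in>mpartitions S n. sum_mset M)"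
    by (simp add: npartitions_def mpartitions_def)
  also have "\<dots> = (\<Sum>M\<in>mpartitions S n. \<Sum>m\<in>T. \<Sum>j=1..n. if j \<le> count M m then m else 0)"
  proof (intro sum.cong refl)
    fix M assume M: "M \<in> mpartitions S n"
    have le: "count M m * m \<le> n" for m using count_le_sum_mset[of M m] M by (simp add: mpartitions_def)
    have sub: "set_mset M \<subseteq> T"
    proof
      fix m assume m: "m \<in># M"
      then have "m \<le> n" using le[of m] le_trans[of m "count M m * m" n] by (simp add: Suc_le_eq)
      then show "m \<in> T" using m M by (auto simp: T_def mpartitions_def)
    qed
    have "sum_mset M = (\<Sum>m\<in>set_mset M. m * count M m)"
    proof -
      obtain xs where "mset xs = M" using ex_mset by blast
      then show ?thesis
        using sum_list_map_eq_sum_count[of "\<lambda>x. x" xs]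
        by (auto simp: sum_mset_sum_list count_mset mult.commute)
    qed
    also have "\<dots> = (\<Sum>m\<in>T. m * count M m)"
      using fin sub by (intro sum.mono_neutral_left) (auto simp: not_in_iff)
    also have "\<dots> = (\<Sum>m\<in>T. \<Sum>j=1..n. if j \<le> count M m then m else 0)"
    proof (intro sum.cong refl)
      fix m assume "m \<in> T"
      then have "m \<ge> 1" using assms by (auto simp: T_def Suc_le_eq intro: gr0I)
      then have "count M m \<le> n" using le[of m] le_trans[of "count M m" "count M m * m" n] by simp
      then have "{j \<in> {1..n}. j \<le> count M m} = {1..count M m}" by auto
      then have "(\<Sum>j\<in>{j\<in>{1..n}. j \<le> count M m}. m) = m * count M m" by simp
      then show "m * count M m = (\<Sum>j=1..n. if j \<le> count M m then m else 0)"
        by (subst (asm) sum.inter_filter) auto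
    qed
    finally show "sum_mset M = (\<Sum>m\<in>T. \<Sum>j=1..n. if j \<le> count M m then m else 0)" .
  qed
  also have "\<dots> = (\<Sum>m\<in>T. \<Sum>j=1..n. \<Sum>M\<in>mpartitions S n. if j \<le> count M m then m else 0)"
    by (subst sum.swap, intro sum.cong refl, subst sum.swap, rule refl)
  also have "\<dots> = (\<Sum>m\<in>T. \<Sum>j=1..n. if j * m \<le> n then m * npartitions S (n - j * m) else 0)"
  proof (intro sum.cong refl)
    fix m j assume "m \<in> T"
    have "(\<Sum>M\<in>mpartitions S n. if j \<le> count M m then m else 0) =
          m * card {M \<in> mpartitions S n. j \<le> count M m}"
      using finite_mpartitions[OF assms] by (simp add: sum.If_cases Int_def)
    then show "(\<Sum>M\<in>mpartitions S n. if j \<le> count M m then m else 0) =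
        (if j * m \<le> n then m * npartitions S (n - j * m) else 0)"
      using \<open>m \<in> T\<close> by (simp add: card_mpartitions_count_ge T_def)
  qed
  also have "\<dots> = (\<Sum>m\<in>T. \<Sum>N\<in>{N\<in>{1..n}. m dvd N}. m * npartitions S (n - N))"
  proof (rule sum.cong[OF refl])
    fix m assume "m \<in> T"
    then have m: "m \<ge> 1" using assms by (auto simp: T_def Suc_le_eq intro: gr0I)
    have "(\<Sum>j=1..n. if j * m \<le> n then m * npartitions S (n - j * m) else 0) =
          (\<Sum>j\<in>{j\<in>{1..n}. j * m \<le> n}. m * npartitions S (n - j * m))"
      by (rule sum.inter_filter[symmetric]) simp
    also have "\<dots> = (\<Sum>N\<in>{N\<in>{1..n}. m dvd N}. m * npartitions S (n - N))"
    proof -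
      have "1 \<le> N div m \<and> N div m \<le> n" if "1 \<le> N" "N \<le> n" "m dvd N" for N
        using that m le_trans[OF div_le_dividend[of N m], of n] dvd_imp_le[of m N]
        by (auto simp: Suc_le_eq div_greater_zero_iff)
      then show ?thesis
        using m by (intro sum.reindex_bij_witness[of _ "\<lambda>N. N div m" "\<lambda>j. j * m"]) auto
    qed
    finally show "(\<Sum>j=1..n. if j * m \<le> n then m * npartitions S (n - j * m) else 0) =
      (\<Sum>N\<in>{N\<in>{1..n}. m dvd N}. m * npartitions S (n - N))" .
  qed
  also have "\<dots> = (\<Sum>N=1..n. \<Sum>m\<in>{m\<in>T. m dvd N}. m * npartitions S (n - N))"
    using fin by (intro sum.swap_restrict) auto
  also have "\<dots> = (\<Sum>N=1..n. (\<Sum>m\<in>{m\<in>S. m dvd N}. m) * npartitions S (n - N))"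
  proof (intro sum.cong refl)
    fix N assume "N \<in> {1..n}"
    then have "{m\<in>T. m dvd N} = {m\<in>S. m dvd N}" by (auto simp: T_def dest: dvd_imp_le)
    then show "(\<Sum>m\<in>{m\<in>T. m dvd N}. m * npartitions S (n - N)) = (\<Sum>m\<in>{m\<in>S. m dvd N}. m) * npartitions S (n - N)"
      by (simp add: sum_distrib_right)
  qed
  finally show ?thesis .
qed

section \<open>The hook totals as sums of partition numbers\<close>

lemma bij_betw_mset_partitions:
  "bij_betw mset (partitions_1_4_mod_5 n) (mpartitions parts_14 n)"
proof (rule bij_betwI[where g = "\<lambda>M. rev (sorted_list_of_multiset M)"])
  show "mset \<in> partitions_1_4_mod_5 n \<rightarrow> mpartitions parts_14 n"
    by (auto simp: partitions_1_4_mod_5_def is_partition_def mpartitions_def parts_14_def sum_mset_sum_list)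
  show "(\<lambda>M. rev (sorted_list_of_multiset M)) \<in> mpartitions parts_14 n \<rightarrow> partitions_1_4_mod_5 n"
  proof
    fix M assume M: "M \<in> mpartitions parts_14 n"
    then have "sum_list (rev (sorted_list_of_multiset M)) = n"
      using sum_mset_sum_list[of "rev (sorted_list_of_multiset M)"] by (simp add: mpartitions_def)
    moreover have "x mod 5 = 1 \<or> x mod 5 = 4" if "x \<in># M" for x
      using M that by (auto simp: mpartitions_def parts_14_def)
    moreover have "x > 0" if "x \<in># M" for x
      using M that by (cases x) (auto simp: mpartitions_def parts_14_def)
    ultimately show "rev (sorted_list_of_multiset M) \<in> partitions_1_4_mod_5 n"
      by (auto simp: partitions_1_4_mod_5_def is_partition_def sorted_wrt_rev)
  qed
  show "rev (sorted_list_of_multiset (mset xs)) = xs" if "xs \<in> partitions_1_4_mod_5 n" for xs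
  proof -
    have "sorted (rev xs)"
      using that by (simp add: partitions_1_4_mod_5_def is_partition_def sorted_wrt_rev)
    then have "sort xs = rev xs" by (intro properties_for_sort) auto
    then show ?thesis by simp
  qed
qed simp

lemma zero_notin_parts_14: "0 \<notin> parts_14"
  by (simp add: parts_14_def)

lemma r2_1_eq: "r2 1 n = (\<Sum>m\<in>{m\<in>parts_14. m \<le> n}. npartitions parts_14 (n - m))"
proof -
  have "r2 1 n = (\<Sum>xs\<in>partitions_1_4_mod_5 n. card {m \<in> set_mset (mset xs). True \<and> 1 \<le> count (mset xs) m})"
    unfolding r2_def
    by (intro sum.cong refl)
       (auto simp: partitions_1_4_mod_5_def is_partition_def card_hooks_1 Suc_le_eq simp del: One_nat_def intro!: arg_cong[of _ _ card])
  also have "\<dots> = (\<Sum>M\<in>mpartitions parts_14 n. card {m \<in> set_mset M. True \<and> 1 \<le> count M m})"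
    by (rule sum.reindex_bij_betw[OF bij_betw_mset_partitions])
  finally show ?thesis
    using sum_card_count_ge[OF zero_notin_parts_14, of 1 "\<lambda>_. True" n] by simp
qed

lemma r2_2_eq: "r2 2 n = (\<Sum>m\<in>{m\<in>parts_14. 2 \<le> m \<and> m \<le> n}. npartitions parts_14 (n - m))
     + (\<Sum>m\<in>{m\<in>parts_14. 2 * m \<le> n}. npartitions parts_14 (n - 2 * m))"
proof -
  have "r2 2 n = (\<Sum>xs\<in>partitions_1_4_mod_5 n. card {m \<in> set_mset (mset xs). 2 \<le> m \<and> 1 \<le> count (mset xs) m}
     + card {m \<in> set_mset (mset xs). True \<and> 2 \<le> count (mset xs) m})"
    unfolding r2_def
  proof (intro sum.cong refl)
    fix xs assume xs: "xs \<in> partitions_1_4_mod_5 n"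
    \<comment> \<open>A predecessor of a part is congruent to 0 or 3 modulo 5.\<close>
    have "m - 1 \<notin> set xs" if "m \<in> set xs" "2 \<le> m" for m
    proof
      assume "m - 1 \<in> set xs"
      then have "(m - 1) mod 5 = 1 \<or> (m - 1) mod 5 = 4" "m mod 5 = 1 \<or> m mod 5 = 4"
        using xs that by (auto simp: partitions_1_4_mod_5_def)
      moreover obtain k where "m = Suc k" using \<open>2 \<le> m\<close> by (cases m) auto
      ultimately show False by simp presburger
    qed
    then have "{m \<in> set xs. 2 \<le> m \<and> m - 1 \<notin> set xs} = {m \<in> set_mset (mset xs). 2 \<le> m \<and> 1 \<le> count (mset xs) m}"
      by (auto simp: Suc_le_eq)
    then show "card (hooks 2 xs) = card {m \<in> set_mset (mset xs). 2 \<le> m \<and> 1 \<le> count (mset xs) m}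
     + card {m \<in> set_mset (mset xs). True \<and> 2 \<le> count (mset xs) m}"
      using xs by (simp add: card_hooks_2 partitions_1_4_mod_5_def is_partition_def)
  qed
  also have "\<dots> = (\<Sum>M\<in>mpartitions parts_14 n. card {m \<in> set_mset M. 2 \<le> m \<and> 1 \<le> count M m}
     + card {m \<in> set_mset M. True \<and> 2 \<le> count M m})"
    by (rule sum.reindex_bij_betw[OF bij_betw_mset_partitions])
  finally show ?thesis
    using sum_card_count_ge[OF zero_notin_parts_14, of 1 "\<lambda>m. 2 \<le> m" n]
      sum_card_count_ge[OF zero_notin_parts_14, of 2 "\<lambda>_. True" n]
    by (simp add: sum.distrib)
qed

section \<open>Generating functions\<close>

text \<open>Cauchy's formula on the circle of radius \<open>exp (- x)\<close>, written in the angle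
  because the saddle point is analysed on the vertical segment \<open>Re s = x\<close>. The series
  converges uniformly there, and every term except the one with \<open>m = n\<close> has an
  antiderivative of period 2 \<pi>.\<close>

lemma power_series_coeff_integral:
  fixes A :: "complex fps" and x :: real and n :: nat
  assumes x: "x > 0" and radius: "fps_conv_radius A \<ge> 1"
  shows "((\<lambda>y. eval_fps A (exp (- Complex x y)) * exp (of_nat n * Complex x y)) has_integral
           (2 * pi * fps_nth A n)) {-pi..pi}"
proof -
  define f where "f = (\<lambda>m y. fps_nth A m * exp (of_int (int n - int m) * Complex x y))"
  define M where "M = (\<lambda>m. norm (fps_nth A m) * exp (- x) ^ m * exp (n * x))"
  have norm_q: "norm (exp (- Complex x y)) < 1" for y
    using x by simp
  have summ: "summable M"
  proof -
    have "norm (complex_of_real (exp (-x))) < fps_conv_radius A"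
      using x less_le_trans[OF _ radius] by simp
    from norm_summable_fps[OF this] show ?thesis
      unfolding M_def by (intro summable_mult2) (simp add: norm_mult norm_power)
  qed
  have unif: "uniform_limit {-pi..pi} (\<lambda>N y. \<Sum>m<N. f m y) (\<lambda>y. \<Sum>m. f m y) sequentially"
  proof (rule Weierstrass_m_test)
    fix m y
    have "norm (f m y) = norm (fps_nth A m) * exp ((real n - real m) * x)"
      by (simp add: f_def norm_mult)
    also have "exp ((real n - real m) * x) = exp (-x) ^ m * exp (n * x)"
      by (simp add: exp_of_nat_mult[symmetric] exp_add[symmetric] algebra_simps)
    finally show "norm (f m y) \<le> M m" by (simp add: M_def)
  qed (fact summ)
  have cont: "continuous_on {-pi..pi} (\<lambda>y. \<Sum>m<N. f m y)" for N
    unfolding f_def Complex_eq by (intro continuous_intros)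
  obtain I J where IJ: "\<And>N. ((\<lambda>y. \<Sum>m<N. f m y) has_integral I N) {-pi..pi}"
    "((\<lambda>y. \<Sum>m. f m y) has_integral J) {-pi..pi}" "I \<longlonglongrightarrow> J"
    using uniform_limit_integral[OF unif cont] by (metis sequentially_bot)
  have single: "(f m has_integral (if m = n then 2 * pi * fps_nth A n else 0)) {-pi..pi}" for m
  proof (cases "m = n")
    case True
    have "((\<lambda>y. fps_nth A n) has_integral (pi - (-pi)) *\<^sub>R fps_nth A n) {-pi..pi}"
      using has_integral_const_real[of "fps_nth A n" "-pi" pi] by simp
    then show ?thesis using True by (simp add: f_def scaleR_conv_of_real)
  next
    case False
    define k where "k = int n - int m"
    have k: "k \<noteq> 0" using False by (simp add: k_def)
    define G where "G = (\<lambda>y::real. fps_nth A m * exp (of_int k * Complex x y) / (\<i> * of_int k))"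
    have "(G has_vector_derivative f m y) (at y within {-pi..pi})" for y
    proof -
      have "((\<lambda>z. fps_nth A m * exp (of_int k * (of_real x + \<i> * z)) / (\<i> * of_int k)) has_field_derivative
              f m y) (at (of_real y))"
        unfolding f_def k_def[symmetric] Complex_eq
        using k by (auto intro!: derivative_eq_intros)
      from has_vector_derivative_real_field[OF this] show ?thesis
        unfolding G_def Complex_eq by (simp add: has_vector_derivative_at_within)
    qed
    then have "(f m has_integral (G pi - G (-pi))) {-pi..pi}"
      by (intro fundamental_theorem_of_calculus) auto
    moreover have "exp (of_int k * Complex x pi) = exp (of_int k * Complex x (-pi))"
      unfolding exp_eq by (intro exI[of _ k]) (simp add: Complex_eq algebra_simps)
    ultimately show ?thesis using False by (simp add: G_def)
  qed
  have I: "I N = (\<Sum>m<N. if m = n then 2 * pi * fps_nth A n else 0)" for N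
    using IJ(1) has_integral_sum[of "{..<N}" f, OF _ single] by (blast intro: has_integral_unique)
  then have "\<forall>\<^sub>F N in sequentially. I N = 2 * pi * fps_nth A n"
    by (intro eventually_mono[OF eventually_gt_at_top[of n]]) (simp add: I)
  then have "J = 2 * pi * fps_nth A n"
    using LIMSEQ_unique[OF IJ(3) tendsto_eventually] by blast
  moreover have "(\<Sum>m. f m y) = eval_fps A (exp (- Complex x y)) * exp (of_nat n * Complex x y)" for y
  proof -
    have "norm (exp (- Complex x y)) < fps_conv_radius A"
      using norm_q less_le_trans[OF _ radius] by simp
    from sums_mult2[OF sums_eval_fps[OF this], of "exp (of_nat n * Complex x y)"]
    have "(\<lambda>m. fps_nth A m * exp (- Complex x y) ^ m * exp (of_nat n * Complex x y)) sums
            (eval_fps A (exp (- Complex x y)) * exp (of_nat n * Complex x y))" .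
    also have "(\<lambda>m. fps_nth A m * exp (- Complex x y) ^ m * exp (of_nat n * Complex x y)) = (\<lambda>m. f m y)"
      by (simp add: f_def exp_of_nat_mult[symmetric] exp_add[symmetric] algebra_simps)
    finally show ?thesis by (simp add: sums_iff)
  qed
  ultimately show ?thesis using IJ(2) by simp
qed

text \<open>The power series of \<open>\<Sum>m\<in>S. - ln (1 - q^m)\<close>; the constant coefficient is \<open>x / 0 = 0\<close>.\<close>

definition euler_log :: "nat set \<Rightarrow> complex fps" where
  "euler_log S = Abs_fps (\<lambda>N. of_nat (\<Sum>m\<in>{m\<in>S. m dvd N}. m) / of_nat N)"

text \<open>Both series are rearrangements of the double sum of q^(jm) / j over
  \<open>j \<ge> 1\<close> and \<open>m \<in> S\<close>. Summation over \<open>m\<close> first gives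
  F (q^j) / j; collecting the pairs with \<open>j * m = N\<close>, where 1 / j = m / N, gives the
  coefficients of \<open>euler_log\<close>.\<close>

lemma euler_log_double_sum:
  fixes q :: complex
  assumes S: "0 \<notin> S" and q: "norm q < 1"
    and F: "\<And>z. norm z < 1 \<Longrightarrow> ((\<lambda>m. z ^ m) has_sum F z) S"
  obtains X where "(\<lambda>N. fps_nth (euler_log S) N * q ^ N) sums X"
    and "(\<lambda>k. F (q ^ Suc k) / of_nat (Suc k)) sums X"
proof -
  define J :: "nat set" where "J = {1..}"
  define f where "f = (\<lambda>(j::nat, m::nat). q ^ (j * m) / of_nat j)"
  define g where "g = (\<lambda>(N::nat, m::nat). q ^ N * of_nat m / of_nat N)"
  define r where "r = norm q"
  have r: "0 \<le> r" "r < 1" using q by (auto simp: r_def)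
  have "f summable_on J \<times> S"
  proof (rule abs_summable_summable, rule Infinite_Sum.abs_summable_on_comparison_test')
    have geo: "(\<lambda>j. r ^ j) summable_on UNIV"
      using r by (intro norm_summable_imp_summable_on) (simp add: norm_power summable_geometric)
    have a: "(\<lambda>j. r ^ (j - 1)) summable_on J"
    proof -
      have "(\<lambda>j. r ^ (j - 1)) summable_on (Suc ` UNIV)"
        using geo by (subst summable_on_reindex) (auto simp: o_def)
      moreover have "Suc ` UNIV = J"
        unfolding J_def by (auto simp: image_iff) (metis Suc_le_D)
      ultimately show ?thesis by simp
    qed
    have b: "(\<lambda>m. r ^ m) summable_on S"
      by (rule summable_on_subset_banach[OF geo]) simp
    \<comment> \<open>For positive \<open>j\<close> and \<open>m\<close> the product
      \<open>j * m\<close> is at least \<open>j - 1 + m\<close>, since (j - 1) (m - 1) is not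
      negative; this decouples the two indices.\<close>
    show "(\<lambda>(j, m). r ^ (j - 1) * r ^ m) summable_on J \<times> S"
    proof (rule summable_on_SigmaI)
      show "((\<lambda>m. case (j, m) of (j, m) \<Rightarrow> r ^ (j - 1) * r ^ m) has_sum r ^ (j - 1) * infsum (\<lambda>m. r ^ m) S) S" for j
        using has_sum_cmult_right[OF has_sum_infsum[OF b]] by simp
      show "(\<lambda>j. r ^ (j - 1) * infsum (\<lambda>m. r ^ m) S) summable_on J"
        by (rule summable_on_cmult_left[OF a])
    qed (use r in auto)
    fix p assume "p \<in> J \<times> S"
    then obtain j m where p: "p = (j, m)" "j \<ge> 1" "m \<in> S" by (auto simp: J_def)
    then have "m \<ge> 1" using S by (cases m) auto
    then obtain a b where ab: "j = Suc a" "m = Suc b" using p by (metis Suc_le_D One_nat_def)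
    have "norm (f p) = r ^ (j * m) / real j" by (simp add: f_def p norm_divide norm_power r_def)
    also have "\<dots> \<le> r ^ (j * m)" using p r by (intro divide_left_mono[where b = 1, simplified]) auto
    also have "\<dots> \<le> r ^ (j - 1 + m)" using r ab by (intro power_decreasing) auto
    finally show "norm (f p) \<le> (case p of (j, m) \<Rightarrow> r ^ (j - 1) * r ^ m)"
      by (simp add: p power_add)
  qed
  then obtain X where X: "(f has_sum X) (J \<times> S)" by (auto simp: summable_on_def)
  have "((\<lambda>j. F (q ^ j) / of_nat j) has_sum X) J"
  proof (rule has_sum_SigmaD[OF X])
    fix j assume "j \<in> J"
    then have "norm (q ^ j) < 1" using q by (auto simp: J_def norm_power power_less_one_iff)
    from has_sum_cmult_right[OF F[OF this], of "1 / of_nat j"]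
    show "((\<lambda>m. f (j, m)) has_sum F (q ^ j) / of_nat j) S"
      by (simp add: f_def power_mult)
  qed
  then have "((\<lambda>k. F (q ^ Suc k) / of_nat (Suc k)) has_sum X) UNIV"
    by (rule has_sum_reindex_bij_witness[of _ Suc "\<lambda>j. j - 1", THEN iffD1, rotated -1]) (auto simp: J_def)
  then have 2: "(\<lambda>k. F (q ^ Suc k) / of_nat (Suc k)) sums X" by (rule has_sum_imp_sums)
  have "(g has_sum X) (SIGMA N:J. {m\<in>S. m dvd N})"
  proof (rule has_sum_reindex_bij_witness[of _ "\<lambda>(N, m). (N div m, m)" "\<lambda>(j, m). (j * m, m)", THEN iffD1, OF _ _ _ _ _ _ X])
    fix p assume "p \<in> J \<times> S"
    then obtain j m where p: "p = (j, m)" "j > 0" "m \<in> S" by (auto simp: J_def)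
    then have "m > 0" using S by (cases m) auto
    with p show "(case case p of (j, m) \<Rightarrow> (j * m, m) of (N, m) \<Rightarrow> (N div m, m)) = p"
      "(case p of (j, m) \<Rightarrow> (j * m, m)) \<in> (SIGMA N:J. {m\<in>S. m dvd N})"
      "g (case p of (j, m) \<Rightarrow> (j * m, m)) = f p"
      by (auto simp: J_def f_def g_def)
  next
    fix p assume "p \<in> (SIGMA N:J. {m\<in>S. m dvd N})"
    then obtain N m where p: "p = (N, m)" "N > 0" "m \<in> S" "m dvd N" by (auto simp: J_def)
    then show "(case case p of (N, m) \<Rightarrow> (N div m, m) of (j, m) \<Rightarrow> (j * m, m)) = p"
      "(case p of (N, m) \<Rightarrow> (N div m, m)) \<in> J \<times> S"
      by (auto simp: J_def elim!: dvdE)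
  qed simp
  then have "((\<lambda>N. fps_nth (euler_log S) N * q ^ N) has_sum X) J"
  proof (rule has_sum_SigmaD)
    fix N assume "N \<in> J"
    then have fin: "finite {m\<in>S. m dvd N}"
      by (intro finite_subset[of "{m\<in>S. m dvd N}" "{..N}"]) (auto simp: J_def dest: dvd_imp_le)
    have "(\<Sum>m\<in>{m\<in>S. m dvd N}. g (N, m)) = fps_nth (euler_log S) N * q ^ N"
      by (simp add: g_def euler_log_def sum_distrib_left sum_divide_distrib mult_ac)
    then show "((\<lambda>m. g (N, m)) has_sum fps_nth (euler_log S) N * q ^ N) {m\<in>S. m dvd N}"
      using has_sum_finite[OF fin, of "\<lambda>m. g (N, m)"] by simp
  qed
  also have "((\<lambda>N. fps_nth (euler_log S) N * q ^ N) has_sum X) J \<longleftrightarrow>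
             ((\<lambda>N. fps_nth (euler_log S) N * q ^ N) has_sum X) UNIV"
    by (rule has_sum_cong_neutral) (auto simp: J_def euler_log_def not_le)
  finally have "((\<lambda>N. fps_nth (euler_log S) N * q ^ N) has_sum X) UNIV" .
  then have "(\<lambda>N. fps_nth (euler_log S) N * q ^ N) sums X" by (rule has_sum_imp_sums)
  with 2 that show thesis by blast
qed

section \<open>The exponential formula for the partition series\<close>

definition npartitions_fps :: "nat set \<Rightarrow> complex fps" where
  "npartitions_fps S = Abs_fps (\<lambda>n. of_nat (npartitions S n))"

lemma npartitions_0:
  assumes "0 \<notin> S"
  shows "npartitions S 0 = 1"
proof -
  have "M = {#}" if "M \<in> mpartitions S 0" for M
    using that assms by (cases M) (auto simp: mpartitions_def)
  then have "mpartitions S 0 = {{#}}"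
    by (auto simp: mpartitions_def)
  then show ?thesis by (simp add: npartitions_def)
qed

lemma npartitions_fps_deriv:
  assumes "0 \<notin> S"
  shows "fps_deriv (npartitions_fps S) = fps_deriv (euler_log S) * npartitions_fps S"
proof (rule fps_ext)
  fix n
  let ?c = "\<lambda>N. \<Sum>m\<in>{m\<in>S. m dvd N}. m"
  have "fps_nth (fps_deriv (npartitions_fps S)) n = of_nat (Suc n * npartitions S (Suc n))"
    by (simp add: npartitions_fps_def ring_distribs)
  also have "Suc n * npartitions S (Suc n) = (\<Sum>N=1..Suc n. ?c N * npartitions S (Suc n - N))"
    by (rule npartitions_recurrence[OF assms])
  also have "\<dots> = (\<Sum>i=0..n. ?c (Suc i) * npartitions S (n - i))"
    by (simp only: One_nat_def sum.atLeast_Suc_atMost_Suc_shift) simp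
  also have "of_nat \<dots> = fps_nth (fps_deriv (euler_log S) * npartitions_fps S) n"
    by (simp add: fps_mult_nth euler_log_def npartitions_fps_def del: of_nat_Suc)
  finally show "fps_nth (fps_deriv (npartitions_fps S)) n = fps_nth (fps_deriv (euler_log S) * npartitions_fps S) n" .
qed

lemma linear_ode_fps_unique:
  fixes A B L :: "'a :: field_char_0 fps"
  assumes "fps_deriv A = L * A" "fps_deriv B = L * B" "fps_nth A 0 = fps_nth B 0"
  shows "A = B"
proof (rule fps_ext)
  fix n show "fps_nth A n = fps_nth B n"
  proof (induction n rule: less_induct)
    case (less n)
    show ?case
    proof (cases n)
      case (Suc m)
      have "of_nat (Suc m) * fps_nth A (Suc m) = fps_nth (L * A) m"
        by (simp flip: assms(1))
      also have "\<dots> = fps_nth (L * B) m"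
        unfolding fps_mult_nth using less Suc by (intro sum.cong refl) auto
      also have "\<dots> = of_nat (Suc m) * fps_nth B (Suc m)"
        by (simp flip: assms(2))
      finally show ?thesis using Suc by (simp del: of_nat_Suc)
    qed (use assms(3) in simp)
  qed
qed

text \<open>The partition series and the Taylor series of the exponential solve the same linear
  differential equation with constant coefficient 1, hence coincide. The radius of convergence then
  comes from holomorphy of the exponential, without any estimate of the partition numbers.\<close>

lemma npartitions_generating_function:
  assumes S: "0 \<notin> S" and radius: "fps_conv_radius (euler_log S) \<ge> 1"
  shows "fps_conv_radius (npartitions_fps S) \<ge> 1"
    and "norm q < 1 \<Longrightarrow> eval_fps (npartitions_fps S) q = exp (eval_fps (euler_log S) q)"
proof -
  define E where "E = (\<lambda>z. exp (eval_fps (euler_log S) z))"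
  have sub: "ball 0 1 \<subseteq> eball (0::complex) (fps_conv_radius (euler_log S))"
  proof
    fix z :: complex assume "z \<in> ball 0 1"
    then have "ereal (norm z) < 1" by (simp add: one_ereal_def)
    then show "z \<in> eball 0 (fps_conv_radius (euler_log S))"
      using less_le_trans[OF _ radius] by simp
  qed
  have holo: "E holomorphic_on ball 0 1"
    unfolding E_def by (intro holomorphic_intros holomorphic_on_eval_fps[OF sub])
  have exp_E: "E has_fps_expansion fps_expansion E 0"
    using holo by (intro has_fps_expansion_fps_expansion) auto
  have L: "eval_fps (euler_log S) has_fps_expansion euler_log S"
    by (intro eval_fps_has_fps_expansion less_le_trans[OF _ radius]) simp
  have "fps_expansion E 0 = npartitions_fps S"
  proof (rule linear_ode_fps_unique)
    have "deriv E has_fps_expansion fps_deriv (fps_expansion E 0)"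
      using exp_E by (rule has_fps_expansion_deriv)
    moreover have "\<forall>\<^sub>F z in nhds 0. deriv E z = deriv (eval_fps (euler_log S)) z * E z"
    proof -
      have "\<forall>\<^sub>F z in nhds 0. z \<in> ball (0::complex) 1" by (intro eventually_nhds_in_open) auto
      then show ?thesis
      proof eventually_elim
        case (elim z)
        then have "eval_fps (euler_log S) field_differentiable at z"
          by (intro holomorphic_on_imp_differentiable_at[OF holomorphic_on_eval_fps[OF sub]]) auto
        from DERIV_deriv_iff_field_differentiable[THEN iffD2, OF this]
        have "(E has_field_derivative deriv (eval_fps (euler_log S)) z * E z) (at z)"
          unfolding E_def using DERIV_chain2[OF DERIV_exp] by (simp add: mult.commute)
        then show ?case by (rule DERIV_imp_deriv)
      qed
    qed
    ultimately have "(\<lambda>z. deriv (eval_fps (euler_log S)) z * E z) has_fps_expansion fps_deriv (fps_expansion E 0)"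
      by (simp add: has_fps_expansion_cong)
    moreover have "(\<lambda>z. deriv (eval_fps (euler_log S)) z * E z) has_fps_expansion fps_deriv (euler_log S) * fps_expansion E 0"
      by (intro has_fps_expansion_mult has_fps_expansion_deriv L exp_E)
    ultimately show "fps_deriv (fps_expansion E 0) = fps_deriv (euler_log S) * fps_expansion E 0"
      by (rule fps_expansion_unique_complex)
    show "fps_deriv (npartitions_fps S) = fps_deriv (euler_log S) * npartitions_fps S"
      by (rule npartitions_fps_deriv[OF S])
    have "fps_nth (fps_expansion E 0) 0 = E 0"
      using has_fps_expansion_imp_0_eq_fps_nth_0[OF exp_E] by simp
    also have "\<dots> = 1" by (simp add: E_def eval_fps_at_0 euler_log_def)
    finally show "fps_nth (fps_expansion E 0) 0 = fps_nth (npartitions_fps S) 0"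
      by (simp add: npartitions_fps_def npartitions_0[OF S])
  qed
  moreover have "fps_conv_radius (fps_expansion E 0) \<ge> 1"
    using conv_radius_fps_expansion[of E 0 1] holo by (simp add: one_ereal_def)
  moreover have "eval_fps (fps_expansion E 0) q = E q" if "norm q < 1"
    using eval_fps_expansion[of E 0 1 q] holo that by (simp add: one_ereal_def)
  ultimately show "fps_conv_radius (npartitions_fps S) \<ge> 1"
    and "norm q < 1 \<Longrightarrow> eval_fps (npartitions_fps S) q = exp (eval_fps (euler_log S) q)"
    by (simp_all add: E_def)
qed

section \<open>The generating function for the residues 1 and 4 modulo 5\<close>

definition F14 :: "complex \<Rightarrow> complex" where
  "F14 s = (exp (- s) + exp (- 4 * s)) / (1 - exp (- 5 * s))"

lemma has_sum_parts_14:
  fixes z :: complex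
  assumes "norm z < 1"
  shows "((\<lambda>m. z ^ m) has_sum ((z + z ^ 4) / (1 - z ^ 5))) parts_14"
proof -
  have z5: "norm (z ^ 5) < 1" using assms by (simp add: norm_power power_less_one_iff)
  have geo: "((\<lambda>j. (z ^ 5) ^ j) has_sum (1 / (1 - z ^ 5))) UNIV"
    using z5 geometric_sums[OF z5]
    by (intro norm_summable_imp_has_sum) (simp_all add: norm_power summable_geometric)
  have res: "((\<lambda>m. z ^ m) has_sum (z ^ a / (1 - z ^ 5))) (range (\<lambda>j. 5 * j + a))" for a
  proof (subst has_sum_reindex)
    show "((\<lambda>m. z ^ m) \<circ> (\<lambda>j. 5 * j + a) has_sum (z ^ a / (1 - z ^ 5))) UNIV"
      using has_sum_cmult_right[OF geo, of "z ^ a"]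
      by (simp add: o_def power_add mult.commute flip: power_mult)
  qed (auto simp: inj_on_def)
  have "parts_14 = range (\<lambda>j. 5 * j + 1) \<union> range (\<lambda>j. 5 * j + 4)"
  proof (intro equalityI subsetI)
    fix m assume "m \<in> parts_14"
    moreover have "m = 5 * (m div 5) + m mod 5" by simp
    ultimately show "m \<in> range (\<lambda>j. 5 * j + 1) \<union> range (\<lambda>j. 5 * j + 4)"
      unfolding parts_14_def by (metis (mono_tags, lifting) UnCI mem_Collect_eq rangeI)
  qed (auto simp: parts_14_def mod_Suc)
  moreover have "range (\<lambda>j. 5 * j + 1) \<inter> range (\<lambda>j. 5 * j + 4) = ({} :: nat set)"
    by auto presburger
  ultimately show ?thesis
    using has_sum_Un_disjoint[OF res[of 1] res[of 4]] by (simp add: add_divide_distrib)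
qed

lemma F14_exp: "F14 (of_nat k * s) = (exp (- s) ^ k + (exp (- s) ^ k) ^ 4) / (1 - (exp (- s) ^ k) ^ 5)"
  by (simp add: F14_def exp_of_nat_mult[symmetric] mult_ac)

lemma parts_14_radius: "fps_conv_radius (euler_log parts_14) \<ge> 1"
  unfolding fps_conv_radius_def
proof (rule conv_radius_geI_ex')
  fix r :: real assume r: "0 < r" "ereal r < 1"
  then have "norm (complex_of_real r) < 1" by (simp add: one_ereal_def)
  from euler_log_double_sum[OF zero_notin_parts_14 this has_sum_parts_14]
  show "summable (\<lambda>n. fps_nth (euler_log parts_14) n * of_real r ^ n)"
    by (metis sums_summable)
qed

definition P14 :: "complex \<Rightarrow> complex" where
  "P14 s = eval_fps (npartitions_fps parts_14) (exp (- s))"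

lemma F14_log_sums:
  assumes "Re s > 0"
  shows "(\<lambda>k. F14 (of_nat (Suc k) * s) / of_nat (Suc k)) sums
           eval_fps (euler_log parts_14) (exp (- s))"
proof -
  have "norm (exp (- s)) < 1" using assms by simp
  from euler_log_double_sum[OF zero_notin_parts_14 this has_sum_parts_14] obtain X where
    "(\<lambda>N. fps_nth (euler_log parts_14) N * exp (- s) ^ N) sums X"
    "(\<lambda>k. ((exp (- s) ^ Suc k) + (exp (- s) ^ Suc k) ^ 4) / (1 - (exp (- s) ^ Suc k) ^ 5) / of_nat (Suc k)) sums X"
    by blast
  then show ?thesis
    unfolding F14_exp by (simp add: eval_fps_def sums_iff)
qed

lemma P14_eq:
  assumes "Re s > 0"
  shows "P14 s = exp (\<Sum>k. F14 (of_nat (Suc k) * s) / of_nat (Suc k))"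
proof -
  have "norm (exp (- s)) < 1" using assms by simp
  from npartitions_generating_function(2)[OF zero_notin_parts_14 parts_14_radius this]
  show ?thesis
    using F14_log_sums[OF assms] by (simp add: P14_def sums_iff)
qed

section \<open>Riemann sums along rays\<close>

lemma integrable_inverse_1_plus_sq: "integrable lborel (\<lambda>t::real. c / (1 + t\<^sup>2))"
proof -
  have "integrable lborel (\<lambda>t::real. inverse (1 + t\<^sup>2))"
    using integrable_inverse_1_plus_square by (simp add: set_integrable_def)
  then show ?thesis
    unfolding divide_inverse by (rule integrable_mult_right)
qed

text \<open>Riemann sums with complex step \<open>s\<close> along the ray through \<open>s\<close>.
  Decay is asked for only in the sector where \<open>norm s\<close> and \<open>Re s\<close> are
  comparable; continuity serves to pass from nearby rays to the positive real axis. The locale is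
  instantiated by \<open>g14\<close> and by \<open>bern\<close>.\<close>

locale sector_decay =
  fixes f :: "complex \<Rightarrow> complex" and C :: real
  assumes cont: "continuous_on {z. Re z > 0} f"
    and decay: "\<And>z. Re z > 0 \<Longrightarrow> \<bar>Im z\<bar> \<le> Re z \<Longrightarrow> norm (f z) \<le> C / (1 + (norm z)\<^sup>2)"
begin

text \<open>Sampling at the right end points of intervals of length \<open>Re s\<close> keeps away
  from the origin, and the sample has norm at least \<open>t\<close>, so the decay bound may be
  evaluated at \<open>t\<close> itself, independently of \<open>s\<close>.\<close>

definition step :: "complex \<Rightarrow> real \<Rightarrow> complex" where
  "step s t = indicator {0<..} t *\<^sub>R f (of_int \<lceil>t / Re s\<rceil> * s)"

lemma C_nonneg: "C \<ge> 0"
proof -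
  have "0 \<le> norm (f 1)" by simp
  also have "\<dots> \<le> C / 2" using decay[of 1] by simp
  finally show ?thesis by simp
qed

lemma norm_multiple_le:
  assumes s: "Re s > 0" "\<bar>Im s\<bar> \<le> Re s" and k: "k > 0" and t: "0 \<le> t" "t \<le> of_int k * Re s"
  shows "norm (f (of_int k * s)) \<le> C / (1 + t\<^sup>2)"
proof -
  have "norm (f (of_int k * s)) \<le> C / (1 + (norm (of_int k * s))\<^sup>2)"
    using s k by (intro decay) (auto simp: abs_mult)
  also have "t \<le> norm (of_int k * s)"
    using t k abs_Re_le_cmod[of "of_int k * s"] by simp
  then have "C / (1 + (norm (of_int k * s))\<^sup>2) \<le> C / (1 + t\<^sup>2)"
    using t C_nonneg by (intro divide_left_mono add_left_mono power_mono mult_pos_pos)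
      (auto intro: add_pos_nonneg)
  finally show ?thesis .
qed

lemma norm_step_le:
  assumes "Re s > 0" "\<bar>Im s\<bar> \<le> Re s"
  shows "norm (step s t) \<le> C / (1 + t\<^sup>2)"
proof (cases "t > 0")
  case True
  then have "0 < \<lceil>t / Re s\<rceil>" using assms by simp
  moreover have "t \<le> of_int \<lceil>t / Re s\<rceil> * Re s"
    using assms by (intro pos_divide_le_eq[THEN iffD1, OF _ le_of_int_ceiling])
  ultimately show ?thesis
    using True norm_multiple_le[OF assms] by (simp add: step_def)
qed (use C_nonneg in \<open>auto simp: step_def\<close>)

text \<open>The series becomes an integral over a fixed domain, so that letting \<open>s\<close>
  tend to 0 is a matter of dominated convergence. The factor \<open>s / Re s\<close> appears because
  the samples lie on a complex ray while the integration variable is real.\<close>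

lemma riemann_sum:
  assumes s: "Re s > 0" "\<bar>Im s\<bar> \<le> Re s"
  shows "summable (\<lambda>k. norm (f (of_nat (Suc k) * s)))"
    and "integrable lborel (step s)"
    and "(\<Sum>k. s * f (of_nat (Suc k) * s)) = s / Re s * (LINT t|lborel. step s t)"
proof -
  define x where "x = Re s"
  have x: "x > 0" using s by (simp add: x_def)
  define I where "I = (\<lambda>k::nat. {k * x<..Suc k * x})"
  define g where "g = (\<lambda>k t. indicator (I k) t *\<^sub>R f (of_nat (Suc k) * s))"
  have le: "norm (f (of_nat (Suc k) * s)) \<le> C / (1 + (Suc k * x)\<^sup>2)" for k
    using norm_multiple_le[OF s, of "int (Suc k)" "Suc k * x"] x by (simp add: x_def)
  show summ: "summable (\<lambda>k. norm (f (of_nat (Suc k) * s)))"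
  proof (rule summable_comparison_test_ev)
    have "(1 + (Suc k * x)\<^sup>2) \<ge> x\<^sup>2 * (real (Suc k))\<^sup>2" for k
      by (simp add: power_mult_distrib mult.commute)
    then have "C / (1 + (Suc k * x)\<^sup>2) \<le> C / (x\<^sup>2 * (real (Suc k))\<^sup>2)" for k
      using C_nonneg x by (intro divide_left_mono mult_pos_pos) (auto intro: add_pos_nonneg)
    also have "C / (x\<^sup>2 * (real (Suc k))\<^sup>2) = C / x\<^sup>2 * (1 / (real (Suc k))\<^sup>2)" for k by simp
    finally show "\<forall>\<^sub>F k in sequentially. norm (norm (f (of_nat (Suc k) * s))) \<le> C / x\<^sup>2 * (1 / (real (Suc k))\<^sup>2)"
      using le order_trans by (intro always_eventually allI) fastforce
    show "summable (\<lambda>k. C / x\<^sup>2 * (1 / (real (Suc k))\<^sup>2))"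
      using inverse_power_summable[of 2, where 'a = real] 
      by (intro summable_mult summable_Suc_iff[of "\<lambda>k. 1 / (real k)\<^sup>2", THEN iffD2])
         (simp add: inverse_eq_divide)
  qed
  have g_sums: "(\<lambda>k. g k t) sums step s t" for t
  proof (cases "t > 0")
    case True
    define k where "k = nat (\<lceil>t / x\<rceil> - 1)"
    have "\<lceil>t / x\<rceil> > 0" using True x by simp
    then have k: "of_int \<lceil>t / x\<rceil> = real (Suc k)" by (simp add: k_def)
    have iff: "t \<in> I j \<longleftrightarrow> j = k" for j
    proof -
      have "t \<in> I j \<longleftrightarrow> real j < t / x \<and> t / x \<le> real (Suc j)"
        using x by (auto simp: I_def field_simps)
      also have "\<dots> \<longleftrightarrow> \<lceil>t / x\<rceil> = int (Suc j)"
        by (simp add: ceiling_eq_iff)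
      also have "\<dots> \<longleftrightarrow> j = k" using \<open>\<lceil>t / x\<rceil> > 0\<close> by (auto simp: k_def)
      finally show ?thesis .
    qed
    have "of_int \<lceil>t / x\<rceil> = (of_nat (Suc k) :: complex)"
      using \<open>\<lceil>t / x\<rceil> > 0\<close> by (simp add: k_def)
    then have "(\<lambda>j. g j t) = (\<lambda>j. if j = k then step s t else 0)"
      using True by (auto simp: g_def iff step_def indicator_def x_def[symmetric])
    then show ?thesis using sums_single[of k "\<lambda>_. step s t"] by simp
  next
    case False
    then have "t \<notin> I k" for k using x by (auto simp: I_def not_less intro: order_trans mult_nonneg_nonneg)
    then show ?thesis using False by (simp add: g_def step_def)
  qed
  have int_g: "integrable lborel (g k)" for k
    unfolding g_def I_def using x by (intro integrable_scaleR_left) (auto simp: mult_right_mono)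
  have LINT_g: "(LINT t|lborel. g k t) = x * f (of_nat (Suc k) * s)" for k
  proof -
    have "(LINT t|lborel. g k t) = measure lborel (I k) *\<^sub>R f (of_nat (Suc k) * s)"
      unfolding g_def I_def using x by (subst integral_scaleR_left) (auto simp: mult_right_mono)
    also have "measure lborel (I k) = x"
      using x by (simp add: I_def mult_right_mono algebra_simps)
    finally show ?thesis by (simp add: scaleR_conv_of_real)
  qed
  have norm_g: "(\<lambda>t. norm (g k t)) = (\<lambda>t. indicator (I k) t *\<^sub>R norm (f (of_nat (Suc k) * s)))" for k
    by (auto simp: g_def)
  have LINT_norm_g: "(LINT t|lborel. norm (g k t)) = x * norm (f (of_nat (Suc k) * s))" for k
  proof -
    have "(LINT t|lborel. norm (g k t)) = measure lborel (I k) *\<^sub>R norm (f (of_nat (Suc k) * s))"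
      unfolding norm_g I_def using x by (subst integral_scaleR_left) (auto simp: mult_right_mono)
    also have "measure lborel (I k) = x"
      using x by (simp add: I_def mult_right_mono algebra_simps)
    finally show ?thesis by simp
  qed
  have AE: "AE t in lborel. summable (\<lambda>k. norm (g k t))"
  proof (rule AE_I2)
    fix t show "summable (\<lambda>k. norm (g k t))"
      by (rule summable_comparison_test'[OF summ, of 0]) (simp add: g_def indicator_def)
  qed
  have sum_norm: "summable (\<lambda>k. LINT t|lborel. norm (g k t))"
    unfolding LINT_norm_g by (intro summable_mult summ)
  have step: "step s = (\<lambda>t. \<Sum>k. g k t)" using g_sums by (simp add: sums_iff)
  show "integrable lborel (step s)"
    unfolding step by (rule integrable_suminf[OF int_g AE sum_norm])
  have "(LINT t|lborel. step s t) = (\<Sum>k. x * f (of_nat (Suc k) * s))"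
    unfolding step LINT_g[symmetric] by (rule integral_suminf[OF int_g AE sum_norm])
  also have "\<dots> = x * (\<Sum>k. f (of_nat (Suc k) * s))"
    by (intro suminf_mult summable_norm_cancel[OF summ])
  finally show "(\<Sum>k. s * f (of_nat (Suc k) * s)) = s / Re s * (LINT t|lborel. step s t)"
    using x suminf_mult[OF summable_norm_cancel[OF summ], of s] by (simp add: x_def)
qed

lemma riemann_sum_bounded:
  obtains B where "\<And>s. Re s > 0 \<Longrightarrow> \<bar>Im s\<bar> \<le> Re s \<Longrightarrow> norm (\<Sum>k. s * f (of_nat (Suc k) * s)) \<le> B"
proof
  fix s assume s: "Re s > 0" "\<bar>Im s\<bar> \<le> Re s"
  have "norm s \<le> 2 * Re s" using s cmod_le[of s] by simp
  then have "norm (s / Re s) \<le> 2" using s by (simp add: norm_divide field_simps)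
  moreover have "norm (LINT t|lborel. step s t) \<le> (LINT t|lborel. C / (1 + t\<^sup>2))"
    using norm_step_le[OF s] integrable_inverse_1_plus_sq[of C]
    by (intro Bochner_Integration.integral_norm_bound_integral[THEN order_trans] riemann_sum(2)[OF s]) auto
  ultimately show "norm (\<Sum>k. s * f (of_nat (Suc k) * s)) \<le> 2 * (LINT t|lborel. C / (1 + t\<^sup>2))"
    unfolding riemann_sum(3)[OF s] norm_mult by (intro mult_mono) auto
qed

text \<open>The real part of the sample exceeds \<open>t\<close> by at most the step, and the
  condition on the ratio turns the sampled ray into the positive real axis. It is satisfied at the
  saddle point, where the relevant heights are of smaller order than the abscissa.\<close>

lemma riemann_sum_tendsto:
  fixes s :: "nat \<Rightarrow> complex"
  assumes s: "\<And>n. Re (s n) > 0" "\<And>n. \<bar>Im (s n)\<bar> \<le> Re (s n)"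
    and lim: "s \<longlonglongrightarrow> 0" and ratio: "(\<lambda>n. s n / Re (s n)) \<longlonglongrightarrow> 1"
  shows "(\<lambda>n. \<Sum>k. s n * f (of_nat (Suc k) * s n)) \<longlonglongrightarrow> (LINT t:{0<..}|lborel. f (of_real t))"
proof -
  have x0: "(\<lambda>n. Re (s n)) \<longlonglongrightarrow> 0" using tendsto_Re[OF lim] by simp
  have pointwise: "(\<lambda>n. step (s n) t) \<longlonglongrightarrow> indicator {0<..} t *\<^sub>R f (of_real t)" for t
  proof (cases "t > 0")
    case True
    have ceil: "(\<lambda>n. of_int \<lceil>t / Re (s n)\<rceil> * Re (s n)) \<longlonglongrightarrow> t"
    proof (rule tendsto_sandwich)
      show "\<forall>\<^sub>F n in sequentially. t \<le> of_int \<lceil>t / Re (s n)\<rceil> * Re (s n)"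
        using s by (intro always_eventually allI pos_divide_le_eq[THEN iffD1, OF _ le_of_int_ceiling])
      show "\<forall>\<^sub>F n in sequentially. of_int \<lceil>t / Re (s n)\<rceil> * Re (s n) \<le> t + Re (s n)"
      proof (intro always_eventually allI)
        fix n
        have "of_int \<lceil>t / Re (s n)\<rceil> * Re (s n) \<le> (t / Re (s n) + 1) * Re (s n)"
          using s(1)[of n] by (intro mult_right_mono) (auto intro: order_trans[OF of_int_ceiling_le_add_one])
        also have "\<dots> = t + Re (s n)" using s(1)[of n] by (simp add: field_simps)
        finally show "of_int \<lceil>t / Re (s n)\<rceil> * Re (s n) \<le> t + Re (s n)" .
      qed
      show "(\<lambda>n. t + Re (s n)) \<longlonglongrightarrow> t" using tendsto_add[OF tendsto_const x0] by simp
    qed simp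
    have "(\<lambda>n. of_real (of_int \<lceil>t / Re (s n)\<rceil> * Re (s n)) * (s n / Re (s n))) \<longlonglongrightarrow> of_real t * 1"
      by (intro tendsto_mult tendsto_of_real ceil ratio)
    also have "(\<lambda>n. of_real (of_int \<lceil>t / Re (s n)\<rceil> * Re (s n)) * (s n / Re (s n))) =
               (\<lambda>n. of_int \<lceil>t / Re (s n)\<rceil> * s n)"
      using s(1) by (auto simp: fun_eq_iff less_imp_neq[THEN not_sym] field_simps)
    finally have "(\<lambda>n. of_int \<lceil>t / Re (s n)\<rceil> * s n) \<longlonglongrightarrow> of_real t" by simp
    moreover have "isCont f (of_real t)"
      using cont True by (subst (asm) continuous_on_eq_continuous_at) (auto simp: open_halfspace_Re_gt)
    ultimately have "(\<lambda>n. f (of_int \<lceil>t / Re (s n)\<rceil> * s n)) \<longlonglongrightarrow> f (of_real t)"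
      by (rule isCont_tendsto_compose[rotated])
    then show ?thesis using True by (simp add: step_def)
  qed (simp add: step_def)
  have "(\<lambda>n. LINT t|lborel. step (s n) t) \<longlonglongrightarrow> (LINT t|lborel. indicator {0<..} t *\<^sub>R f (of_real t))"
  proof (rule integral_dominated_convergence[OF _ _ integrable_inverse_1_plus_sq[of C]])
    have "continuous_on {0<..} (\<lambda>t::real. f (of_real t))"
      by (rule continuous_on_compose2[OF cont]) (auto intro: continuous_intros)
    then show "(\<lambda>t. indicator {0<..} t *\<^sub>R f (of_real t)) \<in> borel_measurable lborel"
      by (simp add: borel_measurable_continuous_on_indicator)
    show "step (s n) \<in> borel_measurable lborel" for n
      by (rule borel_measurable_integrable[OF riemann_sum(2)[OF s]])
  qed (use pointwise norm_step_le[OF s] in auto)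
  from tendsto_mult[OF ratio this] show ?thesis
    unfolding riemann_sum(3)[OF s] set_lebesgue_integral_def by simp
qed

end

section \<open>The logarithm of the generating function near the origin\<close>

lemma exp_remainder_1:
  fixes z :: complex
  shows "norm (exp z - (1 + z)) \<le> exp \<bar>Re z\<bar> * (norm z)\<^sup>2"
  using Taylor_exp[of z 1] by (simp add: power2_eq_square)

lemma exp_remainder_2:
  fixes z :: complex
  shows "norm (exp z - (1 + z + z\<^sup>2 / 2)) \<le> exp \<bar>Re z\<bar> * (norm z) ^ 3"
proof -
  have "norm (exp z - (1 + z + z\<^sup>2 / 2)) \<le> exp \<bar>Re z\<bar> * (norm z) ^ 3 / 2"
    using Taylor_exp[of z 2] by (simp add: numeral_eq_Suc)
  also have "\<dots> \<le> exp \<bar>Re z\<bar> * (norm z) ^ 3" by simp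
  finally show ?thesis .
qed

lemma norm_mult_const_le:
  fixes a c :: complex
  assumes "norm c = C" "norm a \<le> A"
  shows "norm (c * a) \<le> C * A"
  using assms by (auto simp: norm_mult intro: mult_left_mono)

lemma norm_1_minus_exp_ge:
  assumes "Re z > 0"
  shows "norm (1 - exp (- z)) \<ge> Re z / (1 + Re z)"
proof -
  have "exp (- Re z) \<le> 1 / (1 + Re z)"
    using exp_ge_add_one_self[of "Re z"] assms by (simp add: exp_minus field_simps)
  then have "Re z / (1 + Re z) \<le> 1 - exp (- Re z)"
    using assms by (simp add: field_simps)
  also have "\<dots> \<le> norm (1 - exp (- z))"
    using norm_triangle_ineq2[of 1 "exp (- z)"] by simp
  finally show ?thesis .
qed

lemma exp_neq_1_Re_pos: "Re z > 0 \<Longrightarrow> 1 - exp (- z) \<noteq> (0 :: complex)"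
  using norm_1_minus_exp_ge[of z] by (auto simp: field_simps)

text \<open>The condition \<open>norm z \<le> 2 * Re z\<close> follows from the sector condition and
  is the form in which it is used. The factor 2 arises because 1 + |z|^2 is at most 2 inside the
  unit disc and at most 2 |z|^2 outside.\<close>

lemma sector_decayI:
  assumes cont: "continuous_on {z. Re z > 0} f"
    and small: "\<And>z. Re z > 0 \<Longrightarrow> norm z \<le> 2 * Re z \<Longrightarrow> norm z \<le> 1 \<Longrightarrow> norm (f z) \<le> A"
    and large: "\<And>z. Re z > 0 \<Longrightarrow> norm z \<le> 2 * Re z \<Longrightarrow> norm z \<ge> 1 \<Longrightarrow> norm (f z) \<le> B / (norm z)\<^sup>2"
  shows "sector_decay f (2 * max A B)"
proof
  fix z assume z: "Re z > 0" "\<bar>Im z\<bar> \<le> Re z"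
  then have z2: "norm z \<le> 2 * Re z" using cmod_le[of z] by simp
  have A: "A \<ge> 0" using small[of "1/2"] by (intro order_trans[OF norm_ge_zero[of "f (1/2)"]]) simp
  show "norm (f z) \<le> 2 * max A B / (1 + (norm z)\<^sup>2)"
  proof (cases "norm z \<le> 1")
    case True
    have "norm (f z) \<le> max A B" using small[OF z(1) z2 True] by simp
    moreover have "max A B * (1 + (norm z)\<^sup>2) \<le> max A B * 2"
      using True A by (intro mult_left_mono) (auto simp: power_le_one max_def)
    ultimately show ?thesis
      by (smt (verit) mult.commute pos_le_divide_eq mult_right_mono zero_le_power2)
  next
    case False
    then have n: "norm z \<ge> 1" "(norm z)\<^sup>2 \<ge> 1" by (auto simp: one_le_power)
    have "norm (f z) \<le> max A B / (norm z)\<^sup>2"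
      using large[OF z(1) z2 n(1)] by (rule order_trans) (simp add: divide_right_mono)
    also have "\<dots> = 2 * max A B / (2 * (norm z)\<^sup>2)" by simp
    also have "\<dots> \<le> 2 * max A B / (1 + (norm z)\<^sup>2)"
      using n A by (intro divide_left_mono mult_pos_pos) (auto simp: max_def intro: add_pos_nonneg)
    finally show ?thesis .
  qed
qed (fact cont)

text \<open>With the pole removed and after division by the argument, F14 (ks) / k equals s g14 (ks)
  + 2 / (5 s k^2). The first terms form a Riemann sum of step s, the second ones add up to \<pi>^2 /
  (15 s) through the sum of the inverse squares.\<close>

definition g14 :: "complex \<Rightarrow> complex" where
  "g14 z = (F14 z - 2 / (5 * z)) / z"

text \<open>The threshold 1/2 is what \<open>norm z \<le> 2 * Re z\<close> and
  \<open>norm z \<ge> 1\<close> guarantee.\<close>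

lemma F14_bound_large:
  assumes "Re z \<ge> 1/2"
  shows "norm (F14 z) \<le> 3 / Re z"
proof -
  define r where "r = Re z"
  have r: "r \<ge> 1/2" using assms by (simp add: r_def)
  have "r \<le> exp r" using exp_ge_add_one_self[of r] by linarith
  then have er: "exp (- r) \<le> 1 / r"
    using r by (simp add: exp_minus field_simps)
  have "norm (1 - exp (- (5 * z))) \<ge> 5 * r / (1 + 5 * r)"
    using norm_1_minus_exp_ge[of "5 * z"] r by (simp add: r_def)
  moreover have "5 * r / (1 + 5 * r) \<ge> 5 / 7" using r by (simp add: field_simps)
  ultimately have den: "norm (1 - exp (- (5 * z))) \<ge> 5 / 7" by linarith
  have "norm (exp (- z) + exp (- (4 * z))) \<le> exp (- r) + exp (- (4 * r))"
    by (rule order_trans[OF norm_triangle_ineq]) (simp add: r_def)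
  also have "\<dots> \<le> 2 * exp (- r)" using r by simp
  also have "\<dots> \<le> 2 / r" using er by simp
  finally have "norm (F14 z) \<le> (2 / r) / (5 / 7)"
    unfolding F14_def norm_divide using den r by (intro frac_le) auto
  also have "\<dots> \<le> 3 / r" using r by (simp add: field_simps)
  finally show ?thesis by (simp add: r_def)
qed

text \<open>Over the denominator 5 z^2 (1 - exp (- 5 z)) the numerator \<open>N\<close> vanishes to
  third order: its terms of order 1 and 2 cancel, the latter because 1 + 4 = 5. The constant 161
  rounds up 335 * 12 / 25, where 335 = 5 + 5 * 16 + 2 * 125 collects the Taylor remainders.\<close>

lemma g14_small:
  assumes z: "Re z > 0" "norm z \<le> 2 * Re z" "norm z \<le> 1"
  shows "norm (g14 z) \<le> 161 * exp 5"
proof -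
  define n where "n = norm z"
  have n: "n > 0" "n \<le> 1" using z by (auto simp: n_def)
  define N where "N = 5 * z * (exp (- z) + exp (- (4 * z))) - 2 * (1 - exp (- (5 * z)))"
  have Re: "\<bar>Re z\<bar> \<le> 1" using abs_Re_le_cmod[of z] z by linarith
  have "norm (1 - exp (- (5 * z))) \<ge> 5 * Re z / (1 + 5 * Re z)"
    using norm_1_minus_exp_ge[of "5 * z"] z by simp
  moreover have "5 * Re z / (1 + 5 * Re z) \<ge> 5 * Re z / 6"
    using Re z by (intro divide_left_mono) auto
  ultimately have den: "norm (1 - exp (- (5 * z))) \<ge> 5 / 12 * n"
    using z unfolding n_def by linarith
  have R1: "norm (exp (- z) - (1 + - z)) \<le> exp 5 * n\<^sup>2"
    by (rule order_trans[OF exp_remainder_1]) (use Re in \<open>auto simp: n_def intro!: mult_right_mono\<close>)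
  have R2: "norm (exp (- (4 * z)) - (1 + - (4 * z))) \<le> exp 5 * (16 * n\<^sup>2)"
    by (rule order_trans[OF exp_remainder_1]) 
       (use Re in \<open>auto simp: n_def norm_mult power_mult_distrib abs_mult intro!: mult_right_mono\<close>)
  have R3: "norm (exp (- (5 * z)) - (1 + - (5 * z) + (- (5 * z))\<^sup>2 / 2)) \<le> exp 5 * (125 * n ^ 3)"
    by (rule order_trans[OF exp_remainder_2]) 
       (use Re in \<open>auto simp: n_def norm_mult power_mult_distrib abs_mult intro!: mult_right_mono\<close>)
  have "N = 5 * z * (exp (- z) - (1 + - z)) + 5 * z * (exp (- (4 * z)) - (1 + - (4 * z)))
          + 2 * (exp (- (5 * z)) - (1 + - (5 * z) + (- (5 * z))\<^sup>2 / 2))"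
    by (simp add: N_def algebra_simps power2_eq_square)
  also have "norm \<dots> \<le> 5 * n * (exp 5 * n\<^sup>2) + 5 * n * (exp 5 * (16 * n\<^sup>2)) + 2 * (exp 5 * (125 * n ^ 3))"
    by (intro norm_triangle_mono norm_mult_const_le R1 R2 R3) (simp_all add: n_def norm_mult)
  also have "\<dots> = 335 * exp 5 * n ^ 3" by (simp add: power2_eq_square power3_eq_cube)
  finally have num: "norm N \<le> 335 * exp 5 * n ^ 3" .
  have nz: "1 - exp (- (5 * z)) \<noteq> 0" using exp_neq_1_Re_pos[of "5 * z"] z by simp
  have "z \<noteq> 0" using z by auto
  then have "g14 z = N / (5 * z\<^sup>2 * (1 - exp (- (5 * z))))"
  proof -
    have "(a / D - 2 / (5 * z)) / z = (5 * z * a - 2 * D) / (5 * z\<^sup>2 * D)" if "D \<noteq> 0" for a D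
      using that \<open>z \<noteq> 0\<close> by (simp add: field_simps power2_eq_square)
    from this[OF nz] show ?thesis by (simp add: g14_def F14_def N_def)
  qed
  then have "norm (g14 z) = norm N / (5 * n\<^sup>2 * norm (1 - exp (- (5 * z))))"
    by (simp add: norm_divide norm_mult norm_power n_def)
  also have "\<dots> \<le> (335 * exp 5 * n ^ 3) / (5 * n\<^sup>2 * (5 / 12 * n))"
    using num den n by (intro frac_le mult_left_mono) auto
  also have "\<dots> = 335 * 12 / 25 * exp 5" using n by (simp add: field_simps power2_eq_square power3_eq_cube)
  finally show ?thesis by (rule order_trans) simp
qed

lemma g14_sector_decay: "sector_decay g14 (2 * max (161 * exp 5) 7)"
proof (intro sector_decayI)
  show "continuous_on {z. Re z > 0} g14"
    unfolding g14_def F14_def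
    using exp_neq_1_Re_pos[of "5 * _"] by (auto intro!: continuous_intros)
  fix z assume z: "Re z > 0" "norm z \<le> 2 * Re z" "norm z \<ge> 1"
  have "norm (F14 z) \<le> 3 / Re z" using z by (intro F14_bound_large) auto
  also have "\<dots> \<le> 3 / (norm z / 2)" using z by (intro divide_left_mono mult_pos_pos) auto
  also have "\<dots> = 6 / norm z" by simp
  finally have "norm (F14 z - 2 / (5 * z)) \<le> 6 / norm z + norm (2 / (5 * z))"
    using norm_triangle_ineq4[of "F14 z" "2 / (5 * z)"] by linarith
  also have "norm (2 / (5 * z)) = (2 / 5) / norm z" by (simp add: norm_divide norm_mult)
  also have "\<dots> \<le> 1 / norm z" by (intro divide_right_mono) auto
  finally have "norm (F14 z - 2 / (5 * z)) \<le> 7 / norm z" by simp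
  then have "norm (F14 z - 2 / (5 * z)) / norm z \<le> 7 / norm z / norm z"
    by (intro divide_right_mono) auto
  then show "norm (g14 z) \<le> 7 / (norm z)\<^sup>2"
    by (simp add: g14_def norm_divide power2_eq_square)
qed (rule g14_small)

text \<open>So \<open>1 / (exp z - 1) = 1 / z - exp (- z) / 2 + z * bern z\<close>. The constant term \<open>- 1 / 2\<close> at the
  origin is split off as \<open>- exp (- z) / 2\<close> because the remainder then still decays at infinity.\<close>

definition bern :: "complex \<Rightarrow> complex" where
  "bern z = (exp (- z) / (1 - exp (- z)) - 1 / z + exp (- z) / 2) / z"

text \<open>Over the denominator 2 z^2 (1 - exp (- z)) the numerator \<open>N\<close> again vanishes
  to third order. The summand exp (- z) / 2 is what makes its quadratic terms cancel.\<close>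

lemma bern_small:
  assumes z: "Re z > 0" "norm z \<le> 2 * Re z" "norm z \<le> 1"
  shows "norm (bern z) \<le> 18 * exp 2"
proof -
  define n where "n = norm z"
  have n: "n > 0" "n \<le> 1" using z by (auto simp: n_def)
  define N where "N = 3 * z * exp (- z) - 2 + 2 * exp (- z) - z * exp (- (2 * z))"
  have Re: "\<bar>Re z\<bar> \<le> 1" using abs_Re_le_cmod[of z] z by linarith
  have "norm (1 - exp (- z)) \<ge> Re z / (1 + Re z)"
    using norm_1_minus_exp_ge[of z] z by simp
  moreover have "Re z / (1 + Re z) \<ge> Re z / 2"
    using Re z by (intro divide_left_mono) auto
  ultimately have den: "norm (1 - exp (- z)) \<ge> 1 / 4 * n"
    using z unfolding n_def by linarith
  have R1: "norm (exp (- z) - (1 + - z)) \<le> exp 2 * n\<^sup>2"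
    by (rule order_trans[OF exp_remainder_1]) (use Re in \<open>auto simp: n_def intro!: mult_right_mono\<close>)
  have R2: "norm (exp (- (2 * z)) - (1 + - (2 * z))) \<le> exp 2 * (4 * n\<^sup>2)"
    by (rule order_trans[OF exp_remainder_1]) 
       (use Re in \<open>auto simp: n_def norm_mult power_mult_distrib abs_mult intro!: mult_right_mono\<close>)
  have R3: "norm (exp (- z) - (1 + - z + (- z)\<^sup>2 / 2)) \<le> exp 2 * n ^ 3"
    by (rule order_trans[OF exp_remainder_2]) (use Re in \<open>auto simp: n_def intro!: mult_right_mono\<close>)
  have "N = 3 * z * (exp (- z) - (1 + - z)) + 2 * (exp (- z) - (1 + - z + (- z)\<^sup>2 / 2))
          - z * (exp (- (2 * z)) - (1 + - (2 * z)))"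
    by (simp add: N_def algebra_simps power2_eq_square)
  also have "norm \<dots> \<le> 3 * n * (exp 2 * n\<^sup>2) + 2 * (exp 2 * n ^ 3) + n * (exp 2 * (4 * n\<^sup>2))"
    by (intro order_trans[OF norm_triangle_ineq4] add_mono norm_triangle_mono norm_mult_const_le R1 R2 R3)
       (simp_all add: n_def norm_mult)
  also have "\<dots> = 9 * exp 2 * n ^ 3" by (simp add: power2_eq_square power3_eq_cube)
  finally have num: "norm N \<le> 9 * exp 2 * n ^ 3" .
  have nz: "1 - exp (- z) \<noteq> 0" using exp_neq_1_Re_pos[of z] z by simp
  have "exp (- (2 * z)) = exp (- z) * exp (- z)" by (simp flip: exp_add)
  moreover have "z \<noteq> 0" using z by auto
  ultimately have "bern z = N / (2 * z\<^sup>2 * (1 - exp (- z)))"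
    using nz by (simp add: bern_def N_def field_simps power2_eq_square)
  then have "norm (bern z) = norm N / (2 * n\<^sup>2 * norm (1 - exp (- z)))"
    by (simp add: norm_divide norm_mult norm_power n_def)
  also have "\<dots> \<le> (9 * exp 2 * n ^ 3) / (2 * n\<^sup>2 * (1 / 4 * n))"
    using num den n by (intro frac_le mult_left_mono) auto
  also have "\<dots> = 18 * exp 2" using n by (simp add: field_simps power2_eq_square power3_eq_cube)
  finally show ?thesis .
qed

lemma bern_sector_decay: "sector_decay bern (2 * max (18 * exp 2) 9)"
proof (intro sector_decayI)
  show "continuous_on {z. Re z > 0} bern"
    unfolding bern_def
    using exp_neq_1_Re_pos by (auto intro!: continuous_intros)
  fix z assume z: "Re z > 0" "norm z \<le> 2 * Re z" "norm z \<ge> 1"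
  define r where "r = Re z"
  have r: "r \<ge> 1/2" using z by (simp add: r_def)
  have "r \<le> exp r" using exp_ge_add_one_self[of r] by linarith
  then have er: "exp (- r) \<le> 1 / r"
    using r by (simp add: exp_minus field_simps)
  have "r / (1 + r) \<ge> 1 / 3" using r by (simp add: field_simps)
  then have den: "norm (1 - exp (- z)) \<ge> 1 / 3"
    using norm_1_minus_exp_ge[of z] r unfolding r_def by linarith
  have "norm (exp (- z) / (1 - exp (- z))) \<le> (1 / r) / (1 / 3)"
    unfolding norm_divide using den r er by (intro frac_le) (auto simp: r_def)
  moreover have "1 / r \<le> 2 / r" using r by (intro divide_right_mono) auto
  then have "norm (exp (- z) / 2) \<le> 1 / r" using er by (simp add: r_def norm_divide)
  ultimately have "norm (exp (- z) / (1 - exp (- z)) - 1 / z + exp (- z) / 2) \<le> (1 / r) / (1 / 3) + norm (1 / z) + 1 / r"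
    by (intro order_trans[OF norm_triangle_ineq4] norm_triangle_mono) auto
  also have "\<dots> = 4 / r + 1 / norm z" by (simp add: norm_divide)
  also have "4 / r \<le> 4 / (norm z / 2)" using z by (intro divide_left_mono mult_pos_pos) (auto simp: r_def)
  also have "4 / (norm z / 2) + 1 / norm z = 9 / norm z" by simp
  finally have "norm (exp (- z) / (1 - exp (- z)) - 1 / z + exp (- z) / 2) / norm z \<le> 9 / norm z / norm z"
    by (intro divide_right_mono) auto
  then show "norm (bern z) \<le> 9 / (norm z)\<^sup>2"
    by (simp add: bern_def norm_divide power2_eq_square)
qed (rule bern_small)

section \<open>The constant in the asymptotics of the generating function\<close>

text \<open>Fubini for double series. The inner sums are supplied as values \<open>r\<close> and
  \<open>c\<close>, so that convergence of both outer sums is part of the conclusion.\<close>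

lemma double_sums_swap:
  fixes a :: "nat \<Rightarrow> nat \<Rightarrow> real"
  assumes bound: "\<And>k n. \<bar>a k n\<bar> \<le> u k * v n" and u: "summable u" and v: "summable v"
    and nonneg: "\<And>k. u k \<ge> 0" "\<And>n. v n \<ge> 0"
    and rows: "\<And>k. a k sums r k" and cols: "\<And>n. (\<lambda>k. a k n) sums c n"
  obtains X where "r sums X" "c sums X"
proof -
  have us: "u summable_on UNIV" and vs: "v summable_on UNIV"
    using u v nonneg by (auto intro: norm_summable_imp_summable_on)
  have "(\<lambda>(k, n). a k n) summable_on UNIV \<times> UNIV"
  proof (rule abs_summable_summable, rule Infinite_Sum.abs_summable_on_comparison_test')
    show "(\<lambda>(k, n). u k * v n) summable_on UNIV \<times> UNIV"
    proof (rule summable_on_SigmaI)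
      show "((\<lambda>n. case (k, n) of (k, n) \<Rightarrow> u k * v n) has_sum u k * infsum v UNIV) UNIV" for k
        using has_sum_cmult_right[OF has_sum_infsum[OF vs]] by simp
      show "(\<lambda>k. u k * infsum v UNIV) summable_on UNIV"
        by (rule summable_on_cmult_left[OF us])
    qed (use nonneg in auto)
  qed (use bound in auto)
  then obtain X where X: "((\<lambda>(k, n). a k n) has_sum X) (UNIV \<times> UNIV)"
    by (auto simp: summable_on_def)
  have row: "(a k has_sum r k) UNIV" for k
    using rows[of k] bound[of k]
    by (intro norm_summable_imp_has_sum summable_comparison_test'[OF summable_mult[OF v, of "u k"], of 0]) auto
  have col: "((\<lambda>k. a k n) has_sum c n) UNIV" for n
    using cols[of n] bound[of _ n]
    by (intro norm_summable_imp_has_sum summable_comparison_test'[OF summable_mult2[OF u, of "v n"], of 0]) auto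
  have "(r has_sum X) UNIV" by (rule has_sum_SigmaD[OF X]) (simp add: row)
  moreover have "((\<lambda>(n, k). a k n) has_sum X) (UNIV \<times> UNIV)"
    using X by (subst (asm) has_sum_swap) (simp add: case_prod_unfold)
  then have "(c has_sum X) UNIV" by (rule has_sum_SigmaD) (simp add: col)
  ultimately show thesis using that by (auto intro: has_sum_imp_sums)
qed

lemma sums_power_over:
  fixes q :: real
  assumes "0 \<le> q" "q < 1"
  shows "(\<lambda>k. q ^ Suc k / real (Suc k)) sums - ln (1 - q)"
proof -
  have "(\<lambda>n. - (q ^ n / real n)) sums ln (1 - q)"
    using ln_series'[of "- q"] assms by (simp add: sums_iff)
  from sums_minus[OF this] have "(\<lambda>n. q ^ n / real n) sums - ln (1 - q)" by simp
  then show ?thesis by (subst sums_Suc_iff) simp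
qed

section \<open>The value of the character product\<close>

lemma two_cos_pi_fifth: "2 * cos (pi / 5) = golden_ratio"
proof -
  define c where "c = cos (pi / 5)"
  have pos: "c > 0" unfolding c_def by (intro cos_gt_zero_pi) (auto intro: less_trans[OF _ pi_gt_zero])
  \<comment> \<open>As 3 \<pi> / 5 and 2 \<pi> / 5 add up to \<pi>, the multiple angle formulas give
    a cubic for the cosine. It has the factor c + 1, and the positive root of the remaining
    quadratic is half the golden ratio.\<close>
  have "cos (3 * (pi / 5)) = cos (pi - 2 * (pi / 5))" by simp
  also have "\<dots> = - cos (2 * (pi / 5))" by (rule cos_pi_minus)
  finally have "4 * c ^ 3 - 3 * c = - (2 * c\<^sup>2 - 1)"
    unfolding cos_treble_cos cos_double_cos c_def .
  then have "(c + 1) * (4 * c\<^sup>2 - 2 * c - 1) = 0" by (simp add: algebra_simps power2_eq_square power3_eq_cube)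
  then have "4 * c\<^sup>2 - 2 * c - 1 = 0" using pos by simp
  then have "(4 * c - 1)\<^sup>2 = 5" by (simp add: algebra_simps power2_eq_square)
  then have "sqrt 5 = \<bar>4 * c - 1\<bar>" by (metis real_sqrt_abs)
  moreover have "4 * c - 1 > 0"
  proof (rule ccontr)
    assume "\<not> 4 * c - 1 > 0"
    then have "\<bar>4 * c - 1\<bar> \<le> 1" using pos by simp
    moreover have "sqrt 5 > 1" by simp
    ultimately show False using \<open>sqrt 5 = _\<close> by simp
  qed
  ultimately show ?thesis by (simp add: golden_ratio_def c_def)
qed

text \<open>The limit for x \<rightarrow> 0 of one period of the product of (1 - exp (- m x))^(-
  \<chi>(m)), with \<chi> the quadratic character modulo 5: each factor behaves like m x, and the
  powers of x cancel.\<close>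

definition ratio_factor :: "nat \<Rightarrow> real" where
  "ratio_factor j = (5 * j + 2) * (5 * j + 3) / ((5 * j + 1) * (5 * j + 4))"

text \<open>Regrouping the factors as (5k - 2) (5k + 2) and (5k - 1) (5k + 1) gives the partial
  products of the sine at 2/5 and 1/5. Moving 5j + 2 and 5j + 1 by one index leaves the boundary
  factor.\<close>

lemma prod_ratio_factor:
  "(\<Prod>j<N. ratio_factor j) = 2 * (5 * N + 1) / (5 * N + 2) *
     ((\<Prod>k=1..N. 1 - (2/5)\<^sup>2 / (real k)\<^sup>2) / (\<Prod>k=1..N. 1 - (1/5)\<^sup>2 / (real k)\<^sup>2))"
proof (induction N)
  case (Suc N)
  define n where "n = real N"
  have n: "n \<ge> 0" by (simp add: n_def)
  define A B where "A = (\<Prod>k=1..N. 1 - (2/5)\<^sup>2 / (real k)\<^sup>2)" and "B = (\<Prod>k=1..N. 1 - (1/5)\<^sup>2 / (real k)\<^sup>2)"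
  have a: "1 - (2/5)\<^sup>2 / (n + 1)\<^sup>2 = (5 * n + 3) * (5 * n + 7) / (25 * (n + 1)\<^sup>2)"
    and b: "1 - (1/5)\<^sup>2 / (n + 1)\<^sup>2 = (5 * n + 4) * (5 * n + 6) / (25 * (n + 1)\<^sup>2)"
    using n by (simp_all add: divide_simps) (simp_all add: algebra_simps power2_eq_square)
  have "(\<Prod>j<Suc N. ratio_factor j) = 2 * (5 * n + 1) / (5 * n + 2) * (A / B) *
      ((5 * n + 2) * (5 * n + 3) / ((5 * n + 1) * (5 * n + 4)))"
    using Suc.IH by (simp add: A_def B_def n_def ratio_factor_def)
  also have "\<dots> = 2 * (5 * n + 6) / (5 * n + 7) *
      (A * ((5 * n + 3) * (5 * n + 7) / (25 * (n + 1)\<^sup>2)) / (B * ((5 * n + 4) * (5 * n + 6) / (25 * (n + 1)\<^sup>2))))"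
  proof -
    have nz: "5 * n + 1 \<noteq> 0" "5 * n + 2 \<noteq> 0" "5 * n + 4 \<noteq> 0" "5 * n + 6 \<noteq> 0" "5 * n + 7 \<noteq> 0" "(n + 1) \<noteq> 0"
      using n by auto
    \<comment> \<open>For \<open>B = 0\<close> both sides are divisions by zero and agree, which
      saves a proof that the product is nonzero.\<close>
    then show ?thesis by (cases "B = 0") (simp_all add: divide_simps, simp add: algebra_simps)
  qed
  finally show ?case
    unfolding a[symmetric] b[symmetric] by (simp add: A_def B_def n_def add.commute)
qed simp

lemma ratio_factor_gt_1: "ratio_factor j > 1"
  by (simp add: ratio_factor_def divide_simps algebra_simps add_pos_nonneg)

text \<open>Euler's sine product gives sin (2\<pi>/5) / sin (\<pi>/5) = 2 cos (\<pi>/5): the limit 2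
  of the boundary factor cancels against the ratio of the denominators 2\<pi>/5 and \<pi>/5.\<close>

lemma sums_ln_ratio_factor: "(\<lambda>j. ln (ratio_factor j)) sums ln golden_ratio"
proof -
  have s: "sin (pi / 5) > 0" by (intro sin_gt_zero) (auto intro: less_trans[OF _ pi_gt_zero])
  have A: "(\<lambda>N. \<Prod>k=1..N. 1 - (2/5)\<^sup>2 / (real k)\<^sup>2) \<longlonglongrightarrow> sin (pi * (2/5)) / (pi * (2/5))"
    and B: "(\<lambda>N. \<Prod>k=1..N. 1 - (1/5)\<^sup>2 / (real k)\<^sup>2) \<longlonglongrightarrow> sin (pi * (1/5)) / (pi * (1/5))"
    by (rule sin_product_formula_real'; simp)+
  have "(\<lambda>N. 2 * (5 * real N + 1) / (5 * real N + 2)) \<longlonglongrightarrow> 2" by real_asymp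
  from tendsto_mult[OF this tendsto_divide[OF A B]]
  have "(\<lambda>N. \<Prod>j<N. ratio_factor j) \<longlonglongrightarrow>
      2 * ((sin (pi * (2/5)) / (pi * (2/5))) / (sin (pi * (1/5)) / (pi * (1/5))))"
    unfolding prod_ratio_factor using s by simp
  also have "sin (pi * (2/5)) = 2 * sin (pi / 5) * cos (pi / 5)"
    using sin_double[of "pi / 5"] by (simp add: mult.commute)
  also have "2 * ((2 * sin (pi / 5) * cos (pi / 5) / (pi * (2/5))) / (sin (pi * (1/5)) / (pi * (1/5)))) = golden_ratio"
  proof -
    have "2 * ((2 * t * c / (pi * (2/5))) / (t / (pi * (1/5)))) = 2 * c" if "t \<noteq> 0" for t c :: real
      using that by (simp add: field_simps)
    then show ?thesis using s two_cos_pi_fifth by simp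
  qed
  finally have "(\<lambda>N. ln (\<Prod>j<N. ratio_factor j)) \<longlonglongrightarrow> ln golden_ratio"
    by (rule tendsto_ln) (simp add: golden_ratio_def add_pos_nonneg less_imp_neq[THEN not_sym])
  also have "(\<lambda>N. ln (\<Prod>j<N. ratio_factor j)) = (\<lambda>N. \<Sum>j<N. ln (ratio_factor j))"
  proof (intro ext ln_prod)
    show "ratio_factor j \<noteq> 0" for j using ratio_factor_gt_1[of j] by auto
  qed auto
  finally show ?thesis by (simp add: sums_def)
qed

interpretation g14: sector_decay g14 "2 * max (161 * exp 5) 7"
  by (rule g14_sector_decay)

interpretation bern: sector_decay bern "2 * max (18 * exp 2) 9"
  by (rule bern_sector_decay)

section \<open>Logarithms of partition products as Riemann sums\<close>

lemma inverse_squares_sums_complex: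
  "(\<lambda>k. c / (of_nat (Suc k))\<^sup>2) sums (c * (of_real pi)\<^sup>2 / 6 :: complex)"
proof -
  have "(\<lambda>k. complex_of_real (1 / (real k + 1)\<^sup>2)) sums of_real (pi\<^sup>2 / 6)"
    using inverse_squares_sums by (subst sums_of_real_iff) (simp add: add.commute)
  from sums_mult[OF this, of c] show ?thesis by (simp add: add.commute)
qed

lemma P14_eq_exp:
  assumes s: "Re s > 0" "\<bar>Im s\<bar> \<le> Re s"
  shows "(\<lambda>k. F14 (of_nat (Suc k) * s) / of_nat (Suc k)) sums
           (of_real (pi\<^sup>2 / 15) / s + (\<Sum>k. s * g14 (of_nat (Suc k) * s)))"
    and "P14 s = exp (of_real (pi\<^sup>2 / 15) / s + (\<Sum>k. s * g14 (of_nat (Suc k) * s)))"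
proof -
  have nz: "s \<noteq> 0" using s by auto
  have "summable (\<lambda>k. s * g14 (of_nat (Suc k) * s))"
    by (intro summable_mult summable_norm_cancel[OF g14.riemann_sum(1)[OF s]])
  from sums_add[OF inverse_squares_sums_complex[of "2 / (5 * s)"] summable_sums[OF this]]
  have "(\<lambda>k. 2 / (5 * s) / (of_nat (Suc k))\<^sup>2 + s * g14 (of_nat (Suc k) * s)) sums
          (2 / (5 * s) * (of_real pi)\<^sup>2 / 6 + (\<Sum>k. s * g14 (of_nat (Suc k) * s)))" .
  also have "(\<lambda>k. 2 / (5 * s) / (of_nat (Suc k))\<^sup>2 + s * g14 (of_nat (Suc k) * s)) =
             (\<lambda>k. F14 (of_nat (Suc k) * s) / of_nat (Suc k))"
  proof
    fix k
    have "2 / (5 * s) / K\<^sup>2 + s * ((F - 2 / (5 * (K * s))) / (K * s)) = F / K" if "K \<noteq> 0" for K F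
      using nz that by (simp add: field_simps power2_eq_square)
    from this[of "of_nat (Suc k)"] show "2 / (5 * s) / (of_nat (Suc k))\<^sup>2 + s * g14 (of_nat (Suc k) * s) =
       F14 (of_nat (Suc k) * s) / of_nat (Suc k)"
      unfolding g14_def by (simp del: of_nat_Suc)
  qed
  also have "2 / (5 * s) * (of_real pi)\<^sup>2 / 6 = of_real (pi\<^sup>2 / 15) / s" by simp
  finally show sums: "(\<lambda>k. F14 (of_nat (Suc k) * s) / of_nat (Suc k)) sums
           (of_real (pi\<^sup>2 / 15) / s + (\<Sum>k. s * g14 (of_nat (Suc k) * s)))" .
  then show "P14 s = exp (of_real (pi\<^sup>2 / 15) / s + (\<Sum>k. s * g14 (of_nat (Suc k) * s)))"
    using P14_eq[OF s(1)] by (simp add: sums_iff)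
qed

lemma of_real_exp_power: "complex_of_real (exp (- x) ^ n) = exp (- (of_nat n * of_real x))"
  by (simp add: exp_of_real[symmetric] exp_of_nat_mult[symmetric])

text \<open>The series is minus the logarithm of Euler's product of 1 - exp (- m x) over all m \<ge>
  1. The pole, the half exponential and the remainder in the decomposition behind
  \<open>bern\<close> yield the three summands: the inverse squares, the logarithm series and a
  Riemann sum.\<close>

lemma bern_sums:
  fixes x :: real
  assumes x: "x > 0"
  shows "(\<lambda>k. exp (- (of_nat (Suc k) * of_real x)) / (1 - exp (- (of_nat (Suc k) * of_real x))) / of_nat (Suc k)) sums
     (of_real (pi\<^sup>2 / (6 * x)) + of_real (ln (1 - exp (- x)) / 2) +
      (\<Sum>k. of_real x * bern (of_nat (Suc k) * of_real x)))"
proof -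
  let ?s = "complex_of_real x"
  have s: "Re ?s > 0" "\<bar>Im ?s\<bar> \<le> Re ?s" using x by auto
  have "summable (\<lambda>k. ?s * bern (of_nat (Suc k) * ?s))"
    by (intro summable_mult summable_norm_cancel[OF bern.riemann_sum(1)[OF s]])
  note 1 = summable_sums[OF this]
  have "(\<lambda>k. - (exp (- x) ^ Suc k / real (Suc k)) / 2) sums (- (- ln (1 - exp (- x))) / 2)"
    using x by (intro sums_divide sums_minus sums_power_over) auto
  then have 2: "(\<lambda>k. complex_of_real (- (exp (- x) ^ Suc k / real (Suc k)) / 2)) sums of_real (ln (1 - exp (- x)) / 2)"
    by (subst sums_of_real_iff) simp
  have 3: "(\<lambda>k. 1 / ?s / (of_nat (Suc k))\<^sup>2) sums of_real (pi\<^sup>2 / (6 * x))"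
    using inverse_squares_sums_complex[of "1 / ?s"] by (simp add: mult.commute)
  have "1 / ?s / (of_nat (Suc k))\<^sup>2 + complex_of_real (- (exp (- x) ^ Suc k / real (Suc k)) / 2)
          + ?s * bern (of_nat (Suc k) * ?s) =
        exp (- (of_nat (Suc k) * ?s)) / (1 - exp (- (of_nat (Suc k) * ?s))) / of_nat (Suc k)" for k
  proof -
    define w where "w = exp (- (of_nat (Suc k) * ?s))"
    have "complex_of_real (exp (- x) ^ Suc k) = w"
      unfolding w_def by (rule of_real_exp_power)
    then have e: "complex_of_real (- (exp (- x) ^ Suc k / real (Suc k)) / 2) = - (w / of_nat (Suc k)) / 2"
      by (simp del: power_Suc of_nat_Suc)
    have "1 / t / K\<^sup>2 + - (w / K) / 2 + t * ((W - 1 / (K * t) + w / 2) / (K * t)) = W / K"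
      if "K \<noteq> 0" "t \<noteq> 0" for K t W
      using that by (simp add: field_simps power2_eq_square)
    from this[of "of_nat (Suc k)" ?s] show ?thesis
      unfolding bern_def e using x by (simp add: w_def del: of_nat_Suc)
  qed
  with sums_add[OF sums_add[OF 3 2] 1] show ?thesis by simp
qed

text \<open>One period of the sum of - \<chi>(m) ln (1 - exp (- m x)), with \<chi> the quadratic
  character modulo 5. Within a period the four logarithms nearly cancel, which is what makes the sum
  over \<open>j\<close> uniform in \<open>x\<close>.\<close>

definition log_quotient :: "real \<Rightarrow> nat \<Rightarrow> real" where
  "log_quotient x j = ln (1 - exp (- ((5 * j + 2) * x))) + ln (1 - exp (- ((5 * j + 3) * x)))
     - ln (1 - exp (- ((5 * j + 1) * x))) - ln (1 - exp (- ((5 * j + 4) * x)))"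

text \<open>One double series summed in two ways: over \<open>j\<close> it is geometric with ratio
  \<open>w k ^ 5\<close>, over \<open>k\<close> each power contributes the series of - ln (1 - exp
  (- m x)).\<close>

lemma character_sum_log:
  fixes x :: real
  assumes x: "x > 0"
  defines "w \<equiv> (\<lambda>k. exp (- x) ^ Suc k)"
  obtains X where "(\<lambda>k. (w k - w k ^ 2 - w k ^ 3 + w k ^ 4) / (1 - w k ^ 5) / real (Suc k)) sums X"
    and "log_quotient x sums X"
proof -
  define q where "q = exp (- x)"
  have q: "0 < q" "q < 1" using x by (auto simp: q_def)
  have w: "w k = q ^ Suc k" "0 < w k" "w k < 1" for k
    using q by (auto simp: w_def q_def power_less_one_iff simp del: power_Suc)
  define a where "a = (\<lambda>k j. (w k ^ (5 * j + 1) - w k ^ (5 * j + 2) - w k ^ (5 * j + 3) + w k ^ (5 * j + 4)) / real (Suc k))"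
  have sums_pow: "(\<lambda>k. w k ^ m / real (Suc k)) sums - ln (1 - exp (- (real m * x)))" if "m > 0" for m
  proof -
    have "q ^ m < 1" using q that by (simp add: power_less_one_iff)
    then have "(\<lambda>k. (q ^ m) ^ Suc k / real (Suc k)) sums - ln (1 - q ^ m)"
      using q by (intro sums_power_over) auto
    moreover have "(q ^ m) ^ Suc k = w k ^ m" for k
      unfolding w by (simp only: power_mult[symmetric] mult.commute)
    moreover have "q ^ m = exp (- (real m * x))"
      by (simp add: q_def exp_of_nat_mult[symmetric])
    ultimately show ?thesis by simp
  qed
  show thesis
  \<comment> \<open>Each of the four powers is q^((k + 1) m) with m \<ge> 5j + 1, and its exponent
    is at least k + j.\<close>
  proof (rule double_sums_swap[of a "\<lambda>k. 4 * q ^ k" "\<lambda>j. q ^ j"])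
    fix k j
    have pw: "w k ^ (5 * j + i) \<le> q ^ k * q ^ j" if "i \<ge> 1" for i
    proof -
      have "w k ^ (5 * j + i) = q ^ (Suc k * (5 * j + i))" unfolding w by (simp only: power_mult)
      also have "\<dots> \<le> q ^ (k + j)"
      proof (rule power_decreasing)
        have "k + j \<le> Suc k * (j + 1)" by simp
        also have "\<dots> \<le> Suc k * (5 * j + i)" using that by (intro mult_le_mono2) simp
        finally show "k + j \<le> Suc k * (5 * j + i)" .
      qed (use q in auto)
      finally show ?thesis by (simp add: power_add)
    qed
    have nn: "0 \<le> w k ^ i" for i using w[of k] by simp
    have "\<bar>w k ^ (5 * j + 1) - w k ^ (5 * j + 2) - w k ^ (5 * j + 3) + w k ^ (5 * j + 4)\<bar> \<le> 4 * (q ^ k * q ^ j)"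
      using pw[of 1] pw[of 2] pw[of 3] pw[of 4] nn[of "5*j+1"] nn[of "5*j+2"] nn[of "5*j+3"] nn[of "5*j+4"]
      by linarith
    moreover have "\<bar>a k j\<bar> \<le> \<bar>w k ^ (5 * j + 1) - w k ^ (5 * j + 2) - w k ^ (5 * j + 3) + w k ^ (5 * j + 4)\<bar>"
      unfolding a_def abs_divide
      using divide_left_mono[of 1 "\<bar>real (Suc k)\<bar>" "\<bar>w k ^ (5 * j + 1) - w k ^ (5 * j + 2) - w k ^ (5 * j + 3) + w k ^ (5 * j + 4)\<bar>"]
      by simp
    ultimately show "\<bar>a k j\<bar> \<le> 4 * q ^ k * q ^ j" by simp
  next
    fix k
    have "\<bar>w k ^ 5\<bar> < 1" using w[of k] by (simp add: power_less_one_iff)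
    then have "(\<lambda>j. (w k ^ 5) ^ j) sums (1 / (1 - w k ^ 5))" by (intro geometric_sums) simp
    note sums = sums_divide[OF sums_mult[OF this, of "w k - w k ^ 2 - w k ^ 3 + w k ^ 4"], of "real (Suc k)"]
    have "w k ^ (5 * j + i) = w k ^ i * (w k ^ 5) ^ j" for i j
      by (simp add: power_add mult.commute flip: power_mult)
    then have "a k = (\<lambda>j. (w k - w k ^ 2 - w k ^ 3 + w k ^ 4) * (w k ^ 5) ^ j / real (Suc k))"
      unfolding a_def by (simp only: left_diff_distrib distrib_right power_one_right)
    with sums
    show "a k sums ((w k - w k ^ 2 - w k ^ 3 + w k ^ 4) / (1 - w k ^ 5) / real (Suc k))"
      by (simp del: of_nat_Suc)
  next
    fix j
    have "(\<lambda>k. w k ^ (5 * j + 1) / real (Suc k) - w k ^ (5 * j + 2) / real (Suc k) - w k ^ (5 * j + 3) / real (Suc k)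
        + w k ^ (5 * j + 4) / real (Suc k)) sums
       (- ln (1 - exp (- (real (5 * j + 1) * x))) - - ln (1 - exp (- (real (5 * j + 2) * x)))
        - - ln (1 - exp (- (real (5 * j + 3) * x))) + - ln (1 - exp (- (real (5 * j + 4) * x))))"
      by (intro sums_add sums_diff sums_pow) auto
    moreover have "log_quotient x j = - ln (1 - exp (- (real (5 * j + 1) * x))) - - ln (1 - exp (- (real (5 * j + 2) * x)))
        - - ln (1 - exp (- (real (5 * j + 3) * x))) + - ln (1 - exp (- (real (5 * j + 4) * x)))"
      by (simp only: log_quotient_def of_nat_add of_nat_mult of_nat_numeral of_nat_1)
    ultimately show "(\<lambda>k. a k j) sums log_quotient x j"
      by (simp only: a_def add_divide_distrib diff_divide_distrib)
  next
    show "summable (\<lambda>k. 4 * q ^ k)" "summable (\<lambda>j. q ^ j)"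
      using q by (auto intro!: summable_mult summable_geometric)
  qed (use q that in auto)
qed

section \<open>The character product as its argument tends to the origin\<close>

lemma one_minus_exp_ge:
  fixes y :: real
  assumes "y > 0"
  shows "1 - exp (- y) \<ge> y / (1 + y)"
proof -
  have "1 + y \<le> exp y" by (rule exp_ge_add_one_self)
  then show ?thesis using assms by (simp add: exp_minus field_simps)
qed

text \<open>A summable bound free of \<open>x\<close>, as Tannery's theorem needs. The numerator
  exceeds the denominator by O (x^2 exp (- Y)), while the denominator is at least (m + 1) (m + 4)
  x^2 / (1 + Y)^2. The powers of \<open>x\<close> cancel, and the exponential absorbs (1 +
  Y)^2.\<close>

lemma log_quotient_bound:
  assumes x: "0 < x" "x \<le> 1"
  shows "\<bar>log_quotient x j\<bar> \<le> 4 * exp 3 / (real (Suc j))\<^sup>2"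
proof -
  define q where "q = exp (- x)"
  define p where "p = (\<lambda>m::real. 1 - exp (- (m * x)))"
  define m where "m = 5 * real j"
  define Y where "Y = (m + 4) * x"
  have m: "m \<ge> 0" by (simp add: m_def)
  have Y: "Y > 0" using x m by (simp add: Y_def)
  have pos: "p i > 0" if "i > 0" for i using that x by (simp add: p_def)
  have lower: "p i \<ge> i * x / (1 + Y)" if "i > 0" "i \<le> m + 4" for i
  proof -
    have "i * x / (1 + Y) \<le> i * x / (1 + i * x)"
      using that x Y unfolding Y_def
      by (intro divide_left_mono add_left_mono mult_right_mono mult_pos_pos) (auto intro: add_pos_pos)
    also have "\<dots> \<le> p i" using one_minus_exp_ge[of "i * x"] that x by (simp add: p_def)
    finally show ?thesis .
  qed
  have lq: "log_quotient x j = ln (p (m + 2) * p (m + 3) / (p (m + 1) * p (m + 4)))"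
    using pos m by (simp add: log_quotient_def ln_div ln_mult p_def[symmetric] m_def[symmetric] add_pos_nonneg less_imp_neq[THEN not_sym])
       (simp add: p_def m_def)
  \<comment> \<open>As 2 + 3 = 1 + 4, the products of two exponentials cancel, and 1 - q - q^2 + q^3
    = (1 - q) (1 - q^2).\<close>
  have diff: "p (m + 2) * p (m + 3) - p (m + 1) * p (m + 4) = exp (- ((m + 1) * x)) * (1 - exp (- x)) * (1 - exp (- (2 * x)))"
  proof -
    define E where "E = exp (- (m * x))"
    have 1: "exp (- ((m + 1) * x)) = E * q" "exp (- ((m + 2) * x)) = E * q^2" "exp (- ((m + 3) * x)) = E * q^3" "exp (- ((m + 4) * x)) = E * q^4"
       "exp (- (2 * x)) = q^2"
      by (simp_all add: E_def q_def exp_of_nat_mult[symmetric] exp_add[symmetric] algebra_simps)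
    show ?thesis unfolding p_def 1 q_def[symmetric] by (simp add: algebra_simps power2_eq_square power3_eq_cube power4_eq_xxxx)
  qed
  define d where "d = exp (- ((m + 1) * x)) * (1 - exp (- x)) * (1 - exp (- (2 * x)))"
  have d: "d \<ge> 0" using x by (simp add: d_def)
  have den: "p (m + 1) * p (m + 4) > 0" using pos m by simp
  have quot: "p (m + 2) * p (m + 3) / (p (m + 1) * p (m + 4)) = 1 + d / (p (m + 1) * p (m + 4))"
  proof -
    have "p (m + 2) * p (m + 3) = p (m + 1) * p (m + 4) + d" using diff by (simp add: d_def)
    then show ?thesis using pos[of "m + 1"] pos[of "m + 4"] m by (simp add: add_divide_distrib)
  qed
  then have "log_quotient x j \<ge> 0" using d den by (simp add: lq ln_ge_zero)
  moreover have "log_quotient x j \<le> d / (p (m + 1) * p (m + 4))"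
    unfolding lq quot using d den by (intro ln_add_one_self_le_self) simp
  moreover have "d / (p (m + 1) * p (m + 4)) \<le> 4 * exp 3 / (real (Suc j))\<^sup>2"
  proof -
    have e1: "(1 - exp (- x)) * (1 - exp (- (2 * x))) \<le> x * (2 * x)"
    proof (rule mult_mono)
      show "1 - exp (- x) \<le> x" using exp_ge_add_one_self[of "- x"] by linarith
      show "1 - exp (- (2 * x)) \<le> 2 * x" using exp_ge_add_one_self[of "- (2 * x)"] by linarith
    qed (use x in auto)
    \<comment> \<open>The exponents differ by 3x, which is at most 3 because
      \<open>x \<le> 1\<close>.\<close>
    have e2: "exp (- ((m + 1) * x)) \<le> exp (- Y) * exp 3"
      using x by (simp add: exp_add[symmetric] Y_def algebra_simps)
    have "exp (- ((m + 1) * x)) * ((1 - exp (- x)) * (1 - exp (- (2 * x)))) \<le> (exp (- Y) * exp 3) * (x * (2 * x))"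
      by (rule mult_mono[OF e2 e1]) (use x in auto)
    then have 1: "d \<le> exp (- Y) * exp 3 * (x * (2 * x))" by (simp add: d_def mult.assoc)
    have 2: "p (m + 1) * p (m + 4) \<ge> ((m + 1) * x / (1 + Y)) * ((m + 4) * x / (1 + Y))"
      using m x Y by (intro mult_mono lower less_imp_le[OF pos]) (auto intro: add_nonneg_pos)
    have "d / (p (m + 1) * p (m + 4)) \<le> exp (- Y) * exp 3 * (x * (2 * x)) / (((m + 1) * x / (1 + Y)) * ((m + 4) * x / (1 + Y)))"
      using 1 2 d m x Y by (intro frac_le mult_pos_pos divide_pos_pos) auto
    also have "\<dots> = 2 * exp 3 * ((1 + Y)\<^sup>2 * exp (- Y)) / ((m + 1) * (m + 4))"
    proof -
      have "e * f * (x * (2 * x)) / ((a * x / c) * (b * x / c)) = 2 * f * (c\<^sup>2 * e) / (a * b)"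
        if "a \<noteq> 0" "b \<noteq> 0" "c \<noteq> 0" for a b c e f :: real
        using that x by (simp add: field_simps power2_eq_square)
      then show ?thesis using m Y by simp
    qed
    also have "(1 + Y)\<^sup>2 * exp (- Y) \<le> 2"
    proof -
      have "(1 + Y)\<^sup>2 \<le> 2 * (1 + Y + Y\<^sup>2 / 2)" using Y by (simp add: power2_eq_square algebra_simps)
      also have "\<dots> \<le> 2 * exp Y" using exp_lower_Taylor_quadratic[of Y] Y by simp
      finally show ?thesis by (simp add: exp_minus field_simps)
    qed
    then have "2 * exp 3 * ((1 + Y)\<^sup>2 * exp (- Y)) / ((m + 1) * (m + 4)) \<le> 2 * exp 3 * 2 / ((m + 1) * (m + 4))"
      using m by (intro divide_right_mono mult_left_mono) auto
    also have "\<dots> \<le> 2 * exp 3 * 2 / (real (Suc j))\<^sup>2"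
    proof (intro divide_left_mono)
      have "real (Suc j) * real (Suc j) \<le> (m + 1) * (m + 4)" by (intro mult_mono) (auto simp: m_def)
      then show "(real (Suc j))\<^sup>2 \<le> (m + 1) * (m + 4)" by (simp only: power2_eq_square)
    qed (use m in auto)
    finally show ?thesis by simp
  qed
  ultimately show ?thesis by linarith
qed

lemma log_quotient_tendsto: "(\<lambda>n. log_quotient (1 / real (Suc n)) j) \<longlonglongrightarrow> ln (ratio_factor j)"
proof -
  define m where "m = 5 * real j"
  \<comment> \<open>Two factors stand above and two below, so dividing each by \<open>x\<close> does
    not change the quotient; each then tends to its index.\<close>
  define p where "p = (\<lambda>i x::real. (1 - exp (- (i * x))) / x)"
  have lim: "(\<lambda>n. p i (1 / real (Suc n))) \<longlonglongrightarrow> i" if "i > 0" for i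
    unfolding p_def using that by real_asymp
  have pos: "p i x > 0" if "i > 0" "x > 0" for i x using that by (simp add: p_def)
  have "(\<lambda>n. ln (p (m + 2) (1 / real (Suc n)) * p (m + 3) (1 / real (Suc n)) / (p (m + 1) (1 / real (Suc n)) * p (m + 4) (1 / real (Suc n)))))
          \<longlonglongrightarrow> ln ((m + 2) * (m + 3) / ((m + 1) * (m + 4)))"
    by (intro tendsto_ln tendsto_divide tendsto_mult lim) (auto simp: m_def add_nonneg_pos less_imp_neq[THEN not_sym])
  moreover have "ln (p (m + 2) x * p (m + 3) x / (p (m + 1) x * p (m + 4) x)) = log_quotient x j" if x: "x > 0" for x
  proof -
    have nn: "0 < (m + i) * x" if "i > 0" for i
      using that x by (intro mult_pos_pos add_nonneg_pos) (auto simp: m_def)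
    have "1 - exp (- ((m + i) * x)) > 0" if "i > 0" for i
      using nn[OF that] by simp
    then have ln_p: "ln (p (m + i) x) = ln (1 - exp (- ((m + i) * x))) - ln x" if "i > 0" for i
      using that x unfolding p_def by (intro ln_divide_pos) auto
    have "p (m + i) x \<noteq> 0" if "i > 0" for i
      using pos[of "m + i" x] that x by (simp add: m_def add_nonneg_pos)
    then have "ln (p (m + 2) x * p (m + 3) x / (p (m + 1) x * p (m + 4) x)) =
       ln (p (m + 2) x) + ln (p (m + 3) x) - (ln (p (m + 1) x) + ln (p (m + 4) x))"
      by (simp add: ln_div ln_mult)
    then show ?thesis
      unfolding log_quotient_def m_def[symmetric] by (simp add: ln_p)
  qed
  ultimately show ?thesis by (simp add: ratio_factor_def m_def)
qed

lemma suminf_log_quotient_tendsto: "(\<lambda>n. suminf (log_quotient (1 / real (Suc n)))) \<longlonglongrightarrow> ln golden_ratio"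
proof -
  have summ: "summable (\<lambda>j. 4 * exp 3 * (1 / (real (Suc j))\<^sup>2))"
    using inverse_squares_sums by (intro summable_mult) (simp add: sums_iff add.commute)
  have "(\<lambda>n. \<Sum>j. log_quotient (1 / real (Suc n)) j) \<longlonglongrightarrow> (\<Sum>j. ln (ratio_factor j))"
  proof (rule tannerys_theorem[THEN conjunct2, THEN conjunct2, OF log_quotient_tendsto _ summ])
    show "\<forall>\<^sub>F (j, n) in at_top \<times>\<^sub>F sequentially. norm (log_quotient (1 / real (Suc n)) j) \<le> 4 * exp 3 * (1 / (real (Suc j))\<^sup>2)"
      using log_quotient_bound by (intro always_eventually) (auto simp del: of_nat_Suc)
  qed simp
  then show ?thesis using sums_ln_ratio_factor by (simp add: sums_iff)
qed

text \<open>The square root of \<phi> / sqrt 5; it is the limit of P14 (s) exp (- \<pi>^2 / (15 s))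
  at the origin.\<close>

definition K14 :: real where
  "K14 = golden_ratio powr (1/2) / 5 powr (1/4)"

lemma LINT_g14: "exp (LINT t:{0<..}|lborel. g14 (of_real t)) = of_real K14"
proof -
  define x where "x = (\<lambda>n. 1 / real (Suc n))"
  define Rg where "Rg = (\<lambda>s. \<Sum>k. s * g14 (of_nat (Suc k) * s))"
  define Rb where "Rb = (\<lambda>s. \<Sum>k. s * bern (of_nat (Suc k) * s))"
  define I where "I = (LINT t:{0<..}|lborel. g14 (of_real t))"
  define J where "J = (LINT t:{0<..}|lborel. bern (of_real t))"
  have x: "x n > 0" for n by (simp add: x_def)
  have x0: "x \<longlonglongrightarrow> 0" unfolding x_def by real_asymp
  have lim_g: "(\<lambda>n. Rg (of_real (x n))) \<longlonglongrightarrow> I"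
    unfolding Rg_def I_def using x x0
    by (intro g14.riemann_sum_tendsto) (auto intro!: tendsto_eq_intros simp: less_imp_neq[THEN not_sym] less_imp_le)
  have lim_b: "(\<lambda>n. Rb (of_real (c * x n))) \<longlonglongrightarrow> J" if "c > 0" for c
  proof -
    have nz: "c \<noteq> 0" "x n \<noteq> 0" for n using that x[of n] by auto
    show ?thesis
      unfolding Rb_def J_def using x x0 that
      by (intro bern.riemann_sum_tendsto) (auto intro!: tendsto_eq_intros simp: nz less_imp_le)
  qed
  \<comment> \<open>With w = exp (- k x), 2 (w + w^4) is (w + w^2 + w^3 + w^4) + (w - w^2 - w^3 +
    w^4). Over 1 - w^5 the first bracket is w / (1 - w) - w^5 / (1 - w^5), two instances of
    \<open>bern_sums\<close>; the second is the character sum. The polar terms match because 1/6 -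
    1/30 = 2/15.\<close>
  have key: "2 * Rg (of_real (x n)) = of_real ((ln (1 - exp (- x n)) - ln (1 - exp (- (5 * x n)))) / 2)
     + (Rb (of_real (1 * x n)) - Rb (of_real (5 * x n))) + of_real (suminf (log_quotient (x n)))" for n
  proof -
    define y where "y = x n"
    have y: "y > 0" using x by (simp add: y_def)
    define U where "U = (\<lambda>y. of_real (pi\<^sup>2 / (6 * y)) + of_real (ln (1 - exp (- y)) / 2) + Rb (complex_of_real y))"
    define w where "w = (\<lambda>k. exp (- (of_nat (Suc k) * complex_of_real y)))"
    have w1: "complex_of_real (exp (- y) ^ Suc k) = w k" for k
      unfolding w_def by (rule of_real_exp_power)
    have w5: "exp (- (of_nat (Suc k) * complex_of_real (5 * y))) = w k ^ 5" for k
      by (simp add: w_def exp_of_nat_mult[symmetric] algebra_simps)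
    have w4: "F14 (of_nat (Suc k) * of_real y) = (w k + w k ^ 4) / (1 - w k ^ 5)" for k
    proof -
      have "w k = exp (- complex_of_real y) ^ Suc k"
        by (simp only: w_def exp_of_nat_mult[symmetric] mult_minus_right)
      then show ?thesis by (simp only: F14_exp)
    qed
    have nw: "norm (w k) < 1" for k using y by (simp add: w_def)
    have nz: "1 - w k \<noteq> 0" "1 - w k ^ 5 \<noteq> 0" for k
    proof -
      have "norm (w k ^ 5) < 1" using nw[of k] by (simp add: norm_power power_less_one_iff)
      then show "1 - w k \<noteq> 0" "1 - w k ^ 5 \<noteq> 0" using nw[of k] by auto
    qed
    obtain X where X: "(\<lambda>k. ((exp (- y) ^ Suc k) - (exp (- y) ^ Suc k) ^ 2 - (exp (- y) ^ Suc k) ^ 3 + (exp (- y) ^ Suc k) ^ 4)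
         / (1 - (exp (- y) ^ Suc k) ^ 5) / real (Suc k)) sums X" and Xq: "log_quotient y sums X"
      using character_sum_log[OF y] by blast
    from X have "(\<lambda>k. complex_of_real (((exp (- y) ^ Suc k) - (exp (- y) ^ Suc k) ^ 2 - (exp (- y) ^ Suc k) ^ 3 + (exp (- y) ^ Suc k) ^ 4)
         / (1 - (exp (- y) ^ Suc k) ^ 5) / real (Suc k))) sums of_real X"
      by (simp only: sums_of_real_iff)
    then have h: "(\<lambda>k. (w k - w k ^ 2 - w k ^ 3 + w k ^ 4) / (1 - w k ^ 5) / of_nat (Suc k)) sums of_real X"
      by (simp only: of_real_divide of_real_diff of_real_add of_real_power[of _ 2] of_real_power[of _ 3] of_real_power[of _ 4] of_real_power[of _ 5] w1 of_real_1 of_real_of_nat_eq)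
    have u1: "(\<lambda>k. w k / (1 - w k) / of_nat (Suc k)) sums U y"
      using bern_sums[OF y] unfolding U_def Rb_def w_def .
    have u5: "(\<lambda>k. w k ^ 5 / (1 - w k ^ 5) / of_nat (Suc k)) sums U (5 * y)"
      using bern_sums[of "5 * y"] y unfolding U_def Rb_def w5 by simp
    have f: "(\<lambda>k. 2 * (F14 (of_nat (Suc k) * of_real y) / of_nat (Suc k))) sums (2 * (of_real (pi\<^sup>2 / 15) / of_real y + Rg (of_real y)))"
      unfolding Rg_def by (intro sums_mult P14_eq_exp(1)) (use y in auto)
    have "2 * (F14 (of_nat (Suc k) * of_real y) / of_nat (Suc k)) =
        w k / (1 - w k) / of_nat (Suc k) - w k ^ 5 / (1 - w k ^ 5) / of_nat (Suc k)
        + (w k - w k ^ 2 - w k ^ 3 + w k ^ 4) / (1 - w k ^ 5) / of_nat (Suc k)" for k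
    proof -
      have fac: "1 - w k ^ 5 = (1 - w k) * (1 + w k + w k ^ 2 + w k ^ 3 + w k ^ 4)"
        by (simp add: algebra_simps numeral_eq_Suc)
      define c where "c = 1 + w k + w k ^ 2 + w k ^ 3 + w k ^ 4"
      have c: "c \<noteq> 0" using nz(2)[of k] unfolding fac c_def by simp
      have "w k / (1 - w k) = w k * c / (1 - w k ^ 5)"
        using c nz(1)[of k] unfolding fac c_def[symmetric] by simp
      then have "2 * ((w k + w k ^ 4) / (1 - w k ^ 5)) =
         w k / (1 - w k) - w k ^ 5 / (1 - w k ^ 5) + (w k - w k ^ 2 - w k ^ 3 + w k ^ 4) / (1 - w k ^ 5)"
        unfolding c_def by (simp add: diff_divide_distrib[symmetric] add_divide_distrib[symmetric])
           (simp add: algebra_simps numeral_eq_Suc)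
      moreover have "2 * (P / K) = a / K - b / K + c / K" if "2 * P = a - b + c" for P a b c K :: complex
        using arg_cong[OF that, of "\<lambda>t. t / K"] by (simp add: add_divide_distrib diff_divide_distrib)
      ultimately show ?thesis unfolding w4 by blast
    qed
    with f have f': "(\<lambda>k. w k / (1 - w k) / of_nat (Suc k) - w k ^ 5 / (1 - w k ^ 5) / of_nat (Suc k)
        + (w k - w k ^ 2 - w k ^ 3 + w k ^ 4) / (1 - w k ^ 5) / of_nat (Suc k)) sums
        (2 * (of_real (pi\<^sup>2 / 15) / of_real y + Rg (of_real y)))" by (simp del: of_nat_Suc)
    have eq: "2 * (of_real (pi\<^sup>2 / 15) / of_real y + Rg (of_real y)) = U y - U (5 * y) + of_real X"
      using sums_unique2[OF f' sums_add[OF sums_diff[OF u1 u5] h]] .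
    have X_eq: "X = suminf (log_quotient y)" using Xq by (simp add: sums_iff)
    have c: "complex_of_real (pi\<^sup>2 / (6 * y)) - of_real (pi\<^sup>2 / (6 * (5 * y))) = 2 * (of_real (pi\<^sup>2 / 15) / of_real y)"
    proof -
      have "pi\<^sup>2 / (6 * y) - pi\<^sup>2 / (6 * (5 * y)) = 2 * (pi\<^sup>2 / 15 / y)" using y by (simp add: field_simps)
      from arg_cong[OF this, of complex_of_real] show ?thesis by simp
    qed
    have lin: "2 * R = (l1 - l5) + (r1 - r5) + X'"
      if "2 * (T + R) = (c1 + l1 + r1) - (c5 + l5 + r5) + X'" "c1 - c5 = 2 * T" for R T c1 c5 l1 l5 r1 r5 X' :: complex
      using that by (simp add: algebra_simps)
    show ?thesis
      using lin[OF eq[unfolded U_def] c] unfolding X_eq y_def[symmetric] by (simp add: diff_divide_distrib)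
  qed
  have "(\<lambda>n. of_real ((ln (1 - exp (- x n)) - ln (1 - exp (- (5 * x n)))) / 2)
     + (Rb (of_real (1 * x n)) - Rb (of_real (5 * x n))) + of_real (suminf (log_quotient (x n))))
     \<longlonglongrightarrow> of_real (- ln 5 / 2) + (J - J) + of_real (ln golden_ratio)"
  proof (intro tendsto_add tendsto_diff tendsto_of_real lim_b)
    show "(\<lambda>n. (ln (1 - exp (- x n)) - ln (1 - exp (- (5 * x n)))) / 2) \<longlonglongrightarrow> - ln 5 / 2"
      unfolding x_def by real_asymp
    show "(\<lambda>n. suminf (log_quotient (x n))) \<longlonglongrightarrow> ln golden_ratio"
      unfolding x_def by (rule suminf_log_quotient_tendsto)
  qed auto
  then have "(\<lambda>n. 2 * Rg (of_real (x n))) \<longlonglongrightarrow> of_real (- ln 5 / 2) + (J - J) + of_real (ln golden_ratio)"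
    unfolding key .
  moreover have "(\<lambda>n. 2 * Rg (of_real (x n))) \<longlonglongrightarrow> 2 * I"
    by (intro tendsto_mult_left lim_g)
  ultimately have "2 * I = of_real (- ln 5 / 2) + (J - J) + of_real (ln golden_ratio)"
    by (rule LIMSEQ_unique[rotated])
  then have "I = of_real (ln golden_ratio / 2 - ln 5 / 4)"
    by (simp add: field_simps)
  then have "exp I = of_real (exp (ln golden_ratio / 2 - ln 5 / 4))"
    by (simp only: exp_of_real)
  also have "golden_ratio \<noteq> 0" by (simp add: golden_ratio_def add_pos_nonneg less_imp_neq[THEN not_sym])
  then have "exp (ln golden_ratio / 2 - ln 5 / 4) = K14"
    by (simp add: K14_def powr_def exp_diff)
  finally show ?thesis by (simp add: I_def)
qed

section \<open>The partition generating function in the sector\<close>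

lemma P14_sector_bounded:
  obtains B where "\<And>s. Re s > 0 \<Longrightarrow> \<bar>Im s\<bar> \<le> Re s \<Longrightarrow> norm (P14 s * exp (- of_real (pi\<^sup>2 / 15) / s)) \<le> B"
proof -
  obtain B where B: "\<And>s. Re s > 0 \<Longrightarrow> \<bar>Im s\<bar> \<le> Re s \<Longrightarrow> norm (\<Sum>k. s * g14 (of_nat (Suc k) * s)) \<le> B"
    using g14.riemann_sum_bounded by blast
  show thesis
  proof (rule that)
    fix s assume s: "Re s > 0" "\<bar>Im s\<bar> \<le> Re s"
    have "norm (P14 s * exp (- of_real (pi\<^sup>2 / 15) / s)) = norm (exp (\<Sum>k. s * g14 (of_nat (Suc k) * s)))"
      unfolding P14_eq_exp(2)[OF s] by (simp only: exp_add[symmetric]) simp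
    also have "\<dots> \<le> exp (norm (\<Sum>k. s * g14 (of_nat (Suc k) * s)))" by (rule norm_exp)
    also have "\<dots> \<le> exp B" using B[OF s] by simp
    finally show "norm (P14 s * exp (- of_real (pi\<^sup>2 / 15) / s)) \<le> exp B" .
  qed
qed

lemma P14_tendsto:
  fixes s :: "nat \<Rightarrow> complex"
  assumes s: "\<And>n. Re (s n) > 0" "\<And>n. \<bar>Im (s n)\<bar> \<le> Re (s n)"
    and "s \<longlonglongrightarrow> 0" "(\<lambda>n. s n / Re (s n)) \<longlonglongrightarrow> 1"
  shows "(\<lambda>n. P14 (s n) * exp (- of_real (pi\<^sup>2 / 15) / s n)) \<longlonglongrightarrow> of_real K14"
proof -
  have "P14 (s n) * exp (- of_real (pi\<^sup>2 / 15) / s n) = exp (\<Sum>k. s n * g14 (of_nat (Suc k) * s n))" for n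
    unfolding P14_eq_exp(2)[OF s] by (simp only: exp_add[symmetric]) simp
  moreover have "(\<lambda>n. exp (\<Sum>k. s n * g14 (of_nat (Suc k) * s n))) \<longlonglongrightarrow> exp (LINT t:{0<..}|lborel. g14 (of_real t))"
    by (intro tendsto_exp g14.riemann_sum_tendsto assms)
  ultimately show ?thesis unfolding LINT_g14 by simp
qed

section \<open>Minor arcs\<close>

definition f14 :: "real \<Rightarrow> real" where
  "f14 x = (exp (- x) + exp (- (4 * x))) / (1 - exp (- (5 * x)))"

lemma F14_of_real: "F14 (of_real x) = of_real (f14 x)"
proof -
  have "exp (- (of_real c * complex_of_real x)) = of_real (exp (- (c * x)))" for c
    by (simp flip: exp_of_real)
  from this[of 1] this[of 4] this[of 5] show ?thesis
    by (simp add: F14_def f14_def)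
qed

lemma norm_F14_le:
  assumes "Re s > 0"
  shows "norm (F14 s) \<le> f14 (Re s)"
proof -
  have "norm (exp (- s) + exp (- 4 * s)) \<le> exp (- Re s) + exp (- (4 * Re s))"
    by (rule order_trans[OF norm_triangle_ineq]) simp
  moreover have "norm (1 - exp (- 5 * s)) \<ge> 1 - exp (- (5 * Re s))"
    using norm_triangle_ineq2[of 1 "exp (- 5 * s)"] by simp
  moreover have "1 - exp (- (5 * Re s)) > 0" using assms by simp
  ultimately show ?thesis
    unfolding F14_def f14_def norm_divide by (intro frac_le) auto
qed

lemma f14_pos: "x > 0 \<Longrightarrow> f14 x > 0"
  by (auto simp: f14_def intro!: divide_pos_pos add_pos_pos)

lemma f14_upper:
  assumes "0 < x" "x \<le> 1"
  shows "f14 x \<le> 3 / x"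
proof -
  have "1 - exp (- (5 * x)) \<ge> 5 * x / (1 + 5 * x)"
    using one_minus_exp_ge[of "5 * x"] assms by simp
  moreover have "5 * x / (1 + 5 * x) \<ge> 5 * x / 6" using assms by (intro divide_left_mono) auto
  ultimately have "1 - exp (- (5 * x)) \<ge> 5 * x / 6" by linarith
  moreover have "exp (- x) \<le> 1" "exp (- (4 * x)) \<le> 1" using assms by simp_all
  then have "exp (- x) + exp (- (4 * x)) \<le> 2" by linarith
  ultimately have "f14 x \<le> 2 / (5 * x / 6)"
    unfolding f14_def using assms by (intro frac_le) auto
  also have "\<dots> \<le> 3 / x" using assms by (simp add: field_simps)
  finally show ?thesis .
qed

text \<open>The saving \<open>(1 - \<rho>) * f14 x\<close> on the minor arcs must be of order 1 / x,
  the order of the exponent at the saddle point; this bound provides it.\<close>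

lemma f14_lower:
  assumes "0 < x" "x \<le> 1"
  shows "f14 x \<ge> exp (- 4) / (5 * x)"
proof -
  have "1 - exp (- (5 * x)) \<le> 5 * x" using exp_ge_add_one_self[of "- (5 * x)"] by linarith
  moreover have "exp (- 4) \<le> exp (- (4 * x))" using assms by simp
  then have "exp (- 4) \<le> exp (- x) + exp (- (4 * x))" using exp_gt_zero[of "- x"] by linarith
  ultimately show ?thesis
    unfolding f14_def using assms by (intro frac_le) auto
qed

text \<open>Only the first term of \<open>log P14 s = \<Sum>k. F14 (k s) / k\<close> is compared strictly with its value on
  the real axis.\<close>

lemma norm_P14_le:
  assumes s: "Re s > 0"
  shows "norm (P14 s) \<le> norm (P14 (of_real (Re s))) * exp (norm (F14 s) - f14 (Re s))"
proof -
  define x where "x = Re s"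
  have x: "x > 0" using s by (simp add: x_def)
  define a b where "a = (\<lambda>k. F14 (of_nat (Suc k) * s) / of_nat (Suc k))"
    and "b = (\<lambda>k. f14 (real (Suc k) * x) / real (Suc k))"
  have a: "summable a" unfolding a_def by (rule sums_summable[OF F14_log_sums[OF s]])
  have F_real: "F14 (of_nat (Suc k) * of_real x) / of_nat (Suc k) = complex_of_real (b k)" for k
    using F14_of_real[of "real (Suc k) * x"]
    by (simp only: b_def of_real_mult of_real_of_nat_eq of_real_divide)
  then have bc: "(\<lambda>k. complex_of_real (b k)) sums eval_fps (euler_log parts_14) (exp (- of_real x))"
    using F14_log_sums[of "of_real x"] x unfolding F_real by simp
  then have b: "summable b" using sums_summable summable_of_real_iff by blast
  have Px: "P14 (of_real x) = of_real (exp (suminf b))"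
    using P14_eq[of "of_real x"] x unfolding F_real by (simp add: suminf_of_real[OF b] flip: exp_of_real)
  have le: "Re (a k) \<le> b k" for k
  proof -
    have "Re (a k) \<le> norm (a k)" by (rule complex_Re_le_cmod)
    also have "\<dots> = norm (F14 (of_nat (Suc k) * s)) / real (Suc k)"
      unfolding a_def norm_divide norm_of_nat ..
    also have "\<dots> \<le> f14 (Re (of_nat (Suc k) * s)) / real (Suc k)"
      using s by (intro divide_right_mono norm_F14_le) auto
    also have "Re (of_nat (Suc k) * s) = real (Suc k) * x" by (simp add: x_def)
    finally show ?thesis by (simp add: b_def)
  qed
  have "Re (suminf a) = (\<Sum>k. Re (a k))" by (rule bounded_linear.suminf[OF bounded_linear_Re a])
  also have "\<dots> = Re (a 0) + (\<Sum>k. Re (a (Suc k)))"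
    using suminf_split_head[OF summable_Re[OF a]] by simp
  also have "(\<Sum>k. Re (a (Suc k))) \<le> (\<Sum>k. b (Suc k))"
    using le summable_Suc_iff[of "\<lambda>k. Re (a k)"] summable_Re[OF a] summable_Suc_iff[of b] b
    by (intro suminf_le) auto
  also have "(\<Sum>k. b (Suc k)) = suminf b - b 0"
    using suminf_split_head[OF b] by simp
  also have "Re (a 0) \<le> norm (F14 s)" by (simp add: a_def complex_Re_le_cmod)
  finally have "Re (suminf a) \<le> suminf b + (norm (F14 s) - f14 x)" by (simp add: b_def)
  then have "exp (Re (suminf a)) \<le> exp (suminf b) * exp (norm (F14 s) - f14 x)"
    by (simp add: exp_add[symmetric])
  then show ?thesis
    unfolding x_def[symmetric] Px using P14_eq[OF s] by (simp add: a_def)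
qed

section \<open>Trigonometric estimates away from the real axis\<close>

lemma sin_ge_third:
  fixes t :: real
  assumes "0 \<le> t" "t \<le> pi / 2"
  shows "sin t \<ge> t / 3"
proof -
  \<comment> \<open>The cubic Taylor bound sin t \<ge> t - t^3 / 6 gives t / 3 as soon as t^2 \<le>
    4.\<close>
  have "t \<le> 2" using assms pi_half_less_two by linarith
  then have "t * (t * t) \<le> t * (2 * 2)"
    using assms by (intro mult_left_mono mult_mono) auto
  then have "t ^ 3 \<le> 4 * t" by (simp add: power3_eq_cube mult.commute)
  moreover have "\<bar>sin t - t\<bar> \<le> t ^ 3 / 6"
    using Maclaurin_sin_bound[of t 3] assms
    by (simp add: sin_coeff_def numeral_eq_Suc lessThan_Suc fact_numeral field_simps)
  ultimately show ?thesis by linarith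
qed

text \<open>As F14 (s) = exp (- s) (1 + exp (- 3 s)) / (1 - exp (- 5 s)), this identity and its
  companion for 1 + exp (- s) measure exactly how the denominator grows and the numerator shrinks
  off the real axis, through sin (5y/2) and sin (3y/2).\<close>

lemma norm_one_minus_exp_sq:
  "(norm (1 - exp (- s)))\<^sup>2 = (1 - exp (- Re s))\<^sup>2 + 4 * exp (- Re s) * (sin (Im s / 2))\<^sup>2"
proof -
  have c: "cos (Im s) = 1 - 2 * (sin (Im s / 2))\<^sup>2"
    using cos_double_sin[of "Im s / 2"] by simp
  have "(norm (1 - exp (- s)))\<^sup>2 = (1 - exp (- Re s) * cos (Im s))\<^sup>2 + (exp (- Re s) * sin (Im s))\<^sup>2"
    by (simp add: cmod_power2 Re_exp Im_exp)
  also have "\<dots> = 1 - 2 * exp (- Re s) * cos (Im s) + (exp (- Re s))\<^sup>2 * ((cos (Im s))\<^sup>2 + (sin (Im s))\<^sup>2)"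
    by algebra
  also have "(cos (Im s))\<^sup>2 + (sin (Im s))\<^sup>2 = 1" by simp
  also have "1 - 2 * exp (- Re s) * cos (Im s) + (exp (- Re s))\<^sup>2 * 1 = (1 - exp (- Re s))\<^sup>2 + 4 * exp (- Re s) * (sin (Im s / 2))\<^sup>2"
    unfolding c by (simp add: power2_eq_square algebra_simps)
  finally show ?thesis .
qed

lemma norm_one_plus_exp_sq:
  "(norm (1 + exp (- s)))\<^sup>2 = (1 + exp (- Re s))\<^sup>2 - 4 * exp (- Re s) * (sin (Im s / 2))\<^sup>2"
proof -
  have c: "cos (Im s) = 1 - 2 * (sin (Im s / 2))\<^sup>2"
    using cos_double_sin[of "Im s / 2"] by simp
  have "(norm (1 + exp (- s)))\<^sup>2 = (1 + exp (- Re s) * cos (Im s))\<^sup>2 + (exp (- Re s) * sin (Im s))\<^sup>2"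
    by (simp add: cmod_power2 Re_exp Im_exp)
  also have "\<dots> = 1 + 2 * exp (- Re s) * cos (Im s) + (exp (- Re s))\<^sup>2 * ((cos (Im s))\<^sup>2 + (sin (Im s))\<^sup>2)"
    by algebra
  also have "(cos (Im s))\<^sup>2 + (sin (Im s))\<^sup>2 = 1" by simp
  also have "1 + 2 * exp (- Re s) * cos (Im s) + (exp (- Re s))\<^sup>2 * 1 = (1 + exp (- Re s))\<^sup>2 - 4 * exp (- Re s) * (sin (Im s / 2))\<^sup>2"
    unfolding c by (simp add: power2_eq_square algebra_simps)
  finally show ?thesis .
qed

lemma norm_F14_sq:
  "(norm (F14 s))\<^sup>2 = (exp (- Re s))\<^sup>2 * (norm (1 + exp (- (3 * s))))\<^sup>2 / (norm (1 - exp (- (5 * s))))\<^sup>2"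
proof -
  have "F14 s = exp (- s) * (1 + exp (- (3 * s))) / (1 - exp (- (5 * s)))"
    by (simp add: F14_def algebra_simps flip: exp_add)
  then show ?thesis by (simp add: norm_divide norm_mult power_mult_distrib power_divide)
qed

lemma f14_sq:
  "(f14 x)\<^sup>2 = (exp (- x))\<^sup>2 * (1 + exp (- (3 * x)))\<^sup>2 / (1 - exp (- (5 * x)))\<^sup>2"
proof -
  have "f14 x = exp (- x) * (1 + exp (- (3 * x))) / (1 - exp (- (5 * x)))"
    by (simp add: f14_def algebra_simps flip: exp_add)
  then show ?thesis by (simp add: power_mult_distrib power_divide)
qed

text \<open>From 1 = 2 * 3 - 5: the sines of 3t and 5t are both small only where that of t is
  small.\<close>

lemma sin_abs_le: "\<bar>sin t\<bar> \<le> 2 * \<bar>sin (3 * t)\<bar> + \<bar>sin (5 * t)\<bar>" for t :: real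
proof -
  have "sin t = sin (2 * (3 * t)) * cos (5 * t) - cos (2 * (3 * t)) * sin (5 * t)"
    by (simp flip: sin_diff)
  also have "\<bar>\<dots>\<bar> \<le> \<bar>sin (2 * (3 * t))\<bar> * \<bar>cos (5 * t)\<bar> + \<bar>cos (2 * (3 * t))\<bar> * \<bar>sin (5 * t)\<bar>"
    by (metis abs_mult abs_triangle_ineq4)
  also have "\<dots> \<le> \<bar>sin (2 * (3 * t))\<bar> * 1 + 1 * \<bar>sin (5 * t)\<bar>"
    by (intro add_mono mult_mono) auto
  also have "\<bar>sin (2 * (3 * t))\<bar> \<le> 2 * \<bar>sin (3 * t)\<bar>"
  proof -
    have "\<bar>sin (2 * (3 * t))\<bar> = 2 * \<bar>sin (3 * t)\<bar> * \<bar>cos (3 * t)\<bar>"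
      unfolding sin_double by (simp add: abs_mult)
    also have "\<dots> \<le> 2 * \<bar>sin (3 * t)\<bar> * 1" by (intro mult_left_mono) auto
    finally show ?thesis by simp
  qed
  finally show ?thesis by simp
qed

text \<open>Up to t = \<pi>/10 the angle 5t stays in the range where the sine has a linear lower
  bound. Beyond that, sin t is at least 1/10, and \<open>sin_abs_le\<close> shares this out: if sin
  (5t) is below x / 2 \<le> 1/20, then 2 |sin (3t)| is at least 1/20.\<close>

lemma minor_arc_dichotomy:
  fixes x y :: real
  assumes x: "0 < x" "x \<le> 1 / 10" and y: "x < \<bar>y\<bar>" "\<bar>y\<bar> \<le> pi"
  shows "\<bar>sin (5 * (y / 2))\<bar> \<ge> x / 2 \<or> \<bar>sin (3 * (y / 2))\<bar> \<ge> 1 / 40"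
proof -
  define t where "t = \<bar>y\<bar> / 2"
  have t: "x / 2 < t" "t \<le> pi / 2" using y by (auto simp: t_def)
  have abs_eq: "\<bar>sin (c * (y / 2))\<bar> = \<bar>sin (c * t)\<bar>" for c
  proof (cases "y \<ge> 0")
    case False
    then have "c * t = - (c * (y / 2))" by (simp add: t_def)
    then show ?thesis by (simp only: sin_minus abs_minus_cancel)
  qed (simp add: t_def)
  show ?thesis
  proof (cases "t \<le> pi / 10")
    case True
    have "sin (5 * t) \<ge> 5 * t / 3" using True t x by (intro sin_ge_third) auto
    then have "\<bar>sin (5 * t)\<bar> \<ge> x / 2" using t x by linarith
    then show ?thesis unfolding abs_eq by blast
  next
    case False
    have "sin t \<ge> t / 3" using t x by (intro sin_ge_third) auto
    moreover have "t / 3 \<ge> 1 / 10" using False pi_gt3 by simp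
    ultimately have "\<bar>sin t\<bar> \<ge> 1 / 10" by linarith
    then have "2 * \<bar>sin (3 * t)\<bar> + \<bar>sin (5 * t)\<bar> \<ge> 1 / 10" using sin_abs_le[of t] by linarith
    then have "\<bar>sin (5 * t)\<bar> \<ge> x / 2 \<or> \<bar>sin (3 * t)\<bar> \<ge> 1 / 40" using x by linarith
    then show ?thesis unfolding abs_eq .
  qed
qed

lemma norm_F14_minor:
  obtains \<rho> where "\<rho> < 1" and "\<And>x y. 0 < x \<Longrightarrow> x \<le> 1 / 10 \<Longrightarrow> x < \<bar>y\<bar> \<Longrightarrow> \<bar>y\<bar> \<le> pi \<Longrightarrow>
     norm (F14 (Complex x y)) \<le> \<rho> * f14 x"
proof -
  \<comment> \<open>The constants solve \<eta> (5x)^2 = 4 exp (- 1) (x/2)^2 and \<kappa> 2^2 = 4 exp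
    (- 1) / 40^2. Here 5x and 2 bound \<open>a\<close> and \<open>b\<close>, and exp (- 1) bounds
    the exponential factors from below for \<open>x \<le> 1 / 10\<close>.\<close>
  define \<eta> where "\<eta> = (exp (- 1) / 25 :: real)"
  define \<kappa> where "\<kappa> = (exp (- 1) / 1600 :: real)"
  define \<sigma> where "\<sigma> = max (1 / (1 + \<eta>)) (1 - \<kappa>)"
  have "\<eta> > 0" "\<kappa> > 0" by (auto simp: \<eta>_def \<kappa>_def)
  have "exp (- 1) \<le> (1 :: real)" by simp
  then have "\<kappa> < 1" unfolding \<kappa>_def by linarith
  with \<open>\<eta> > 0\<close> \<open>\<kappa> > 0\<close> have \<sigma>: "0 < \<sigma>" "\<sigma> < 1" by (auto simp: \<sigma>_def less_max_iff_disj intro: divide_pos_pos)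
  show thesis
  proof (rule that[of "sqrt \<sigma>"])
    show "sqrt \<sigma> < 1" using \<sigma> by simp
    fix x y :: real
    assume x: "0 < x" "x \<le> 1 / 10" and y: "x < \<bar>y\<bar>" "\<bar>y\<bar> \<le> pi"
    let ?s = "Complex x y"
    define E where "E = (exp (- x))\<^sup>2"
    define a where "a = 1 - exp (- (5 * x))"
    define b where "b = 1 + exp (- (3 * x))"
    have a: "0 < a" "a \<le> 5 * x"
      using x exp_ge_add_one_self[of "- (5 * x)"] unfolding a_def by (simp, linarith)
    have b: "0 < b" "b \<le> 2" using x by (auto simp: b_def add_pos_pos)
    have E: "E > 0" by (simp add: E_def)
    have A: "(norm (1 - exp (- (5 * ?s))))\<^sup>2 = a\<^sup>2 + 4 * exp (- (5 * x)) * (sin (5 * (y / 2)))\<^sup>2"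
      using norm_one_minus_exp_sq[of "5 * ?s"] by (simp add: a_def)
    have B: "(norm (1 + exp (- (3 * ?s))))\<^sup>2 = b\<^sup>2 - 4 * exp (- (3 * x)) * (sin (3 * (y / 2)))\<^sup>2"
      using norm_one_plus_exp_sq[of "3 * ?s"] by (simp add: b_def)
    have fsq: "(f14 x)\<^sup>2 = E * b\<^sup>2 / a\<^sup>2" by (simp add: f14_sq E_def a_def b_def)
    have "(norm (F14 ?s))\<^sup>2 \<le> \<sigma> * (f14 x)\<^sup>2"
    proof (cases "\<bar>sin (5 * (y / 2))\<bar> \<ge> x / 2")
      case True
      have "(1 + \<eta>) * a\<^sup>2 \<le> (norm (1 - exp (- (5 * ?s))))\<^sup>2"
      proof -
        have "\<eta> * a\<^sup>2 \<le> \<eta> * (5 * x)\<^sup>2"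
          using a \<open>\<eta> > 0\<close> by (intro mult_left_mono power_mono) auto
        also have "\<dots> = 4 * exp (- 1) * (x / 2)\<^sup>2" by (simp add: \<eta>_def power2_eq_square)
        also have "\<dots> \<le> 4 * exp (- (5 * x)) * (sin (5 * (y / 2)))\<^sup>2"
          using True x power_mono[of "x / 2" "\<bar>sin (5 * (y / 2))\<bar>" 2] by (intro mult_mono) auto
        finally show ?thesis unfolding A by (simp add: algebra_simps)
      qed
      moreover have "(norm (1 + exp (- (3 * ?s))))\<^sup>2 \<le> b\<^sup>2" unfolding B by simp
      ultimately have "(norm (F14 ?s))\<^sup>2 \<le> E * b\<^sup>2 / ((1 + \<eta>) * a\<^sup>2)"
        unfolding norm_F14_sq complex.sel E_def[symmetric] using a E \<open>\<eta> > 0\<close>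
        by (intro frac_le mult_left_mono mult_pos_pos mult_nonneg_nonneg) auto
      also have "\<dots> = 1 / (1 + \<eta>) * (f14 x)\<^sup>2" by (simp add: fsq)
      also have "\<dots> \<le> \<sigma> * (f14 x)\<^sup>2" by (intro mult_right_mono) (auto simp: \<sigma>_def)
      finally show ?thesis .
    next
      case False
      then have "\<bar>sin (3 * (y / 2))\<bar> \<ge> 1 / 40" using minor_arc_dichotomy[OF x y] by blast
      then have sq: "(sin (3 * (y / 2)))\<^sup>2 \<ge> 1 / 1600"
        using power_mono[of "1/40" "\<bar>sin (3 * (y / 2))\<bar>" 2] by (simp add: power2_eq_square)
      have "(norm (1 + exp (- (3 * ?s))))\<^sup>2 \<le> (1 - \<kappa>) * b\<^sup>2"
      proof -
        have "\<kappa> * b\<^sup>2 \<le> \<kappa> * 2\<^sup>2" using b \<open>\<kappa> > 0\<close> by (intro mult_left_mono power_mono) auto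
        also have "\<dots> = 4 * exp (- 1) * (1 / 1600)" by (simp add: \<kappa>_def)
        also have "\<dots> \<le> 4 * exp (- (3 * x)) * (sin (3 * (y / 2)))\<^sup>2"
          using x sq by (intro mult_mono) auto
        finally show ?thesis unfolding B by (simp add: algebra_simps)
      qed
      moreover have "a\<^sup>2 \<le> (norm (1 - exp (- (5 * ?s))))\<^sup>2" unfolding A by simp
      ultimately have "(norm (F14 ?s))\<^sup>2 \<le> E * ((1 - \<kappa>) * b\<^sup>2) / a\<^sup>2"
        unfolding norm_F14_sq complex.sel E_def[symmetric] using a E \<open>\<kappa> < 1\<close>
        by (intro frac_le mult_left_mono mult_nonneg_nonneg) auto
      also have "\<dots> = (1 - \<kappa>) * (f14 x)\<^sup>2" by (simp add: fsq)
      also have "\<dots> \<le> \<sigma> * (f14 x)\<^sup>2" by (intro mult_right_mono) (auto simp: \<sigma>_def)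
      finally show ?thesis .
    qed
    also have "\<dots> = (sqrt \<sigma> * f14 x)\<^sup>2" using \<sigma> by (simp add: power_mult_distrib)
    finally show "norm (F14 ?s) \<le> sqrt \<sigma> * f14 x"
      by (rule power2_le_imp_le) (use f14_pos[OF x(1)] \<sigma> in simp)
  qed
qed

text \<open>At the real point below, the sector estimate applies; the strict loss in the first term
  of log P then costs a factor exp (- c / x), where \<open>c\<close> is \<open>1 - \<rho>\<close>
  times the constant of \<open>f14_lower\<close>.\<close>

lemma P14_minor:
  obtains B c where "c > 0" and "\<And>x y. 0 < x \<Longrightarrow> x \<le> 1 / 10 \<Longrightarrow> x < \<bar>y\<bar> \<Longrightarrow> \<bar>y\<bar> \<le> pi \<Longrightarrow>
     norm (P14 (Complex x y)) \<le> B * exp (pi\<^sup>2 / 15 / x - c / x)"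
proof -
  obtain \<rho> where \<rho>: "\<rho> < 1" and F: "\<And>x y. 0 < x \<Longrightarrow> x \<le> 1 / 10 \<Longrightarrow> x < \<bar>y\<bar> \<Longrightarrow> \<bar>y\<bar> \<le> pi \<Longrightarrow>
     norm (F14 (Complex x y)) \<le> \<rho> * f14 x"
    using norm_F14_minor by blast
  obtain B where B: "\<And>s. Re s > 0 \<Longrightarrow> \<bar>Im s\<bar> \<le> Re s \<Longrightarrow> norm (P14 s * exp (- of_real (pi\<^sup>2 / 15) / s)) \<le> B"
    using P14_sector_bounded by blast
  define c where "c = (1 - \<rho>) * exp (- 4) / 5"
  show thesis
  proof (rule that[of c B])
    show "c > 0" using \<rho> by (simp add: c_def)
    fix x y :: real
    assume x: "0 < x" "x \<le> 1 / 10" and y: "x < \<bar>y\<bar>" "\<bar>y\<bar> \<le> pi"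
    have "norm (P14 (of_real x)) * exp (- (pi\<^sup>2 / 15 / x)) \<le> B"
      using B[of "of_real x"] x by (simp add: norm_mult)
    then have "norm (P14 (of_real x)) \<le> B * exp (pi\<^sup>2 / 15 / x)"
      by (simp add: exp_minus field_simps)
    moreover have "norm (F14 (Complex x y)) - f14 x \<le> - (c / x)"
    proof -
      have "norm (F14 (Complex x y)) - f14 x \<le> - ((1 - \<rho>) * f14 x)" using F[OF x y] by (simp add: algebra_simps)
      moreover have "(1 - \<rho>) * (exp (- 4) / (5 * x)) \<le> (1 - \<rho>) * f14 x"
        using f14_lower[of x] x \<rho> by (intro mult_left_mono) auto
      ultimately show ?thesis by (simp add: c_def)
    qed
    then have "exp (norm (F14 (Complex x y)) - f14 x) \<le> exp (- (c / x))" by simp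
    ultimately have "norm (P14 (of_real x)) * exp (norm (F14 (Complex x y)) - f14 x)
         \<le> B * exp (pi\<^sup>2 / 15 / x) * exp (- (c / x))"
      by (rule mult_mono') auto
    also have "\<dots> = B * exp (pi\<^sup>2 / 15 / x - c / x)"
      by (simp add: exp_diff exp_minus field_simps)
    finally show "norm (P14 (Complex x y)) \<le> B * exp (pi\<^sup>2 / 15 / x - c / x)"
      using norm_P14_le[of "Complex x y"] x by simp
  qed
qed

section \<open>The saddle point\<close>

lemma gaussian_integral: "has_bochner_integral lborel (\<lambda>v. exp (- v\<^sup>2)) (sqrt pi)"
  using has_bochner_integral_even_function[OF gaussian_moment_0] by simp

lemma exp_minus_half_le: "exp (- (v\<^sup>2 / 2)) \<le> 2 / (1 + v\<^sup>2)" for v :: real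
proof -
  have "1 + v\<^sup>2 / 2 \<le> exp (v\<^sup>2 / 2)" by (rule exp_ge_add_one_self)
  then have "exp (- (v\<^sup>2 / 2)) \<le> 1 / (1 + v\<^sup>2 / 2)"
    unfolding exp_minus inverse_eq_divide by (intro divide_left_mono mult_pos_pos) (auto intro: add_pos_nonneg)
  also have "\<dots> = 2 / (2 * (1 + v\<^sup>2 / 2))"
    using mult_divide_mult_cancel_left[of 2 1 "1 + v\<^sup>2 / 2"] by (simp only: mult_1_right)
  also have "\<dots> \<le> 2 / (1 + v\<^sup>2)" by (intro divide_left_mono mult_pos_pos) (auto intro: add_pos_nonneg)
  finally show ?thesis .
qed

text \<open>The third power is the one that fits the scaling: at height y = x v / sqrt N the product
  v^2 x^3 equals A14 y^2, which stays bounded, so exp (- c / x) = O (x^3) is O (1 / (1 +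
  v^2)).\<close>

lemma exp_ge_cube:
  fixes t :: real
  assumes "t \<ge> 0"
  shows "exp t \<ge> (t / 3) ^ 3"
proof -
  have "t / 3 \<le> exp (t / 3)" using exp_ge_add_one_self[of "t / 3"] by linarith
  then have "(t / 3) ^ 3 \<le> exp (t / 3) ^ 3" using assms by (intro power_mono) auto
  also have "\<dots> = exp t" by (simp flip: exp_of_nat_mult)
  finally show ?thesis .
qed

section \<open>Cauchy's integral in coordinates adapted to the saddle point\<close>

definition A14 :: real where "A14 = pi\<^sup>2 / 15"

lemma A14_pos: "A14 > 0" by (simp add: A14_def)

text \<open>The saddle point of \<open>exp (A14 / s + n s)\<close> is \<open>s = sqrt (A14 / n)\<close>. With
  \<open>N = sqrt (A14 n)\<close> the point \<open>s\<close> at height \<open>x v / sqrt N\<close> above it has exponent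
  \<open>2 N - v\<^sup>2 / (1 + \<i> v / sqrt N)\<close>.\<close>

definition saddle :: "real \<Rightarrow> real \<Rightarrow> complex" where
  "saddle N v = of_real (A14 / N) * (1 + \<i> * of_real (v / sqrt N))"

lemma saddle_sel: "Re (saddle N v) = A14 / N" "Im (saddle N v) = A14 / N * (v / sqrt N)"
  by (simp_all add: saddle_def)

lemma saddle_eq_Complex: "saddle N v = Complex (A14 / N) (A14 / N * (v / sqrt N))"
  by (simp add: complex_eq_iff saddle_sel)

lemma saddle_exponent:
  assumes "N > 0"
  shows "of_real A14 / saddle N v + of_real (N\<^sup>2 / A14) * saddle N v - of_real (2 * N) =
           - of_real (v\<^sup>2) / (1 + \<i> * of_real (v / sqrt N))"
proof -
  define w where "w = 1 + \<i> * complex_of_real (v / sqrt N)"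
  have w: "w \<noteq> 0" by (auto simp: w_def complex_eq_iff)
  have A: "complex_of_real A14 \<noteq> 0" using A14_pos by simp
  have N: "complex_of_real N \<noteq> 0" using assms by simp
  have w2: "(w - 1)\<^sup>2 * of_real N = - of_real (v\<^sup>2)"
  proof -
    have "(v / sqrt N)\<^sup>2 * N = v\<^sup>2" using assms by (simp add: power_divide)
    then have "complex_of_real ((v / sqrt N)\<^sup>2) * of_real N = of_real (v\<^sup>2)"
      unfolding of_real_mult[symmetric] by (rule arg_cong)
    moreover have "(w - 1)\<^sup>2 = - of_real ((v / sqrt N)\<^sup>2)"
      unfolding w_def by (simp only: add_diff_cancel_left' power_mult_distrib power2_i of_real_power mult_minus1)
    ultimately show ?thesis by simp
  qed
  have "of_real A14 / saddle N v + of_real (N\<^sup>2 / A14) * saddle N v - of_real (2 * N) =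
     of_real N / w + of_real N * w - 2 * of_real N"
    unfolding saddle_def w_def[symmetric] using A N w by (simp add: field_simps power2_eq_square)
  also have "\<dots> = (w - 1)\<^sup>2 * of_real N / w"
    using w by (simp add: field_simps power2_eq_square)
  also have "\<dots> = - of_real (v\<^sup>2) / w" unfolding w2 ..
  finally show ?thesis unfolding w_def .
qed

text \<open>The real part of 1 / (1 + \<i> u) is 1 / (1 + u^2), at least 1/2 for |u| \<le> 1; this
  gives a Gaussian bound on the whole part of the path inside the sector.\<close>

lemma saddle_exponent_norm:
  assumes "N > 0" "\<bar>v\<bar> \<le> sqrt N"
  shows "norm (exp (- of_real (v\<^sup>2) / (1 + \<i> * of_real (v / sqrt N)))) \<le> exp (- (v\<^sup>2 / 2))"
proof -
  define u where "u = v / sqrt N"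
  have "\<bar>u\<bar> \<le> 1" using assms by (simp add: u_def abs_divide)
  then have u: "1 + u\<^sup>2 \<le> 2" using power_mono[of "\<bar>u\<bar>" 1 2] by simp
  have "Re (- of_real (v\<^sup>2) / (1 + \<i> * of_real u)) = - (v\<^sup>2 / (1 + u\<^sup>2))"
    by (simp add: Re_divide)
  moreover have "v\<^sup>2 / 2 \<le> v\<^sup>2 / (1 + u\<^sup>2)"
    using u by (intro divide_left_mono mult_pos_pos) (auto intro: add_pos_nonneg)
  ultimately show ?thesis unfolding u_def[symmetric] norm_exp_eq_Re exp_le_cancel_iff by linarith
qed

text \<open>The substitution y = x v / sqrt N with x = A14 / N has the factor x / sqrt N. The sqrt N
  goes into the normalisation on the left, whereas x = A14 / N stays in the integrand, where it
  compensates the pole of the hook factor.\<close>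

lemma fps_coeff_saddle_integral:
  fixes G :: "complex fps"
  assumes radius: "fps_conv_radius G \<ge> 1" and n: "n > 0"
  defines "N \<equiv> sqrt (A14 * n)"
  shows "of_real (2 * pi * sqrt N * exp (- 2 * N)) * fps_nth G n =
     (LINT v|lborel. indicator {v. A14 / N * (\<bar>v\<bar> / sqrt N) \<le> pi} v *\<^sub>R
        (of_real (A14 / N) * eval_fps G (exp (- saddle N v)) * exp (of_real (N\<^sup>2 / A14) * saddle N v - of_real (2 * N))))"
proof -
  define x where "x = A14 / N"
  have N: "N > 0" using n A14_pos by (simp add: N_def)
  have x: "x > 0" using N A14_pos by (simp add: x_def)
  have nN: "N\<^sup>2 / A14 = real n" using A14_pos by (simp add: N_def)
  define g where "g = (\<lambda>y. eval_fps G (exp (- Complex x y)) * exp (of_nat n * Complex x y))"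
  have int: "(g has_integral (2 * pi * fps_nth G n)) {-pi..pi}"
    unfolding g_def by (rule power_series_coeff_integral[OF x radius])
  have cont_exp: "continuous_on UNIV (\<lambda>y. exp (of_nat n * Complex x y))"
    unfolding Complex_eq by (intro continuous_intros)
  have "continuous_on UNIV (\<lambda>y. eval_fps G (exp (- Complex x y)))"
  proof (rule continuous_on_compose2[OF continuous_on_eval_fps[of G]])
    show "continuous_on UNIV (\<lambda>y. exp (- Complex x y))"
      unfolding Complex_eq by (intro continuous_intros)
    have "ereal (norm (exp (- Complex x y))) < 1" for y
      using x by (simp add: one_ereal_def)
    then show "(\<lambda>y. exp (- Complex x y)) ` UNIV \<subseteq> eball 0 (fps_conv_radius G)"
      using less_le_trans[OF _ radius] by auto
  qed
  then have "continuous_on UNIV g"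
    unfolding g_def by (intro continuous_on_mult cont_exp)
  then have si: "set_integrable lborel {-pi..pi} g"
    by (intro borel_integrable_atLeastAtMost') (auto intro: continuous_on_subset)
  define c where "c = x / sqrt N"
  have c: "c > 0" using x N by (simp add: c_def)
  have "2 * pi * fps_nth G n = (LINT y:{-pi..pi}|lborel. g y)"
    using set_borel_integral_eq_integral(2)[OF si] integral_unique[OF int] by simp
  also have "\<dots> = c *\<^sub>R (LINT v|lborel. indicator {-pi..pi} (c * v) *\<^sub>R g (c * v))"
    unfolding set_lebesgue_integral_def using c by (subst lborel_integral_real_affine[of c _ 0]) auto
  finally have main: "2 * pi * fps_nth G n = of_real c * (LINT v|lborel. indicator {-pi..pi} (c * v) *\<^sub>R g (c * v))"
    by (simp add: scaleR_conv_of_real)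
  have cv: "c * v = A14 / N * (v / sqrt N)" for v by (simp add: c_def x_def)
  have "of_real (2 * pi * sqrt N * exp (- 2 * N)) * fps_nth G n
        = of_real (sqrt N * exp (- 2 * N)) * (2 * pi * fps_nth G n)" by simp
  also have "\<dots> = of_real (x * exp (- 2 * N)) * (LINT v|lborel. indicator {-pi..pi} (c * v) *\<^sub>R g (c * v))"
    unfolding main using N by (simp add: c_def)
  also have "\<dots> = (LINT v|lborel. of_real (x * exp (- 2 * N)) * (indicator {-pi..pi} (c * v) *\<^sub>R g (c * v)))"
    by (rule integral_mult_right_zero[symmetric])
  also have "\<dots> = (LINT v|lborel. indicator {v. A14 / N * (\<bar>v\<bar> / sqrt N) \<le> pi} v *\<^sub>R
        (of_real (A14 / N) * eval_fps G (exp (- saddle N v)) * exp (of_real (N\<^sup>2 / A14) * saddle N v - of_real (2 * N))))"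
  proof (intro Bochner_Integration.integral_cong refl)
    fix v
    have "c * v \<in> {-pi..pi} \<longleftrightarrow> \<bar>c * v\<bar> \<le> pi" by auto
    also have "\<bar>c * v\<bar> = A14 / N * (\<bar>v\<bar> / sqrt N)"
      unfolding cv using N A14_pos by (simp add: abs_mult)
    finally have ind: "indicator {-pi..pi} (c * v) = (indicator {v. A14 / N * (\<bar>v\<bar> / sqrt N) \<le> pi} v :: real)"
      by (simp add: indicator_def)
    have s: "saddle N v = Complex x (c * v)" by (simp add: saddle_eq_Complex x_def cv)
    have "exp (of_real (N\<^sup>2 / A14) * saddle N v - of_real (2 * N)) = exp (of_nat n * Complex x (c * v)) * of_real (exp (- 2 * N))"
      unfolding nN s by (simp add: exp_diff exp_minus divide_inverse flip: exp_of_real)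
    then show "of_real (x * exp (- 2 * N)) * (indicator {-pi..pi} (c * v) *\<^sub>R g (c * v)) =
       indicator {v. A14 / N * (\<bar>v\<bar> / sqrt N) \<le> pi} v *\<^sub>R
        (of_real (A14 / N) * eval_fps G (exp (- saddle N v)) * exp (of_real (N\<^sup>2 / A14) * saddle N v - of_real (2 * N)))"
      unfolding ind g_def s x_def[symmetric] by (simp add: mult_ac)
  qed
  finally show ?thesis .
qed

lemma saddle_integrand_measurable:
  fixes G :: "complex fps"
  assumes radius: "fps_conv_radius G \<ge> 1" and N: "N > 0"
  shows "(\<lambda>v. indicator {v. A14 / N * (\<bar>v\<bar> / sqrt N) \<le> pi} v *\<^sub>R
        (of_real (A14 / N) * eval_fps G (exp (- saddle N v)) * exp (of_real (N\<^sup>2 / A14) * saddle N v - of_real (2 * N))))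
      \<in> borel_measurable lborel"
proof -
  have cont_exp: "continuous_on UNIV (\<lambda>v. exp (of_real (N\<^sup>2 / A14) * saddle N v - of_real (2 * N)))"
    unfolding saddle_def using N by (intro continuous_intros) auto
  have "continuous_on UNIV (\<lambda>v. eval_fps G (exp (- saddle N v)))"
  proof (rule continuous_on_compose2[OF continuous_on_eval_fps[of G]])
    show "continuous_on UNIV (\<lambda>v. exp (- saddle N v))"
      unfolding saddle_def using N by (intro continuous_intros) auto
    have "ereal (norm (exp (- saddle N v))) < 1" for v
      using N A14_pos by (simp add: one_ereal_def saddle_sel)
    then show "(\<lambda>v. exp (- saddle N v)) ` UNIV \<subseteq> eball 0 (fps_conv_radius G)"
      using less_le_trans[OF _ radius] by auto
  qed
  then have "continuous_on UNIV (\<lambda>v. of_real (A14 / N) * eval_fps G (exp (- saddle N v)) *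
      exp (of_real (N\<^sup>2 / A14) * saddle N v - of_real (2 * N)))"
    by (intro continuous_on_mult continuous_on_const cont_exp)
  then have "(\<lambda>v. of_real (A14 / N) * eval_fps G (exp (- saddle N v)) *
      exp (of_real (N\<^sup>2 / A14) * saddle N v - of_real (2 * N))) \<in> borel_measurable borel"
    by (rule borel_measurable_continuous_onI)
  moreover have "{v. A14 / N * (\<bar>v\<bar> / sqrt N) \<le> pi} \<in> sets borel"
    by (intro borel_closed closed_Collect_le continuous_intros) (use N in auto)
  ultimately show ?thesis by (simp add: borel_measurable_scaleR borel_measurable_indicator)
qed

text \<open>The function \<open>H\<close> is the hook factor, with residue \<open>h\<close> at the
  origin. The rescaled integrand tends pointwise to h K14 exp (- v^2) and is dominated by a multiple
  of 1 / (1 + v^2), so the limit is a Gaussian integral. The bound on \<open>H\<close> is needed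
  outside the sector too, for the minor arcs.\<close>

lemma saddle_point_asymptotics:
  fixes G :: "complex fps" and H :: "complex \<Rightarrow> complex" and C h :: real
  assumes radius: "fps_conv_radius G \<ge> 1"
    and eval: "\<And>s. Re s > 0 \<Longrightarrow> eval_fps G (exp (- s)) = H s * P14 s"
    and H_bound: "\<And>s. 0 < Re s \<Longrightarrow> Re s \<le> 1 \<Longrightarrow> norm (H s) \<le> C / Re s"
    and H_lim: "\<And>s::nat \<Rightarrow> complex. (\<And>n. Re (s n) > 0) \<Longrightarrow> (\<And>n. \<bar>Im (s n)\<bar> \<le> Re (s n)) \<Longrightarrow>
       s \<longlonglongrightarrow> 0 \<Longrightarrow> (\<lambda>n. s n / Re (s n)) \<longlonglongrightarrow> 1 \<Longrightarrow> (\<lambda>n. s n * H (s n)) \<longlonglongrightarrow> of_real h"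
  shows "(\<lambda>n. of_real (2 * pi * sqrt (sqrt (A14 * n)) * exp (- 2 * sqrt (A14 * n))) * fps_nth G n)
           \<longlonglongrightarrow> of_real (h * K14 * sqrt pi)"
proof -
  define N where "N = (\<lambda>n::nat. sqrt (A14 * n))"
  have N_top: "filterlim N at_top sequentially"
    unfolding N_def using A14_pos by real_asymp
  obtain B1 where B1: "\<And>s. Re s > 0 \<Longrightarrow> \<bar>Im s\<bar> \<le> Re s \<Longrightarrow> norm (P14 s * exp (- of_real (pi\<^sup>2 / 15) / s)) \<le> B1"
    using P14_sector_bounded by blast
  obtain B2 c where c: "c > 0" and B2: "\<And>x y. 0 < x \<Longrightarrow> x \<le> 1 / 10 \<Longrightarrow> x < \<bar>y\<bar> \<Longrightarrow> \<bar>y\<bar> \<le> pi \<Longrightarrow>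
     norm (P14 (Complex x y)) \<le> B2 * exp (pi\<^sup>2 / 15 / x - c / x)"
    by (rule P14_minor) (rule that)
  define \<Phi> where "\<Phi> = (\<lambda>M v. indicator {v. A14 / M * (\<bar>v\<bar> / sqrt M) \<le> pi} v *\<^sub>R
        (of_real (A14 / M) * eval_fps G (exp (- saddle M v)) * exp (of_real (M\<^sup>2 / A14) * saddle M v - of_real (2 * M))))"
  have C: "C \<ge> 0"
    using H_bound[of 1] norm_ge_zero[of "H 1"] by (simp add: order_trans[of 0 "norm (H 1)"])
  \<comment> \<open>27 / c^3 comes from \<open>exp_ge_cube\<close> at c / x, and 1 + \<pi>^2 A14
    bounds (1 + v^2) x^3.\<close>
  define Q where "Q = 27 * (1 + pi\<^sup>2 * A14) / c ^ 3"
  define W where "W = max (2 * C * B1) (C * B2 * Q)"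
  have split: "of_real (A14 / M) * eval_fps G (exp (- saddle M v)) * exp (of_real (M\<^sup>2 / A14) * saddle M v - of_real (2 * M))
     = of_real (A14 / M) * H (saddle M v) * (P14 (saddle M v) * exp (- of_real (pi\<^sup>2 / 15) / saddle M v)) *
       exp (- of_real (v\<^sup>2) / (1 + \<i> * of_real (v / sqrt M)))" if M: "M > 0" for M v
  proof -
    have "Re (saddle M v) > 0" using M A14_pos by (simp add: saddle_sel)
    moreover have "exp (- of_real (pi\<^sup>2 / 15) / saddle M v) * exp (- of_real (v\<^sup>2) / (1 + \<i> * of_real (v / sqrt M)))
      = exp (of_real (M\<^sup>2 / A14) * saddle M v - of_real (2 * M))"
      unfolding saddle_exponent[OF M, symmetric] A14_def[symmetric]
      by (simp flip: exp_add)
    ultimately show ?thesis using eval by (simp add: mult.assoc)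
  qed
  have bound: "norm (\<Phi> M v) \<le> W / (1 + v\<^sup>2)" if M: "M \<ge> 10 * A14" for M v
  proof -
    define x where "x = A14 / M"
    have Mp: "M > 0" using M A14_pos by linarith
    have x: "0 < x" "x \<le> 1 / 10" using M A14_pos Mp by (auto simp: x_def field_simps)
    have s: "Re (saddle M v) = x" "Im (saddle M v) = x * (v / sqrt M)" by (simp_all add: saddle_sel x_def)
    have xH: "norm (of_real x * H (saddle M v)) \<le> C"
    proof -
      have "norm (H (saddle M v)) \<le> C / x" using H_bound[of "saddle M v"] x s by simp
      then show ?thesis using x by (simp add: norm_mult field_simps)
    qed
    \<comment> \<open>Sector, minor arcs, and the region outside the range of integration.\<close>
    consider "\<bar>v\<bar> \<le> sqrt M" | "\<bar>v\<bar> > sqrt M" "x * (\<bar>v\<bar> / sqrt M) \<le> pi" | "x * (\<bar>v\<bar> / sqrt M) > pi"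
      by linarith
    then show ?thesis
    proof cases
      case 1
      then have "\<bar>v\<bar> / sqrt M \<le> 1" using Mp by simp
      then have "x * (\<bar>v\<bar> / sqrt M) \<le> x * 1" using x by (intro mult_left_mono) auto
      then have im: "\<bar>Im (saddle M v)\<bar> \<le> Re (saddle M v)"
        using x Mp by (simp add: s abs_mult)
      have "norm (\<Phi> M v) \<le> norm (of_real (A14 / M) * eval_fps G (exp (- saddle M v)) * exp (of_real (M\<^sup>2 / A14) * saddle M v - of_real (2 * M)))"
        unfolding \<Phi>_def norm_scaleR by (rule mult_left_le_one_le) (auto simp: indicator_def)
      also have "\<dots> = norm (of_real x * H (saddle M v)) * norm (P14 (saddle M v) * exp (- of_real (pi\<^sup>2 / 15) / saddle M v)) *
           norm (exp (- of_real (v\<^sup>2) / (1 + \<i> * of_real (v / sqrt M))))"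
        by (simp only: split[OF Mp] x_def norm_mult)
      also have "\<dots> \<le> C * B1 * exp (- (v\<^sup>2 / 2))"
        using im x s C by (intro mult_mono xH B1 saddle_exponent_norm[OF Mp 1] mult_nonneg_nonneg)
          (auto intro: order_trans[OF norm_ge_zero B1])
      also have "\<dots> \<le> C * B1 * (2 / (1 + v\<^sup>2))"
        using im x s C by (intro mult_left_mono exp_minus_half_le mult_nonneg_nonneg)
          (auto intro: order_trans[OF norm_ge_zero B1])
      also have "\<dots> = 2 * C * B1 / (1 + v\<^sup>2)" by simp
      also have "\<dots> \<le> W / (1 + v\<^sup>2)" unfolding W_def by (intro divide_right_mono) auto
      finally show ?thesis .
    next
      case 2
      define y where "y = x * (v / sqrt M)"
      have absy: "\<bar>y\<bar> = x * (\<bar>v\<bar> / sqrt M)" using x Mp by (simp add: y_def abs_mult)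
      have "\<bar>v\<bar> / sqrt M > 1" using 2 Mp by simp
      then have "x * (\<bar>v\<bar> / sqrt M) > x * 1" using x by (intro mult_strict_left_mono) auto
      then have y: "x < \<bar>y\<bar>" "\<bar>y\<bar> \<le> pi" using 2 absy by auto
      have sC: "saddle M v = Complex x y" by (simp add: complex_eq_iff s y_def)
      \<comment> \<open>The real part of the exponent is M - 2M = - A14 / x, which exactly cancels
        the growth exp (A14 / x) in the bound for \<open>P14\<close> and leaves exp (- c /
        x).\<close>
      have "norm (exp (of_real (M\<^sup>2 / A14) * saddle M v - of_real (2 * M))) = exp (- (A14 / x))"
        using Mp A14_pos by (simp add: s x_def power2_eq_square)
      moreover have "eval_fps G (exp (- saddle M v)) = H (saddle M v) * P14 (Complex x y)"
        using eval[of "saddle M v"] x s by (simp add: sC)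
      ultimately have "norm (of_real (A14 / M) * eval_fps G (exp (- saddle M v)) * exp (of_real (M\<^sup>2 / A14) * saddle M v - of_real (2 * M)))
         = norm (of_real x * H (saddle M v)) * norm (P14 (Complex x y)) * exp (- (A14 / x))"
        by (simp only: norm_mult x_def mult.assoc)
      moreover have "norm (\<Phi> M v) \<le> norm (of_real (A14 / M) * eval_fps G (exp (- saddle M v)) * exp (of_real (M\<^sup>2 / A14) * saddle M v - of_real (2 * M)))"
        unfolding \<Phi>_def norm_scaleR by (rule mult_left_le_one_le) (auto simp: indicator_def)
      ultimately have "norm (\<Phi> M v) \<le> norm (of_real x * H (saddle M v)) * norm (P14 (Complex x y)) * exp (- (A14 / x))"
        by simp
      also have "\<dots> \<le> C * (B2 * exp (pi\<^sup>2 / 15 / x - c / x)) * exp (- (A14 / x))"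
        using C by (intro mult_right_mono mult_mono xH B2 x y) auto
      also have "\<dots> = C * B2 * exp (- (c / x))"
        by (simp add: A14_def exp_diff exp_minus field_simps)
      also have "\<dots> \<le> C * B2 * (Q / (1 + v\<^sup>2))"
      proof (intro mult_left_mono mult_nonneg_nonneg C)
        have "0 \<le> norm (P14 (Complex x y))" by simp
        also have "\<dots> \<le> B2 * exp (pi\<^sup>2 / 15 / x - c / x)" by (rule B2[OF x y])
        finally show "B2 \<ge> 0" by (simp add: zero_le_mult_iff)
        have "v\<^sup>2 * x ^ 3 = A14 * y\<^sup>2"
        proof -
          have "(v / sqrt M)\<^sup>2 = v\<^sup>2 / M" using Mp by (simp add: power_divide)
          then have "y\<^sup>2 = x\<^sup>2 * (v\<^sup>2 / M)" by (simp only: y_def power_mult_distrib)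
          moreover have "A14 = x * M" using Mp by (simp add: x_def)
          ultimately have "A14 * y\<^sup>2 = x * M * (x\<^sup>2 * (v\<^sup>2 / M))" by (simp only:)
          also have "\<dots> = v\<^sup>2 * x ^ 3" using Mp by (simp add: power2_eq_square power3_eq_cube)
          finally show ?thesis ..
        qed
        also have "y\<^sup>2 \<le> pi\<^sup>2" using power_mono[OF y(2), of 2] by simp
        finally have 1: "v\<^sup>2 * x ^ 3 \<le> A14 * pi\<^sup>2" using A14_pos by simp
        have "x ^ 3 \<le> 1" using x by (intro power_le_one) auto
        with 1 have 2: "(1 + v\<^sup>2) * x ^ 3 \<le> 1 + pi\<^sup>2 * A14" by (simp add: algebra_simps)
        have "(c / x / 3) ^ 3 \<le> exp (c / x)" using c x by (intro exp_ge_cube) auto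
        then have "exp (- (c / x)) \<le> 1 / (c / x / 3) ^ 3"
          unfolding exp_minus inverse_eq_divide using c x by (intro divide_left_mono mult_pos_pos) auto
        also have "\<dots> = 27 * x ^ 3 / c ^ 3" by (simp add: power_divide)
        also have "\<dots> \<le> 27 * ((1 + pi\<^sup>2 * A14) / (1 + v\<^sup>2)) / c ^ 3"
        proof -
          have "0 < 1 + v\<^sup>2" by (intro add_pos_nonneg) auto
          then have "x ^ 3 \<le> (1 + pi\<^sup>2 * A14) / (1 + v\<^sup>2)" using 2 by (simp add: pos_le_divide_eq mult.commute)
          then show ?thesis using c by (intro divide_right_mono mult_left_mono) auto
        qed
        also have "\<dots> = Q / (1 + v\<^sup>2)" by (simp add: Q_def)
        finally show "exp (- (c / x)) \<le> Q / (1 + v\<^sup>2)" .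
      qed
      also have "\<dots> = C * B2 * Q / (1 + v\<^sup>2)" by simp
      also have "\<dots> \<le> W / (1 + v\<^sup>2)" unfolding W_def by (intro divide_right_mono) auto
      finally show ?thesis .
    next
      case 3
      have "0 \<le> B1" by (rule order_trans[OF norm_ge_zero B1[of 1]]) auto
      then have "0 \<le> W" unfolding W_def using C by (intro max.coboundedI1) simp
      then show ?thesis using 3 by (simp add: \<Phi>_def x_def)
    qed
  qed
  have pointwise: "(\<lambda>n. \<Phi> (N (n + m)) v) \<longlonglongrightarrow> of_real (h * K14) * of_real (exp (- v\<^sup>2))" for v m
  proof -
    have "\<forall>\<^sub>F n in sequentially. sqrt (N n) \<ge> \<bar>v\<bar> \<and> N n > A14"
    proof (intro eventually_conj)
      have "filterlim (\<lambda>n. sqrt (N n)) at_top sequentially"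
        by (rule filterlim_compose[OF sqrt_at_top N_top])
      then show "\<forall>\<^sub>F n in sequentially. sqrt (N n) \<ge> \<bar>v\<bar>" by (simp add: filterlim_at_top)
      show "\<forall>\<^sub>F n in sequentially. N n > A14" using N_top by (simp add: filterlim_at_top_dense)
    qed
    \<comment> \<open>The limit statements ask for the sector condition at every index, so the
      sequence is shifted by a \<open>k\<close> depending on \<open>v\<close>; convergence is
      unaffected.\<close>
    then obtain k where k: "\<And>n. n \<ge> k \<Longrightarrow> sqrt (N n) \<ge> \<bar>v\<bar>" "\<And>n. n \<ge> k \<Longrightarrow> N n > A14"
      by (auto simp: eventually_sequentially)
    define M where "M = (\<lambda>n. N (n + k))"
    have M: "sqrt (M n) \<ge> \<bar>v\<bar>" "M n > A14" "M n > 0" for n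
      using k[of "n + k"] A14_pos by (auto simp: M_def)
    have M_top: "filterlim M at_top sequentially"
      unfolding M_def by (rule filterlim_compose[OF N_top filterlim_add_const_nat_at_top])
    define s where "s = (\<lambda>n. saddle (M n) v)"
    have u0: "(\<lambda>n. v / sqrt (M n)) \<longlonglongrightarrow> 0"
      by (intro tendsto_divide_0[OF tendsto_const] filterlim_at_top_imp_at_infinity filterlim_compose[OF sqrt_at_top M_top])
    have w1: "(\<lambda>n. 1 + \<i> * of_real (v / sqrt (M n))) \<longlonglongrightarrow> 1"
      using tendsto_add[OF tendsto_const tendsto_mult[OF tendsto_const tendsto_of_real[OF u0]], of 1 \<i>] by simp
    have x0: "(\<lambda>n. A14 / M n) \<longlonglongrightarrow> 0"
      by (intro tendsto_divide_0[OF tendsto_const] filterlim_at_top_imp_at_infinity M_top)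
    have s0: "s \<longlonglongrightarrow> 0"
      using tendsto_mult[OF tendsto_of_real[OF x0] w1] by (simp add: s_def saddle_def)
    have xpos: "A14 / M n > 0" for n using M A14_pos by simp
    have ratio_eq: "s n / Re (s n) = 1 + \<i> * of_real (v / sqrt (M n))" for n
      using M(3)[of n] A14_pos unfolding s_def saddle_sel saddle_def by simp
    have ratio: "(\<lambda>n. s n / Re (s n)) \<longlonglongrightarrow> 1" unfolding ratio_eq by (rule w1)
    have Re_s: "Re (s n) > 0" for n using xpos by (simp add: s_def saddle_sel)
    have u_le: "\<bar>v / sqrt (M n)\<bar> \<le> 1" for n using M[of n] by (simp add: abs_divide)
    have Im_s: "\<bar>Im (s n)\<bar> \<le> Re (s n)" for n
    proof -
      have "\<bar>A14 / M n\<bar> * \<bar>v / sqrt (M n)\<bar> \<le> A14 / M n * 1"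
        using xpos[of n] u_le[of n] by (intro mult_mono) auto
      then show ?thesis unfolding s_def saddle_sel abs_mult by simp
    qed
    have a: "(\<lambda>n. of_real (A14 / M n) * H (s n)) \<longlonglongrightarrow> of_real h"
    proof -
      have "(\<lambda>n. s n * H (s n) / (s n / Re (s n))) \<longlonglongrightarrow> of_real h / 1"
        by (intro tendsto_divide H_lim Re_s Im_s s0 ratio) auto
      moreover have "s n * H (s n) / (s n / Re (s n)) = of_real (A14 / M n) * H (s n)" for n
      proof -
        have "s n \<noteq> 0" using Re_s[of n] by auto
        then show ?thesis by (simp add: s_def saddle_sel)
      qed
      ultimately show ?thesis by simp
    qed
    have b: "(\<lambda>n. P14 (s n) * exp (- of_real (pi\<^sup>2 / 15) / s n)) \<longlonglongrightarrow> of_real K14"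
      by (intro P14_tendsto Re_s Im_s s0 ratio)
    have "(\<lambda>n. exp (- of_real (v\<^sup>2) / (1 + \<i> * of_real (v / sqrt (M n))))) \<longlonglongrightarrow> exp (- of_real (v\<^sup>2) / 1)"
      by (intro tendsto_exp tendsto_divide tendsto_const w1) auto
    from tendsto_mult[OF tendsto_mult[OF a b] this]
    have lim: "(\<lambda>n. of_real (A14 / M n) * H (s n) * (P14 (s n) * exp (- of_real (pi\<^sup>2 / 15) / s n)) *
         exp (- of_real (v\<^sup>2) / (1 + \<i> * of_real (v / sqrt (M n))))) \<longlonglongrightarrow> of_real (h * K14) * of_real (exp (- v\<^sup>2))"
      by (simp flip: exp_of_real)
    have "\<Phi> (M n) v = of_real (A14 / M n) * H (s n) * (P14 (s n) * exp (- of_real (pi\<^sup>2 / 15) / s n)) *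
         exp (- of_real (v\<^sup>2) / (1 + \<i> * of_real (v / sqrt (M n))))" for n
    proof -
      have "A14 / M n * (\<bar>v\<bar> / sqrt (M n)) \<le> 1 * 1"
        using u_le[of n] M[of n] A14_pos by (intro mult_mono) auto
      then have "A14 / M n * (\<bar>v\<bar> / sqrt (M n)) \<le> pi" using pi_ge_two by linarith
      then show ?thesis unfolding \<Phi>_def s_def split[OF M(3)] by simp
    qed
    then have "(\<lambda>n. \<Phi> (N (n + k)) v) \<longlonglongrightarrow> of_real (h * K14) * of_real (exp (- v\<^sup>2))"
      using lim by (simp add: M_def)
    then have "(\<lambda>n. \<Phi> (N n) v) \<longlonglongrightarrow> of_real (h * K14) * of_real (exp (- v\<^sup>2))"
      by (rule LIMSEQ_offset)
    then show ?thesis by (rule LIMSEQ_ignore_initial_segment)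
  qed
  \<comment> \<open>From \<open>m\<close> on the abscissa is at most 1/10, as the minor arc estimate
    requires; \<open>m > 0\<close> avoids the coefficient of index 0, whose scale \<open>N\<close>
    would vanish.\<close>
  obtain m where m: "m > 0" "\<And>n. n \<ge> m \<Longrightarrow> N n \<ge> 10 * A14"
  proof -
    have "\<forall>\<^sub>F n in sequentially. N n \<ge> 10 * A14" using N_top by (simp add: filterlim_at_top)
    then obtain m where "\<And>n. n \<ge> m \<Longrightarrow> N n \<ge> 10 * A14" by (auto simp: eventually_sequentially)
    then show thesis using that[of "Suc m"] by simp
  qed
  have coeff: "of_real (2 * pi * sqrt (N (n + m)) * exp (- 2 * N (n + m))) * fps_nth G (n + m) = (LINT v|lborel. \<Phi> (N (n + m)) v)" for n
    unfolding \<Phi>_def N_def using m by (intro fps_coeff_saddle_integral radius) auto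
  have "(\<lambda>n. LINT v|lborel. \<Phi> (N (n + m)) v) \<longlonglongrightarrow> (LINT v|lborel. of_real (h * K14) * complex_of_real (exp (- v\<^sup>2)))"
  proof (rule integral_dominated_convergence[OF _ _ integrable_inverse_1_plus_sq[of W]])
    show meas: "\<Phi> (N (n + m)) \<in> borel_measurable lborel" for n
      unfolding \<Phi>_def using m(2)[of "n + m"] A14_pos by (intro saddle_integrand_measurable radius) auto
  qed (use pointwise bound m in auto)
  also have "(LINT v|lborel. of_real (h * K14) * complex_of_real (exp (- v\<^sup>2))) = of_real (h * K14) * of_real (sqrt pi)"
  proof -
    have "(LINT v|lborel. exp (- v\<^sup>2)) = sqrt pi" using gaussian_integral by (simp add: has_bochner_integral_iff)
    then show ?thesis by simp
  qed
  finally have "(\<lambda>n. of_real (2 * pi * sqrt (N (n + m)) * exp (- 2 * N (n + m))) * fps_nth G (n + m)) \<longlonglongrightarrow> of_real (h * K14 * sqrt pi)"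
    unfolding coeff by simp
  then show ?thesis
    unfolding N_def by (rule LIMSEQ_offset)
qed

section \<open>From the rescaled limit to the asymptotic formula\<close>

lemma A14_n: "sqrt (A14 * real n) = pi * sqrt (real n / 15)"
  by (simp add: A14_def real_sqrt_mult real_sqrt_divide)

text \<open>The normalising factor contains sqrt \<pi> n^(1/4) / 15^(1/4). Its sqrt \<pi> cancels
  the one from the Gaussian integral, and 15^(1/4) against the 5^(1/4) in \<open>K14\<close> leaves
  3^(1/4).\<close>

lemma coefficient_asymptotics:
  fixes a :: "nat \<Rightarrow> real" and h :: real
  assumes h: "h > 0"
    and lim: "(\<lambda>n. complex_of_real (2 * pi * sqrt (sqrt (A14 * n)) * exp (- 2 * sqrt (A14 * n))) * of_real (a n))
           \<longlonglongrightarrow> of_real (h * K14 * sqrt pi)"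
  shows "a \<sim>[sequentially] (\<lambda>n. h * (3 powr (1/4) * golden_ratio powr (1/2) / (2 * pi)) * real n powr (-1/4) *
            exp (2 * pi * sqrt (real n / 15)))"
proof (rule asymp_equivI')
  define t where "t = (\<lambda>n. 2 * pi * sqrt (sqrt (A14 * real n)) * exp (- 2 * sqrt (A14 * real n)))"
  define D where "D = (\<lambda>n. h * (3 powr (1/4) * golden_ratio powr (1/2) / (2 * pi)) * real n powr (-1/4) *
            exp (2 * pi * sqrt (real n / 15)))"
  have gr: "golden_ratio > 0" by (simp add: golden_ratio_def add_pos_nonneg)
  have K: "K14 > 0" using gr by (simp add: K14_def)
  have "(\<lambda>n. complex_of_real (t n * a n)) \<longlonglongrightarrow> of_real (h * K14 * sqrt pi)"
    using lim unfolding t_def by simp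
  then have "(\<lambda>n. t n * a n) \<longlonglongrightarrow> h * K14 * sqrt pi"
    by (simp only: tendsto_of_real_iff)
  from tendsto_divide[OF this tendsto_const[of "h * K14 * sqrt pi"]]
  have "(\<lambda>n. t n * a n / (h * K14 * sqrt pi)) \<longlonglongrightarrow> 1"
    using h K by simp
  moreover have "t n * a n / (h * K14 * sqrt pi) = a n / D n" if n: "n > 0" for n
  proof -
    define E where "E = exp (2 * pi * sqrt (real n / 15))"
    define r where "r = real n powr (1/4)"
    have r: "r > 0" using n by (simp add: r_def)
    have e: "exp (- 2 * sqrt (A14 * real n)) = 1 / E"
      unfolding A14_n E_def by (simp add: exp_minus inverse_eq_divide mult_ac)
    have sq: "sqrt (sqrt (A14 * real n)) = sqrt pi * r / 15 powr (1/4)"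
    proof -
      have "sqrt (sqrt y) = y powr (1/4)" if "y > 0" for y
        using that by (simp add: powr_half_sqrt[symmetric] powr_powr)
      moreover have "sqrt (sqrt (A14 * real n)) = sqrt pi * (sqrt (sqrt (real n)) / sqrt (sqrt 15))"
        unfolding A14_n by (simp add: real_sqrt_mult real_sqrt_divide)
      ultimately show ?thesis using n by (simp add: r_def)
    qed
    have rm: "real n powr (-1/4) = 1 / r"
      using n by (simp add: r_def powr_minus_divide)
    have p15: "(15::real) powr (1/4) = 3 powr (1/4) * 5 powr (1/4)"
      using powr_mult[of 3 5 "1/4"] by simp
    define s where "s = sqrt pi"
    have s: "s > 0" "pi = s * s" by (simp_all add: s_def)
    have "t n / (h * K14 * sqrt pi) = 1 / D n"
      unfolding t_def D_def e sq rm p15 E_def[symmetric] K14_def s_def[symmetric] unfolding s(2)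
      using s(1) r h gr by (simp add: E_def field_simps)
    then show ?thesis by (metis (no_types, lifting) mult.commute mult.left_neutral times_divide_eq_left times_divide_eq_right)
  qed
  then have "\<forall>\<^sub>F n in sequentially. t n * a n / (h * K14 * sqrt pi) = a n / D n"
    by (intro eventually_mono[OF eventually_gt_at_top[of 0]])
  ultimately show "(\<lambda>n. a n / D n) \<longlonglongrightarrow> 1"
    by (rule Lim_transform_eventually)
qed

section \<open>Size and pole of the hook factors\<close>

lemma F14_norm_bound:
  assumes "0 < Re s" "Re s \<le> 1"
  shows "norm (F14 s) \<le> 3 / Re s"
  using norm_F14_le[OF assms(1)] f14_upper[OF assms] by linarith

lemma F14_norm_bound_double:
  assumes "0 < Re s" "Re s \<le> 1"
  shows "norm (F14 (2 * s)) \<le> 6 / Re s"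
proof -
  have "norm (F14 (2 * s)) \<le> f14 (2 * Re s)" using norm_F14_le[of "2 * s"] assms by simp
  also have "\<dots> \<le> f14 (Re s)"
  proof -
    have "exp (- (2 * Re s)) \<le> exp (- Re s)" "exp (- (4 * (2 * Re s))) \<le> exp (- (4 * Re s))"
      "exp (- (5 * (2 * Re s))) \<le> exp (- (5 * Re s))" using assms by auto
    then show ?thesis unfolding f14_def using assms by (intro frac_le add_mono) auto
  qed
  also have "\<dots> \<le> 3 / Re s" by (rule f14_upper[OF assms])
  also have "\<dots> \<le> 6 / Re s" using assms by (intro divide_right_mono) auto
  finally show ?thesis .
qed

text \<open>By the definition of \<open>g14\<close>, s F14 (s) = 2/5 + s^2 g14 (s), and
  \<open>g14\<close> is bounded in the sector.\<close>

lemma F14_pole: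
  fixes s :: "nat \<Rightarrow> complex"
  assumes s: "\<And>n. Re (s n) > 0" "\<And>n. \<bar>Im (s n)\<bar> \<le> Re (s n)" and lim: "s \<longlonglongrightarrow> 0"
  shows "(\<lambda>n. s n * F14 (s n)) \<longlonglongrightarrow> 2 / 5"
proof -
  have "(\<lambda>n. (s n)\<^sup>2 * g14 (s n)) \<longlonglongrightarrow> 0"
  proof (rule Lim_null_comparison)
    define C :: real where "C = 2 * max (161 * exp 5) 7"
    have "C \<ge> 0" by (simp add: C_def)
    have "norm (g14 (s n)) \<le> C" for n
    proof -
      have "norm (g14 (s n)) \<le> C / (1 + (norm (s n))\<^sup>2)" unfolding C_def by (rule g14.decay[OF s])
      also have "\<dots> \<le> C / 1" using \<open>C \<ge> 0\<close> by (intro divide_left_mono mult_pos_pos) (auto intro: add_pos_nonneg)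
      finally show ?thesis by simp
    qed
    then show "\<forall>\<^sub>F n in sequentially. norm ((s n)\<^sup>2 * g14 (s n)) \<le> (norm (s n))\<^sup>2 * C"
      by (auto simp: norm_mult norm_power intro!: always_eventually mult_left_mono)
    have "(\<lambda>n. (norm (s n))\<^sup>2 * C) \<longlonglongrightarrow> (norm (0::complex))\<^sup>2 * C"
      by (intro tendsto_intros lim)
    then show "(\<lambda>n. (norm (s n))\<^sup>2 * C) \<longlonglongrightarrow> 0" by simp
  qed
  from tendsto_add[OF tendsto_const[of "2 / 5"] this]
  have "(\<lambda>n. 2 / 5 + (s n)\<^sup>2 * g14 (s n)) \<longlonglongrightarrow> 2 / 5" by simp
  moreover have "2 / 5 + (s n)\<^sup>2 * g14 (s n) = s n * F14 (s n)" for n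
  proof -
    have "s n \<noteq> 0" using s(1)[of n] by auto
    then show ?thesis by (simp add: g14_def field_simps power2_eq_square)
  qed
  ultimately show ?thesis by simp
qed

section \<open>The generating functions of the hook counts\<close>

definition hooks1_fps :: "complex fps" where
  "hooks1_fps = Abs_fps (\<lambda>m. if m \<in> parts_14 then 1 else 0)"

text \<open>The exponent is the total size of the parts removed: one part \<open>m\<close> for the
  first kind of 2-hook, two equal parts for the second. The summands may overlap, since a number can
  be both a part size and twice one.\<close>

definition hooks2_fps :: "complex fps" where
  "hooks2_fps = Abs_fps (\<lambda>m. (if m \<in> parts_14 \<and> 2 \<le> m then 1 else 0) + (if even m \<and> m div 2 \<in> parts_14 then 1 else 0))"

lemma has_sum_imp_sums_indicator:
  fixes f :: "nat \<Rightarrow> complex"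
  assumes "(f has_sum X) S"
  shows "(\<lambda>m. (if m \<in> S then 1 else 0) * f m) sums X"
proof (rule has_sum_imp_sums)
  have "((\<lambda>m. (if m \<in> S then 1 else 0) * f m) has_sum X) UNIV \<longleftrightarrow> (f has_sum X) S"
    by (rule has_sum_cong_neutral) auto
  then show "((\<lambda>m. (if m \<in> S then 1 else 0) * f m) has_sum X) UNIV" using assms by simp
qed

lemma hooks1_fps_sums:
  assumes "norm (q::complex) < 1"
  shows "(\<lambda>m. fps_nth hooks1_fps m * q ^ m) sums ((q + q ^ 4) / (1 - q ^ 5))"
  using has_sum_imp_sums_indicator[OF has_sum_parts_14[OF assms]] by (simp add: hooks1_fps_def)

lemma hooks2_fps_sums:
  assumes q: "norm (q::complex) < 1"
  shows "(\<lambda>m. fps_nth hooks2_fps m * q ^ m) sums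
    ((q + q ^ 4) / (1 - q ^ 5) - q + (q\<^sup>2 + (q\<^sup>2) ^ 4) / (1 - (q\<^sup>2) ^ 5))"
proof -
  have q2: "norm (q\<^sup>2) < 1" using q by (simp add: norm_power power_less_one_iff)
  \<comment> \<open>The size 1 is the only admissible one excluded by
    \<open>2 \<le> m\<close>.\<close>
  have 1: "(\<lambda>m. if m = 1 then q else 0) sums q" by (rule sums_single)
  have "((\<lambda>m. q ^ m) has_sum ((q\<^sup>2 + (q\<^sup>2) ^ 4) / (1 - (q\<^sup>2) ^ 5))) ((\<lambda>m. 2 * m) ` parts_14)"
    using has_sum_parts_14[OF q2] by (subst has_sum_reindex) (auto simp: inj_on_def o_def power_mult)
  also have "(\<lambda>m. 2 * m) ` parts_14 = {m. even m \<and> m div 2 \<in> parts_14}"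
    by (auto simp: image_iff elim!: evenE)
  finally have 2: "((\<lambda>m. q ^ m) has_sum ((q\<^sup>2 + (q\<^sup>2) ^ 4) / (1 - (q\<^sup>2) ^ 5))) {m. even m \<and> m div 2 \<in> parts_14}" .
  have "(\<lambda>m. fps_nth hooks1_fps m * q ^ m - (if m = 1 then q else 0) + (if m \<in> {m. even m \<and> m div 2 \<in> parts_14} then 1 else 0) * q ^ m) sums
    ((q + q ^ 4) / (1 - q ^ 5) - q + (q\<^sup>2 + (q\<^sup>2) ^ 4) / (1 - (q\<^sup>2) ^ 5))"
    by (intro sums_add sums_diff hooks1_fps_sums q 1 has_sum_imp_sums_indicator 2)
  also have "(\<lambda>m. fps_nth hooks1_fps m * q ^ m - (if m = 1 then q else 0) + (if m \<in> {m. even m \<and> m div 2 \<in> parts_14} then 1 else 0) * q ^ m)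
    = (\<lambda>m. fps_nth hooks2_fps m * q ^ m)"
  proof
    fix m
    have "m \<in> parts_14 \<Longrightarrow> 2 \<le> m \<or> m = 1" using zero_notin_parts_14 by (cases "m = 0") auto
    moreover have "1 \<in> parts_14" by (simp add: parts_14_def)
    ultimately show "fps_nth hooks1_fps m * q ^ m - (if m = 1 then q else 0) + (if m \<in> {m. even m \<and> m div 2 \<in> parts_14} then 1 else 0) * q ^ m
      = fps_nth hooks2_fps m * q ^ m"
      by (cases "m = 1") (auto simp: hooks1_fps_def hooks2_fps_def)
  qed
  finally show ?thesis .
qed

lemma fps_conv_radius_ge_1:
  fixes A :: "complex fps"
  assumes "\<And>q. norm q < 1 \<Longrightarrow> summable (\<lambda>m. fps_nth A m * q ^ m)"
  shows "fps_conv_radius A \<ge> 1"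
  unfolding fps_conv_radius_def
proof (rule conv_radius_geI_ex')
  fix r :: real assume "0 < r" "ereal r < 1"
  then show "summable (\<lambda>n. fps_nth A n * of_real r ^ n)"
    by (intro assms) (simp add: one_ereal_def)
qed

text \<open>The common frame of both claims: they differ only in the series \<open>A\<close>, its
  sum \<open>H\<close> as a function of \<open>s\<close>, and the residue \<open>h\<close> of
  \<open>H\<close> at the origin.\<close>

lemma asymptotics_of_product:
  fixes A :: "complex fps" and H :: "complex \<Rightarrow> complex" and C h :: real and a :: "nat \<Rightarrow> nat"
  assumes sums: "\<And>s. Re s > 0 \<Longrightarrow> (\<lambda>m. fps_nth A m * exp (- s) ^ m) sums H s"
    and summable: "\<And>q. norm q < 1 \<Longrightarrow> summable (\<lambda>m. fps_nth A m * q ^ m)"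
    and bound: "\<And>s. 0 < Re s \<Longrightarrow> Re s \<le> 1 \<Longrightarrow> norm (H s) \<le> C / Re s"
    and lim: "\<And>s::nat \<Rightarrow> complex. (\<And>n. Re (s n) > 0) \<Longrightarrow> (\<And>n. \<bar>Im (s n)\<bar> \<le> Re (s n)) \<Longrightarrow>
       s \<longlonglongrightarrow> 0 \<Longrightarrow> (\<lambda>n. s n * H (s n)) \<longlonglongrightarrow> of_real h"
    and coeff: "\<And>n. fps_nth (A * npartitions_fps parts_14) n = of_nat (a n)" and h: "h > 0"
  shows "(\<lambda>n. real (a n)) \<sim>[sequentially] (\<lambda>n. h * (3 powr (1/4) * golden_ratio powr (1/2) / (2 * pi)) * real n powr (-1/4) *
            exp (2 * pi * sqrt (real n / 15)))"
proof (rule coefficient_asymptotics[OF h])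
  have radA: "fps_conv_radius A \<ge> 1" by (rule fps_conv_radius_ge_1[OF summable])
  have radP: "fps_conv_radius (npartitions_fps parts_14) \<ge> 1"
    by (rule npartitions_generating_function(1)[OF zero_notin_parts_14 parts_14_radius])
  have "(\<lambda>n. of_real (2 * pi * sqrt (sqrt (A14 * n)) * exp (- 2 * sqrt (A14 * n))) * fps_nth (A * npartitions_fps parts_14) n)
           \<longlonglongrightarrow> of_real (h * K14 * sqrt pi)"
  proof (rule saddle_point_asymptotics[where H = H and C = C])
    show "fps_conv_radius (A * npartitions_fps parts_14) \<ge> 1"
      using radA radP by (intro order_trans[OF _ fps_conv_radius_mult]) auto
    show "eval_fps (A * npartitions_fps parts_14) (exp (- s)) = H s * P14 s" if s: "Re s > 0" for s
    proof -
      have "ereal (norm (exp (- s))) < 1" using s by (simp add: one_ereal_def)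
      then have "eval_fps (A * npartitions_fps parts_14) (exp (- s)) = eval_fps A (exp (- s)) * P14 s"
        unfolding P14_def using less_le_trans[OF _ radA] less_le_trans[OF _ radP] by (intro eval_fps_mult) auto
      moreover have "eval_fps A (exp (- s)) = H s" using sums[OF s] by (simp add: eval_fps_def sums_iff)
      ultimately show ?thesis by simp
    qed
  qed (use bound lim in auto)
  then show "(\<lambda>n. complex_of_real (2 * pi * sqrt (sqrt (A14 * n)) * exp (- 2 * sqrt (A14 * n))) * of_real (real (a n)))
           \<longlonglongrightarrow> of_real (h * K14 * sqrt pi)"
    unfolding coeff by simp
qed

lemma r2_1_coeff: "fps_nth (hooks1_fps * npartitions_fps parts_14) n = of_nat (r2 1 n)"
proof -
  have "of_nat (r2 1 n) = (\<Sum>m\<in>{m\<in>{0..n}. m \<in> parts_14}. complex_of_nat (npartitions parts_14 (n - m)))"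
    unfolding r2_1_eq of_nat_sum by (intro sum.cong) auto
  also have "\<dots> = (\<Sum>m=0..n. if m \<in> parts_14 then complex_of_nat (npartitions parts_14 (n - m)) else 0)"
    by (rule sum.inter_filter) simp
  also have "\<dots> = fps_nth (hooks1_fps * npartitions_fps parts_14) n"
    by (simp add: fps_mult_nth hooks1_fps_def npartitions_fps_def if_distrib[of "\<lambda>c. c * _"] cong: if_cong)
  finally show ?thesis by simp
qed

lemma r2_2_coeff: "fps_nth (hooks2_fps * npartitions_fps parts_14) n = of_nat (r2 2 n)"
proof -
  let ?p = "\<lambda>m. complex_of_nat (npartitions parts_14 (n - m))"
  have "of_nat (\<Sum>m\<in>{m\<in>parts_14. 2 \<le> m \<and> m \<le> n}. npartitions parts_14 (n - m)) =
        (\<Sum>m\<in>{m\<in>{0..n}. m \<in> parts_14 \<and> 2 \<le> m}. ?p m)"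
    unfolding of_nat_sum by (intro sum.cong) auto
  also have "\<dots> = (\<Sum>m=0..n. if m \<in> parts_14 \<and> 2 \<le> m then ?p m else 0)"
    by (rule sum.inter_filter) simp
  finally have 1: "of_nat (\<Sum>m\<in>{m\<in>parts_14. 2 \<le> m \<and> m \<le> n}. npartitions parts_14 (n - m)) = \<dots>" .
  have "of_nat (\<Sum>m\<in>{m\<in>parts_14. 2 * m \<le> n}. npartitions parts_14 (n - 2 * m)) =
        (\<Sum>m\<in>{m\<in>{0..n}. even m \<and> m div 2 \<in> parts_14}. ?p m)"
    unfolding of_nat_sum
    by (rule sum.reindex_bij_witness[of _ "\<lambda>m. m div 2" "\<lambda>m. 2 * m"]) auto
  also have "\<dots> = (\<Sum>m=0..n. if even m \<and> m div 2 \<in> parts_14 then ?p m else 0)"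
    by (rule sum.inter_filter) simp
  finally have 2: "of_nat (\<Sum>m\<in>{m\<in>parts_14. 2 * m \<le> n}. npartitions parts_14 (n - 2 * m)) = \<dots>" .
  have "fps_nth (hooks2_fps * npartitions_fps parts_14) n =
     (\<Sum>m=0..n. (if m \<in> parts_14 \<and> 2 \<le> m then ?p m else 0) + (if even m \<and> m div 2 \<in> parts_14 then ?p m else 0))"
    unfolding fps_mult_nth by (intro sum.cong refl) (simp add: hooks2_fps_def npartitions_fps_def)
  also have "\<dots> = of_nat (r2 2 n)"
    unfolding r2_2_eq of_nat_add 1 2 by (rule sum.distrib)
  finally show ?thesis .
qed

lemma F14_q: "F14 s = (exp (- s) + exp (- s) ^ 4) / (1 - exp (- s) ^ 5)"
  using F14_exp[of 1 s] by simp

theorem theorem1p4: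
  shows "(\<lambda>n. real (r2 1 n)) \<sim>[sequentially]
           (\<lambda>n. 3 powr (1/4) * golden_ratio powr (1/2) / (5 * pi)
                  * real n powr (-1/4) * exp (2 * pi * sqrt (real n / 15)))
       \<and> (\<lambda>n. real (r2 2 n)) \<sim>[sequentially]
           (\<lambda>n. 3 powr (5/4) * golden_ratio powr (1/2) / (10 * pi)
                  * real n powr (-1/4) * exp (2 * pi * sqrt (real n / 15)))"
proof
  have norm_q: "norm (exp (- s)) < 1" if "Re s > 0" for s :: complex using that by simp
  have "(\<lambda>n. real (r2 1 n)) \<sim>[sequentially] (\<lambda>n. 2/5 * (3 powr (1/4) * golden_ratio powr (1/2) / (2 * pi)) * real n powr (-1/4) *
            exp (2 * pi * sqrt (real n / 15)))"
  proof (rule asymptotics_of_product[where H = F14 and A = hooks1_fps and C = 3])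
    show "(\<lambda>m. fps_nth hooks1_fps m * exp (- s) ^ m) sums F14 s" if "Re s > 0" for s
      unfolding F14_q by (rule hooks1_fps_sums[OF norm_q[OF that]])
    show "summable (\<lambda>m. fps_nth hooks1_fps m * q ^ m)" if "norm q < 1" for q
      by (rule sums_summable[OF hooks1_fps_sums[OF that]])
    show "(\<lambda>n. s n * F14 (s n)) \<longlonglongrightarrow> of_real (2 / 5)"
      if "\<And>n. Re (s n) > 0" "\<And>n. \<bar>Im (s n)\<bar> \<le> Re (s n)" "s \<longlonglongrightarrow> 0" for s :: "nat \<Rightarrow> complex"
      using F14_pole[OF that] by simp
    show "norm (F14 s) \<le> 3 / Re s" if "0 < Re s" "Re s \<le> 1" for s
      by (rule F14_norm_bound[OF that])
    show "fps_nth (hooks1_fps * npartitions_fps parts_14) n = of_nat (r2 1 n)" for n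
      by (rule r2_1_coeff)
  qed simp
  then show "(\<lambda>n. real (r2 1 n)) \<sim>[sequentially]
           (\<lambda>n. 3 powr (1/4) * golden_ratio powr (1/2) / (5 * pi)
                  * real n powr (-1/4) * exp (2 * pi * sqrt (real n / 15)))"
    by (simp add: mult_ac)
  have "(\<lambda>n. real (r2 2 n)) \<sim>[sequentially] (\<lambda>n. 3/5 * (3 powr (1/4) * golden_ratio powr (1/2) / (2 * pi)) * real n powr (-1/4) *
            exp (2 * pi * sqrt (real n / 15)))"
  \<comment> \<open>The bound 10 is 3 + 1 + 6, one number for each of the three summands.\<close>
  proof (rule asymptotics_of_product[where H = "\<lambda>s. F14 s - exp (- s) + F14 (2 * s)" and A = hooks2_fps and C = 10])
    show "(\<lambda>m. fps_nth hooks2_fps m * exp (- s) ^ m) sums (F14 s - exp (- s) + F14 (2 * s))" if "Re s > 0" for s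
      using hooks2_fps_sums[OF norm_q[OF that]] F14_exp[of 2 s] unfolding F14_q[of s] by simp
    show "summable (\<lambda>m. fps_nth hooks2_fps m * q ^ m)" if "norm q < 1" for q
      by (rule sums_summable[OF hooks2_fps_sums[OF that]])
    show "norm (F14 s - exp (- s) + F14 (2 * s)) \<le> 10 / Re s" if s: "0 < Re s" "Re s \<le> 1" for s
    proof -
      have "norm (F14 s - exp (- s) + F14 (2 * s)) \<le> norm (F14 s) + norm (exp (- s)) + norm (F14 (2 * s))"
        by (intro order_trans[OF norm_triangle_ineq] add_right_mono norm_triangle_ineq4)
      moreover have "norm (exp (- s)) \<le> 1" "1 \<le> 1 / Re s" using s by auto
      ultimately have "norm (F14 s - exp (- s) + F14 (2 * s)) \<le> 3 / Re s + 1 / Re s + 6 / Re s"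
        using F14_norm_bound[OF s] F14_norm_bound_double[OF s] by linarith
      then show ?thesis by (simp flip: add_divide_distrib)
    qed
    show "(\<lambda>n. s n * (F14 (s n) - exp (- s n) + F14 (2 * s n))) \<longlonglongrightarrow> of_real (3 / 5)"
      if s: "\<And>n. Re (s n) > 0" "\<And>n. \<bar>Im (s n)\<bar> \<le> Re (s n)" "s \<longlonglongrightarrow> 0" for s :: "nat \<Rightarrow> complex"
    proof -
      \<comment> \<open>The argument 2s halves the residue, and exp (- s) has no pole, so the total
        residue is 2/5 + 1/5 = 3/5. Its factor 3 later turns 3^(1/4) into 3^(5/4).\<close>
      have "(\<lambda>n. 2 * s n * F14 (2 * s n)) \<longlonglongrightarrow> 2 / 5"
        by (rule F14_pole) (use s tendsto_mult[OF tendsto_const s(3), of 2] in \<open>auto simp: abs_mult\<close>)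
      from tendsto_add[OF tendsto_diff[OF F14_pole[OF s] tendsto_mult[OF s(3) tendsto_exp[OF tendsto_minus[OF s(3)]]]]
          tendsto_mult[OF tendsto_const[of "1 / 2"] this]]
      show ?thesis by (simp add: algebra_simps)
    qed
    show "fps_nth (hooks2_fps * npartitions_fps parts_14) n = of_nat (r2 2 n)" for n
      by (rule r2_2_coeff)
  qed simp
  moreover have "3/5 * (3 powr (1/4) * golden_ratio powr (1/2) / (2 * pi)) =
      3 powr (5/4) * golden_ratio powr (1/2) / (10 * pi)"
  proof -
    have "3 powr (5/4) = 3 * (3::real) powr (1/4)"
      using powr_add[of "3::real" 1 "1/4"] by simp
    then show ?thesis by simp
  qed
  ultimately show "(\<lambda>n. real (r2 2 n)) \<sim>[sequentially]
           (\<lambda>n. 3 powr (5/4) * golden_ratio powr (1/2) / (10 * pi)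
                  * real n powr (-1/4) * exp (2 * pi * sqrt (real n / 15)))"
    by (simp only:)
qed

end
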